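(* Let $d\ge 1$ be an integer, let $0\le\gamma<d/2$, and let $\{\xi_{\vec n}:\vec n\in\mathbb{Z}^d\}$ be independent $\{0,1\}$-valued random variables on a probability space $\Omega$ such that $\mathbb{P}(\xi_{\vec n}=1)=2^{-\gamma j}$ whenever $j\ge 0$ is an integer with $2^j\le|\vec n|<2^{j+1}$. Then the following holds for all $\omega\in\Omega$ except for a set of probability $0$: if $\{\vec a_k\}_{k\in\mathbb{N}}$ is an enumeration of the set $\{\vec n\in\mathbb{Z}^d:\xi_{\vec n}(\omega)=1\}$ with $|\vec a_k|$ nondecreasing in $k$, then for any measure-preserving $\mathbb{Z}^d$-action $\mathcal{T}$ on a probability space $X$ and any $f\in L^1(X)$, the averages $$A_Nf(x):=\frac1N\sum_{k=1}^N f\circ\mathcal{T}(\vec a_k)(x)$$ converge for almost every $x\in X$ as $N\to\infty$.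
   Context: $|\cdot|$ denotes the Euclidean norm on $\mathbb{Z}^d$. A measure-preserving $\mathbb{Z}^d$-action $\mathcal{T}$ on a probability space $X$ assigns to each $\vec n\in\mathbb{Z}^d$ a measure-preserving transformation $\mathcal{T}(\vec n)$ of $X$ with $\mathcal{T}(\vec n)\circ\mathcal{T}(\vec m)=\mathcal{T}(\vec n+\vec m)$; equivalently $\mathcal{T}(\vec n)=T_1^{n_1}\cdots T_d^{n_d}$ for commuting invertible measure-preserving transformations $T_1,\dots,T_d$. The distribution of $\xi_{\vec 0}$ is arbitrary. The exceptional null set in $\Omega$ does not depend on $X$, $\mathcal{T}$ or $f$. *)

theory Defs
  imports "HOL-Probability.Probability"
begin

text \<open>The lattice is \<open>int ^ 'd\<close> with \<open>d = CARD('d)\<close>. The library has no norm on it, so the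
  Euclidean norm is taken in \<open>real ^ 'd\<close>.\<close>

definition lattice_norm :: "int ^ 'd \<Rightarrow> real" where
  "lattice_norm n = norm (\<chi> i. real_of_int (n $ i))"

definition norm_enumeration :: "(nat \<Rightarrow> int ^ 'd) \<Rightarrow> (int ^ 'd) set \<Rightarrow> bool" where
  "norm_enumeration a S \<longleftrightarrow>
     bij_betw a {1..} S \<and> mono_on {1..} (\<lambda>k. lattice_norm (a k))"

definition measure_preserving_map :: "'x measure \<Rightarrow> ('x \<Rightarrow> 'x) \<Rightarrow> bool" where
  "measure_preserving_map X g \<longleftrightarrow> g \<in> measurable X X \<and> distr X X g = X"

text \<open>The condition at \<open>0\<close> makes every \<open>T n\<close> invertible, with inverse \<open>T (- n)\<close>.\<close>

definition measure_preserving_action ::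
    "'x measure \<Rightarrow> (int ^ 'd \<Rightarrow> 'x \<Rightarrow> 'x) \<Rightarrow> bool" where
  "measure_preserving_action X T \<longleftrightarrow>
     (\<forall>n. measure_preserving_map X (T n)) \<and>
     (\<forall>x\<in>space X. T 0 x = x) \<and>
     (\<forall>n m. \<forall>x\<in>space X. T n (T m x) = T (n + m) x)"

definition sparse_average ::
    "(nat \<Rightarrow> int ^ 'd) \<Rightarrow> (int ^ 'd \<Rightarrow> 'x \<Rightarrow> 'x) \<Rightarrow> ('x \<Rightarrow> complex) \<Rightarrow> nat \<Rightarrow> 'x \<Rightarrow> complex" where
  "sparse_average a T f N x = (\<Sum>k=1..N. f (T (a k) x)) / of_nat N"

definition averages_converge_ae ::
    "(nat \<Rightarrow> int ^ 'd) \<Rightarrow> 'x measure \<Rightarrow> bool" where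
  "averages_converge_ae a X \<longleftrightarrow>
     (\<forall>T f. measure_preserving_action X T \<longrightarrow> integrable X f \<longrightarrow>
        (AE x in X. convergent (\<lambda>N. sparse_average a T f N x)))"

text \<open>The null set of exceptional \<open>\<omega>\<close> must not depend on the probability space \<open>X\<close>, and hence not
  on the type of its points either. A statement of the form \<open>AE \<omega> in M. \<forall>X :: 'x measure. \<dots>\<close> with
  a type variable \<open>'x\<close> would leave room for such a dependence, since types cannot be quantified
  inside a formula. We therefore name the exceptional set: it consists of the \<open>\<omega>\<close> for which
  convergence fails for some system carried by the fixed type of families
  \<open>int ^ 'd \<Rightarrow> complex\<close>. That convergence holds off this same set on probability spaces over
  every other type is not part of the definition and has to be asserted separately.\<close>

definition exceptional_set ::
    "'w measure \<Rightarrow> (int ^ 'd \<Rightarrow> 'w \<Rightarrow> nat) \<Rightarrow> 'w set" where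
  "exceptional_set M \<xi> = {\<omega> \<in> space M.
     \<exists>a. norm_enumeration a {n. \<xi> n \<omega> = 1} \<and>
       (\<exists>X :: (int ^ 'd \<Rightarrow> complex) measure. prob_space X \<and> \<not> averages_converge_ae a X)}"

end

theory Submission
  imports Defs "HOL-Real_Asymp.Real_Asymp"
begin

text \<open>Write \<open>p n\<close> for the probability that \<open>\<xi> n = 1\<close>, \<open>S\<close> for the random set and \<open>\<eta> = 1\<^bsub>S\<^esub> - p\<close>.
  Almost surely the correlations \<open>\<Sum>n. \<eta> n * \<eta> (n + m)\<close> over the ball of radius \<open>R\<close> are, for all large \<open>R\<close> and
  all \<open>m \<noteq> 0\<close> at once, at most \<open>R powr (- d - \<epsilon>)\<close> times the square of the mass \<open>\<Sum>n. p n\<close> of that ball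
  (Chernoff bound; \<open>\<epsilon> > 0\<close> exists because \<open>\<gamma> < d / 2\<close>). From here on \<open>S\<close> is deterministic. Expanding the square,
  the correlation bound controls the \<open>L\<^sup>2\<close> norm of the difference between the average of \<open>f\<close> over \<open>S\<close> and its
  \<open>p\<close>-weighted average; since \<open>p\<close> is radial and decreasing, the latter is a mixture of ball averages. For bounded
  \<open>f\<close> this gives convergence along the radii \<open>i ^ L\<close>, which suffices because their ratios tend to \<open>1\<close>.
  For the weak type \<open>(1,1)\<close> maximal inequality at the scale \<open>R\<close>, discard the points where the average of \<open>f\<close> over
  the ball of radius \<open>2 * R\<close> is large (they only affect the set where the ball maximal function is large) and the points
  where \<open>f\<close> exceeds \<open>R powr (d - \<gamma>)\<close> (they are few); on the remaining points the \<open>L\<^sup>2\<close> bound applies and sums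
  over dyadic \<open>R\<close>. No cancellation, hence no Calderon-Zygmund decomposition, is needed.\<close>

section \<open>Lattice points in Euclidean balls\<close>

text \<open>Why \<open>d / 2\<close> is the threshold: put \<open>a = d - \<gamma>\<close> and
  \<open>\<theta> = d / 2 - \<gamma>\<close>. A ball of radius \<open>R\<close> has mass of order
  \<open>R powr a\<close>, and a correlation at a shift \<open>m \<noteq> 0\<close> has variance at
  most of order \<open>R powr (2 * \<theta>)\<close>, the sum of the squares of \<open>p\<close>.
  About \<open>R ^ d\<close> shifts occur, so the off-diagonal part of the square, divided by the
  squared mass, has size \<open>R powr (\<theta> + d - 2 * a) = R powr (- \<theta>)\<close>. This
  decays exactly when \<open>\<gamma> < d / 2\<close>. Half of the gain is given up: correlations
  may exceed their standard deviation by the factor \<open>R powr (\<theta> / 2)\<close>. Larger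
  values have probability smaller than any power of \<open>R\<close>, which pays for the union over
  all shifts, and the decay \<open>R powr (- \<theta> / 2)\<close> is left. The exceptional set has
  to be chosen before \<open>X\<close>, whose points may have any type. The properties of
  \<open>S\<close> that are used therefore mention no dynamical system, and a system on an arbitrary
  type is pushed forward to the shift on families indexed by the lattice.\<close>

definition lat :: "int ^ 'd \<Rightarrow> real ^ 'd" where
  "lat n = (\<chi> i. real_of_int (n $ i))"

lemma lat_nth [simp]: "lat n $ i = real_of_int (n $ i)"
  by (simp add: lat_def)

lemma lat_add: "lat (n + m) = lat n + lat m"
  and lat_minus: "lat (- n) = - lat n"
  and lat_diff: "lat (n - m) = lat n - lat m"
  and lat_zero [simp]: "lat 0 = 0"
  by (simp_all add: vec_eq_iff)

lemma lattice_norm_lat: "lattice_norm n = norm (lat n)"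
  by (simp add: lattice_norm_def lat_def)

lemma lattice_norm_ge_0 [simp]: "0 \<le> lattice_norm n"
  and lattice_norm_minus [simp]: "lattice_norm (- n) = lattice_norm n"
  and lattice_norm_zero [simp]: "lattice_norm 0 = 0"
  and lattice_norm_triangle: "lattice_norm (n + m) \<le> lattice_norm n + lattice_norm m"
  and lattice_norm_dist: "lattice_norm (n - m) = dist (lat n) (lat m)"
  by (simp_all add: lattice_norm_lat lat_minus lat_add lat_diff norm_triangle_ineq dist_norm)

lemma lattice_norm_ge_1: assumes "n \<noteq> 0" shows "1 \<le> lattice_norm n"
proof -
  obtain i where i: "n $ i \<noteq> 0" using assms by (auto simp: vec_eq_iff)
  have "1 \<le> \<bar>lat n $ i\<bar>" using i by simp
  also have "\<dots> \<le> norm (lat n)" by (rule component_le_norm_cart)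
  finally show ?thesis by (simp add: lattice_norm_lat)
qed

text \<open>Open balls match the half-open shells of the hypothesis:
  \<open>lball (2 ^ (j + 1))\<close> consists of the origin and the shells up to level
  \<open>j\<close>, and \<open>lball 1\<close> is the origin alone.\<close>

definition lball :: "real \<Rightarrow> (int ^ 'd) set" where
  "lball r = {n. lattice_norm n < r}"

text \<open>The type argument carries the dimension, which the radius alone does not
  determine.\<close>

definition bcount :: "'d::finite itself \<Rightarrow> real \<Rightarrow> real" where
  "bcount t r = real (card (lball r :: (int ^ 'd) set))"

lemma mem_lball [simp]: "n \<in> lball r \<longleftrightarrow> lattice_norm n < r"
  by (simp add: lball_def)

lemma finite_lball [simp]: "finite (lball r :: (int ^ 'd) set)"
proof -
  have "\<bar>n $ i\<bar> \<le> \<lceil>r\<rceil>" if "n \<in> (lball r :: (int ^ 'd) set)" for n i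
  proof -
    have "\<bar>real_of_int (n $ i)\<bar> = \<bar>lat n $ i\<bar>" by simp
    also have "\<dots> \<le> norm (lat n)" by (rule component_le_norm_cart)
    also have "\<dots> < r" using that by (simp add: lattice_norm_lat)
    finally show ?thesis by linarith
  qed
  then have "vec_nth ` (lball r :: (int ^ 'd) set) \<subseteq> UNIV \<rightarrow>\<^sub>E {-\<lceil>r\<rceil>..\<lceil>r\<rceil>}"
    by (auto simp: PiE_iff extensional_def abs_le_iff minus_le_iff)
  then have "finite (vec_nth ` (lball r :: (int ^ 'd) set))"
    by (rule finite_subset) (intro finite_PiE, auto)
  then show ?thesis
    by (rule finite_imageD) (simp add: inj_on_def vec_nth_inject)
qed

lemma lball_mono: "r \<le> s \<Longrightarrow> lball r \<subseteq> lball s"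
  by auto

lemma bcount_mono: "r \<le> s \<Longrightarrow> bcount TYPE('d::finite) r \<le> bcount TYPE('d) s"
  unfolding bcount_def by (simp add: card_mono lball_mono)

lemma bcount_nonneg [simp]: "0 \<le> bcount t r"
  by (simp add: bcount_def)

lemma bcount_ge_1: "0 < r \<Longrightarrow> 1 \<le> bcount TYPE('d::finite) r"
proof -
  assume "0 < r"
  then have "card {0 :: int ^ 'd} \<le> card (lball r :: (int ^ 'd) set)"
    by (intro card_mono) auto
  then show ?thesis by (simp add: bcount_def)
qed

lemma bcount_pos [simp]: "0 < r \<Longrightarrow> 0 < bcount TYPE('d::finite) r"
  using bcount_ge_1[of r] by (metis less_le_trans zero_less_one)

section \<open>Counting lattice points by comparison with volume\<close>

lemma norm_diff_lat_le:
  fixes x :: "real ^ 'd::finite"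
  assumes "x \<in> cbox (lat n) (lat n + 1)"
  shows "norm (x - lat n) \<le> CARD('d)"
proof -
  have "norm (x - lat n) \<le> (\<Sum>i\<in>UNIV. \<bar>(x - lat n) $ i\<bar>)" by (rule norm_le_l1_cart)
  also have "\<dots> \<le> (\<Sum>i\<in>(UNIV::'d set). 1)"
    using assms by (intro sum_mono) (auto simp: mem_box_cart abs_le_iff algebra_simps dest!: spec)
  finally show ?thesis by simp
qed

lemma measure_unit_cube:
  fixes n :: "int ^ 'd::finite"
  shows "measure lborel (box (lat n) (lat n + 1)) = 1" "measure lborel (cbox (lat n) (lat n + 1)) = 1"
proof -
  have le: "lat n \<bullet> b \<le> (lat n + 1) \<bullet> b" if "b \<in> Basis" for b
    using that by (auto simp: Basis_vec_def inner_axis algebra_simps)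
  have one: "(\<Prod>b\<in>Basis. (lat n + 1 - lat n) \<bullet> b) = 1"
    by (intro prod.neutral) (auto simp: Basis_vec_def inner_axis)
  show "measure lborel (box (lat n) (lat n + 1)) = 1" "measure lborel (cbox (lat n) (lat n + 1)) = 1"
    using measure_lborel_box[OF le] measure_lborel_cbox[OF le] one by auto
qed

text \<open>Open unit cubes anchored at lattice points are disjoint and stay within distance
  \<open>CARD('d)\<close> of their anchors, so their total volume is at most that of the enlarged
  ball.\<close>

lemma bcount_volume_upper:
  assumes "0 \<le> r"
  shows "bcount TYPE('d::finite) r \<le> unit_ball_vol CARD('d) * (r + CARD('d)) ^ CARD('d)"
proof -
  let ?L = "lball r :: (int ^ 'd) set"
  let ?Q = "\<lambda>n :: int ^ 'd. box (lat n) (lat n + 1)"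
  have disj: "disjoint_family_on ?Q ?L"
  proof (unfold disjoint_family_on_def, safe)
    fix n m :: "int ^ 'd" and x assume nm: "n \<noteq> m" and x: "x \<in> ?Q n" "x \<in> ?Q m"
    have "n $ i = m $ i" for i
    proof -
      have "real_of_int (n $ i) < real_of_int (m $ i) + 1" "real_of_int (m $ i) < real_of_int (n $ i) + 1"
        using x unfolding mem_box_cart by (auto dest!: spec[of _ i])
      then show ?thesis by linarith
    qed
    with nm show "x \<in> {}" by (auto simp: vec_eq_iff)
  qed
  have fm: "?Q n \<in> fmeasurable lborel" for n
    by (rule fmeasurableI) (auto simp: emeasure_lborel_box_eq)
  have sub: "(\<Union>n\<in>?L. ?Q n) \<subseteq> ball 0 (r + CARD('d))"
  proof safe
    fix n :: "int ^ 'd" and x assume n: "n \<in> ?L" and x: "x \<in> ?Q n"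
    have "norm (x - lat n) \<le> CARD('d)" using x box_subset_cbox by (blast intro: norm_diff_lat_le)
    moreover have "norm x \<le> norm (lat n) + norm (x - lat n)"
      using norm_triangle_ineq[of "lat n" "x - lat n"] by simp
    ultimately show "x \<in> ball 0 (r + CARD('d))" using n by (simp add: lattice_norm_lat)
  qed
  have "bcount TYPE('d) r = (\<Sum>n\<in>?L. measure lborel (?Q n))"
    by (simp add: measure_unit_cube bcount_def)
  also have "\<dots> = measure lborel (\<Union>n\<in>?L. ?Q n)"
    by (rule measure_UNION'[symmetric]) (use disj fm in \<open>auto simp: disjoint_family_on_def pairwise_def disjnt_def\<close>)
  also have "\<dots> \<le> measure lborel (ball (0 :: real ^ 'd) (r + CARD('d)))"
    by (rule measure_mono_fmeasurable[OF sub]) (use assms in \<open>auto intro!: fmeasurableI simp: emeasure_ball\<close>)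
  also have "\<dots> = unit_ball_vol CARD('d) * (r + CARD('d)) ^ CARD('d)"
    using content_ball[of "r + CARD('d)" "0 :: real ^ 'd"] assms by simp
  finally show ?thesis .
qed

text \<open>Closed cubes are used here because they must cover: rounding the coordinates down finds
  a cube for each point of the smaller ball.\<close>

lemma bcount_volume_lower:
  assumes "real CARD('d::finite) \<le> r"
  shows "unit_ball_vol CARD('d) * (r - CARD('d)) ^ CARD('d) \<le> bcount TYPE('d) r"
proof -
  let ?L = "lball r :: (int ^ 'd) set"
  let ?Q = "\<lambda>n :: int ^ 'd. cbox (lat n) (lat n + 1)"
  have fm: "?Q n \<in> fmeasurable lborel" for n
    by (rule fmeasurableI) (auto simp: emeasure_lborel_cbox_eq)
  have sub: "ball 0 (r - CARD('d)) \<subseteq> (\<Union>n\<in>?L. ?Q n)"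
  proof
    fix x :: "real ^ 'd" assume x: "x \<in> ball 0 (r - CARD('d))"
    define n :: "int ^ 'd" where "n = (\<chi> i. \<lfloor>x $ i\<rfloor>)"
    have xQ: "x \<in> ?Q n"
      by (auto simp: mem_box_cart n_def intro: less_imp_le)
    have "norm (x - lat n) \<le> CARD('d)" using xQ by (rule norm_diff_lat_le)
    moreover have "norm (lat n) \<le> norm x + norm (x - lat n)"
      using norm_triangle_ineq[of "x" "lat n - x"] by (simp add: norm_minus_commute)
    ultimately have "n \<in> ?L" using x by (simp add: lattice_norm_lat)
    with xQ show "x \<in> (\<Union>n\<in>?L. ?Q n)" by blast
  qed
  have "unit_ball_vol CARD('d) * (r - CARD('d)) ^ CARD('d) = measure lborel (ball (0 :: real ^ 'd) (r - CARD('d)))"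
    using content_ball[of "r - CARD('d)" "0 :: real ^ 'd"] assms by simp
  also have "\<dots> \<le> measure lborel (\<Union>n\<in>?L. ?Q n)"
    by (rule measure_mono_fmeasurable[OF sub]) (auto intro!: fmeasurable.finite_UN fm)
  also have "\<dots> \<le> (\<Sum>n\<in>?L. measure lborel (?Q n))"
    by (rule measure_UNION_le) auto
  also have "\<dots> = bcount TYPE('d) r"
    by (simp add: measure_unit_cube bcount_def)
  finally show ?thesis .
qed

lemma bcount_asymp:
  "((\<lambda>r. bcount TYPE('d::finite) r / r ^ CARD('d)) \<longlongrightarrow> unit_ball_vol CARD('d)) at_top"
proof (rule real_tendsto_sandwich)
  let ?d = "real CARD('d)" and ?v = "unit_ball_vol CARD('d)"
  show "\<forall>\<^sub>F r in at_top. ?v * ((r - ?d) / r) ^ CARD('d) \<le> bcount TYPE('d) r / r ^ CARD('d)"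
    using eventually_ge_at_top[of "?d"] eventually_gt_at_top[of 0]
    by eventually_elim (use bcount_volume_lower[where 'd='d] in \<open>simp add: power_divide divide_right_mono\<close>)
  show "\<forall>\<^sub>F r in at_top. bcount TYPE('d) r / r ^ CARD('d) \<le> ?v * ((r + ?d) / r) ^ CARD('d)"
    using eventually_gt_at_top[of 0]
    by eventually_elim (use bcount_volume_upper[where 'd='d] in \<open>simp add: power_divide divide_right_mono\<close>)
  have "((\<lambda>r. (r - ?d) / r) \<longlongrightarrow> 1) at_top" "((\<lambda>r. (r + ?d) / r) \<longlongrightarrow> 1) at_top"
    by real_asymp+
  then have *: "((\<lambda>r. ?v * ((r - ?d) / r) ^ CARD('d)) \<longlongrightarrow> ?v * 1 ^ CARD('d)) at_top"
      "((\<lambda>r. ?v * ((r + ?d) / r) ^ CARD('d)) \<longlongrightarrow> ?v * 1 ^ CARD('d)) at_top"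
    by (auto intro!: tendsto_intros simp del: power_one)
  from * show "((\<lambda>r. ?v * ((r - ?d) / r) ^ CARD('d)) \<longlongrightarrow> ?v) at_top"
      "((\<lambda>r. ?v * ((r + ?d) / r) ^ CARD('d)) \<longlongrightarrow> ?v) at_top" by simp_all
qed

text \<open>Two-sided bounds would not do here: the leading constant of the volume asymptotic has to
  cancel. The Folner property of balls and the slow growth of the weighted mass both rest on this
  limit.\<close>

lemma bcount_ratio:
  fixes r s :: "nat \<Rightarrow> real"
  assumes "filterlim r at_top sequentially" "filterlim s at_top sequentially"
    and "(\<lambda>i. s i / r i) \<longlonglongrightarrow> 1"
  shows "(\<lambda>i. bcount TYPE('d::finite) (s i) / bcount TYPE('d) (r i)) \<longlonglongrightarrow> 1"
proof -
  let ?v = "unit_ball_vol CARD('d)"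
  have v: "?v \<noteq> 0" using unit_ball_vol_pos[of "CARD('d)"] by linarith
  have a: "(\<lambda>i. bcount TYPE('d) (r i) / r i ^ CARD('d)) \<longlonglongrightarrow> ?v"
    by (rule filterlim_compose[OF bcount_asymp assms(1)])
  have b: "(\<lambda>i. bcount TYPE('d) (s i) / s i ^ CARD('d)) \<longlonglongrightarrow> ?v"
    by (rule filterlim_compose[OF bcount_asymp assms(2)])
  have "(\<lambda>i. (bcount TYPE('d) (s i) / s i ^ CARD('d)) / (bcount TYPE('d) (r i) / r i ^ CARD('d)) * (s i / r i) ^ CARD('d))
    \<longlonglongrightarrow> ?v / ?v * 1 ^ CARD('d)"
    by (intro tendsto_intros a b v assms)
  also have "?v / ?v * 1 ^ CARD('d) = 1" using v by simp
  finally show ?thesis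
  proof (rule Lim_transform_eventually)
    show "\<forall>\<^sub>F i in sequentially. (bcount TYPE('d) (s i) / s i ^ CARD('d)) / (bcount TYPE('d) (r i) / r i ^ CARD('d)) * (s i / r i) ^ CARD('d)
      = bcount TYPE('d) (s i) / bcount TYPE('d) (r i)"
      using filterlim_at_top_dense[THEN iffD1, OF assms(1), rule_format, of 0]
        filterlim_at_top_dense[THEN iffD1, OF assms(2), rule_format, of 0]
      by eventually_elim (simp add: power_divide)
  qed
qed

lemma bcount_bounds:
  obtains c C where "0 < c" "0 < C"
    "\<And>r. 1 \<le> r \<Longrightarrow> c * r ^ CARD('d) \<le> bcount TYPE('d::finite) r"
    "\<And>r. 1 \<le> r \<Longrightarrow> bcount TYPE('d) r \<le> C * r ^ CARD('d)"
proof -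
  let ?v = "unit_ball_vol CARD('d)" and ?d = "real CARD('d)"
  have v: "?v > 0" by simp
  have d1: "?d \<ge> 1" by (simp add: Suc_leI)
  \<comment> \<open>Below radius \<open>2 * ?d\<close> the volume bound degenerates. There the
    second entry of the minimum makes the left side at most 1, and the origin alone
    suffices.\<close>
  define c where "c = min (?v * (1/2) ^ CARD('d)) ((1 / (2 * ?d)) ^ CARD('d))"
  define C where "C = ?v * (1 + ?d) ^ CARD('d)"
  have "c > 0" "C > 0" using v d1 by (auto simp: c_def C_def intro!: mult_pos_pos)
  moreover have "c * r ^ CARD('d) \<le> bcount TYPE('d) r" if r: "1 \<le> r" for r
  proof (cases "2 * ?d \<le> r")
    case True
    have "c * r ^ CARD('d) \<le> (?v * (1/2) ^ CARD('d)) * r ^ CARD('d)"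
      using r by (intro mult_right_mono) (auto simp: c_def)
    also have "\<dots> = ?v * (r / 2) ^ CARD('d)" by (simp add: power_divide)
    also have "\<dots> \<le> ?v * (r - ?d) ^ CARD('d)"
      using True r v by (intro mult_left_mono power_mono) auto
    also have "\<dots> \<le> bcount TYPE('d) r" using True d1 by (intro bcount_volume_lower) auto
    finally show ?thesis .
  next
    case False
    have "c * r ^ CARD('d) \<le> (1 / (2 * ?d)) ^ CARD('d) * r ^ CARD('d)"
      using r by (intro mult_right_mono) (auto simp: c_def)
    also have "\<dots> = (r / (2 * ?d)) ^ CARD('d)" by (simp add: power_divide power_mult_distrib)
    also have "\<dots> \<le> 1" using False r d1 by (intro power_le_one) (auto simp: divide_simps)
    also have "\<dots> \<le> bcount TYPE('d) r" using r by (intro bcount_ge_1) auto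
    finally show ?thesis .
  qed
  moreover have "bcount TYPE('d) r \<le> C * r ^ CARD('d)" if r: "1 \<le> r" for r
  proof -
    have "bcount TYPE('d) r \<le> ?v * (r + ?d) ^ CARD('d)" using r by (intro bcount_volume_upper) auto
    also have "\<dots> \<le> ?v * ((1 + ?d) * r) ^ CARD('d)"
      using r v d1 by (intro mult_left_mono power_mono) (auto simp: algebra_simps)
    also have "\<dots> = C * r ^ CARD('d)" by (simp add: C_def power_mult_distrib)
    finally show ?thesis .
  qed
  ultimately show ?thesis by (rule that)
qed

text \<open>The factor 5 is the dilation in the Vitali covering lemma.\<close>

lemma bcount_doubling:
  obtains D where "1 \<le> D" "\<And>r. 1 \<le> r \<Longrightarrow> bcount TYPE('d::finite) (5 * r) \<le> D * bcount TYPE('d) r"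
proof -
  obtain c C where c: "0 < c" "0 < C"
    "\<And>r. 1 \<le> r \<Longrightarrow> c * r ^ CARD('d) \<le> bcount TYPE('d::finite) r"
    "\<And>r. 1 \<le> r \<Longrightarrow> bcount TYPE('d) r \<le> C * r ^ CARD('d)" using bcount_bounds[where 'd='d] by metis
  define D where "D = C * 5 ^ CARD('d) / c"
  have *: "bcount TYPE('d) (5 * r) \<le> D * bcount TYPE('d) r" if r: "1 \<le> r" for r
  proof -
    have "bcount TYPE('d) (5 * r) \<le> C * (5 * r) ^ CARD('d)" using r by (intro c) auto
    also have "\<dots> = D * (c * r ^ CARD('d))" using c by (simp add: D_def power_mult_distrib)
    also have "\<dots> \<le> D * bcount TYPE('d) r" using c r by (intro mult_left_mono) (auto simp: D_def)
    finally show ?thesis .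
  qed
  have "bcount TYPE('d) 1 \<le> D * bcount TYPE('d) 1"
    using order_trans[OF bcount_mono[of 1 5, where 'd='d]] *[of 1] by simp
  then have "1 \<le> D" using bcount_pos[of 1, where 'd='d]
    by (metis mult_1 mult_right_le_imp_le zero_less_one)
  with * show ?thesis using that by blast
qed

section \<open>The maximal inequality for ball averages\<close>

lemma card_translate_lball:
  "real (card {k :: int ^ 'd. lattice_norm (k - n) < r}) = bcount TYPE('d::finite) r"
proof -
  have "{k :: int ^ 'd. lattice_norm (k - n) < r} = (\<lambda>m. m + n) ` lball r"
    by (force intro: image_eqI[of _ _ "k - n" for k])
  then show ?thesis by (simp add: bcount_def card_image)
qed

locale zd_action = prob_space X for X :: "'x measure" +
  fixes T :: "int ^ 'd::finite \<Rightarrow> 'x \<Rightarrow> 'x"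
  assumes action: "measure_preserving_action X T"
begin

lemma T_measurable [measurable]: "T n \<in> measurable X X"
  using action by (simp add: measure_preserving_action_def measure_preserving_map_def)

lemma distr_T: "distr X X (T n) = X"
  using action by (simp add: measure_preserving_action_def measure_preserving_map_def)

lemma T_space [simp]: "x \<in> space X \<Longrightarrow> T n x \<in> space X"
  by (rule measurable_space[OF T_measurable])

lemma T_zero [simp]: "x \<in> space X \<Longrightarrow> T 0 x = x"
  using action by (simp add: measure_preserving_action_def)

lemma T_add: "x \<in> space X \<Longrightarrow> T n (T m x) = T (n + m) x"
  using action by (simp add: measure_preserving_action_def)

lemma integral_T:
  fixes f :: "'x \<Rightarrow> real"
  assumes "f \<in> borel_measurable X"
  shows "(\<integral>x. f (T n x) \<partial>X) = (\<integral>x. f x \<partial>X)"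
  using integral_distr[of "T n" X X f] assms by (simp add: distr_T)

lemma integrable_T:
  fixes f :: "'x \<Rightarrow> real"
  assumes "integrable X f"
  shows "integrable X (\<lambda>x. f (T n x))"
  using integrable_distr[of "T n" X X f] assms by (simp add: distr_T)

lemma measure_T:
  assumes "A \<in> sets X"
  shows "measure X {x \<in> space X. T n x \<in> A} = measure X A"
proof -
  have "measure X A = measure (distr X X (T n)) A" by (simp add: distr_T)
  also have "\<dots> = measure X (T n -` A \<inter> space X)" using assms by (intro measure_distr) auto
  also have "T n -` A \<inter> space X = {x \<in> space X. T n x \<in> A}" by auto
  finally show ?thesis by simp
qed

definition osum :: "('x \<Rightarrow> real) \<Rightarrow> real \<Rightarrow> 'x \<Rightarrow> real" where
  "osum f r x = (\<Sum>n\<in>lball r. f (T n x))"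

lemma osum_measurable [measurable]:
  assumes [measurable]: "f \<in> borel_measurable X"
  shows "osum f r \<in> borel_measurable X"
  unfolding osum_def by measurable

lemma osum_integrable: "integrable X f \<Longrightarrow> integrable X (osum f r)"
  unfolding osum_def by (intro Bochner_Integration.integrable_sum integrable_T)

lemma osum_shift:
  assumes "x \<in> space X"
  shows "osum f r (T n x) = (\<Sum>k | lattice_norm (k - n) < r. f (T k x))"
  unfolding osum_def using assms
  by (intro sum.reindex_bij_witness[of _ "\<lambda>k. k - n" "\<lambda>m. m + n"]) (auto simp: T_add)

text \<open>Each \<open>n \<in> K\<close> carries a ball on which the orbit sum exceeds the number
  of its points. Vitali's lemma in \<open>real ^ 'd\<close> selects disjoint balls whose fivefold
  dilates cover \<open>K\<close>. Doubling brings the dilates back to the selected balls, and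
  disjointness lets their orbit sums add up without repetition inside the ball of radius
  \<open>2 * R\<close>.\<close>

lemma maximal_covering:
  fixes f :: "'x \<Rightarrow> real" and R :: nat
  assumes f: "\<And>x. x \<in> space X \<Longrightarrow> 0 \<le> f x"
    and D: "0 \<le> D" "\<And>r. 1 \<le> r \<Longrightarrow> bcount TYPE('d) (5 * r) \<le> D * bcount TYPE('d) r"
    and x: "x \<in> space X"
  defines "K \<equiv> {n \<in> lball R. \<exists>r\<in>{1..R}. bcount TYPE('d) r < osum f r (T n x)}"
  shows "real (card K) \<le> D * osum f (2 * real R) x"
proof -
  have "\<forall>n\<in>K. \<exists>r\<in>{1..R}. bcount TYPE('d) r < osum f r (T n x)" by (auto simp: K_def)
  then obtain \<rho> where \<rho>: "\<And>n. n \<in> K \<Longrightarrow> \<rho> n \<in> {1..R} \<and> bcount TYPE('d) (\<rho> n) < osum f (\<rho> n) (T n x)"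
    by metis
  have finK: "finite K" unfolding K_def by (rule finite_subset[of _ "lball R"]) auto
  have \<rho>1: "real (\<rho> n) \<ge> 1" if "n \<in> K" for n using \<rho>[OF that] by auto
  have cover: "lat ` K \<subseteq> (\<Union>i\<in>K. ball (lat i) (real (\<rho> i)))"
  proof
    fix y assume "y \<in> lat ` K"
    then obtain n where "n \<in> K" "y = lat n" by auto
    then show "y \<in> (\<Union>i\<in>K. ball (lat i) (real (\<rho> i)))" using \<rho>1[of n] by (auto intro!: bexI[of _ n])
  qed
  have pos: "0 < real (\<rho> n) \<and> real (\<rho> n) \<le> real R" if "n \<in> K" for n using \<rho>[OF that] by auto
  obtain C where "countable C" and C: "C \<subseteq> K"
     "pairwise (\<lambda>i j. disjnt (ball (lat i) (\<rho> i)) (ball (lat j) (\<rho> j))) C"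
     "lat ` K \<subseteq> (\<Union>i\<in>C. ball (lat i) (5 * real (\<rho> i)))"
    by (rule Vitali_covering_lemma_balls[OF cover pos])
  let ?B = "\<lambda>n r. {k :: int ^ 'd. lattice_norm (k - n) < r}"
  have finB: "finite (?B n r)" for n r
    by (rule finite_subset[of _ "(\<lambda>m. m + n) ` lball r"]) (force intro: image_eqI[of _ _ "k - n" for k])+
  have finC: "finite C" using C finK finite_subset by blast
  have KB: "K \<subseteq> (\<Union>n\<in>C. ?B n (5 * real (\<rho> n)))"
  proof
    fix k assume "k \<in> K"
    then obtain n where "n \<in> C" "lat k \<in> ball (lat n) (5 * real (\<rho> n))" using C(3) by blast
    then show "k \<in> (\<Union>n\<in>C. ?B n (5 * real (\<rho> n)))" by (auto simp: lattice_norm_dist dist_commute)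
  qed
  have disj: "?B n (\<rho> n) \<inter> ?B m (\<rho> m) = {}" if "n \<in> C" "m \<in> C" "n \<noteq> m" for n m
  proof -
    have "disjnt (ball (lat n) (\<rho> n)) (ball (lat m) (\<rho> m))" using C(2) that by (auto simp: pairwise_def)
    moreover have "lat k \<in> ball (lat n) (\<rho> n)" if "k \<in> ?B n (\<rho> n)" for k n
      using that by (auto simp: lattice_norm_dist dist_commute)
    ultimately show ?thesis unfolding disjnt_def by blast
  qed
  have "card K \<le> card (\<Union>n\<in>C. ?B n (5 * real (\<rho> n)))" using finC finB KB by (intro card_mono) auto
  also have "\<dots> \<le> (\<Sum>n\<in>C. card (?B n (5 * real (\<rho> n))))" using finC by (rule card_UN_le)
  finally have "real (card K) \<le> (\<Sum>n\<in>C. real (card (?B n (5 * real (\<rho> n)))))"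
    unfolding of_nat_sum[symmetric] of_nat_le_iff .
  also have "\<dots> = (\<Sum>n\<in>C. bcount TYPE('d) (5 * real (\<rho> n)))" by (simp add: card_translate_lball)
  also have "\<dots> \<le> (\<Sum>n\<in>C. D * osum f (\<rho> n) (T n x))"
  proof (rule sum_mono)
    fix n assume n: "n \<in> C"
    then have nK: "n \<in> K" using C by auto
    have "bcount TYPE('d) (5 * real (\<rho> n)) \<le> D * bcount TYPE('d) (\<rho> n)" using \<rho>1[OF nK] by (rule D)
    also have "\<dots> \<le> D * osum f (\<rho> n) (T n x)" using \<rho>[OF nK] D(1) by (intro mult_left_mono) auto
    finally show "bcount TYPE('d) (5 * real (\<rho> n)) \<le> D * osum f (\<rho> n) (T n x)" .
  qed
  also have "\<dots> = D * (\<Sum>n\<in>C. \<Sum>k\<in>?B n (\<rho> n). f (T k x))"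
    by (simp add: osum_shift[OF x] sum_distrib_left)
  also have "(\<Sum>n\<in>C. \<Sum>k\<in>?B n (\<rho> n). f (T k x)) = (\<Sum>k\<in>(\<Union>n\<in>C. ?B n (\<rho> n)). f (T k x))"
    using finC finB disj by (intro sum.UNION_disjoint[symmetric]) auto
  also have "\<dots> \<le> osum f (2 * real R) x"
    unfolding osum_def
  proof (rule sum_mono2)
    show "(\<Union>n\<in>C. ?B n (\<rho> n)) \<subseteq> lball (2 * real R)"
    proof safe
      fix n k assume "n \<in> C" and k: "lattice_norm (k - n) < \<rho> n"
      then have n: "n \<in> K" using C by auto
      have "lattice_norm k \<le> lattice_norm (k - n) + lattice_norm n"
        using lattice_norm_triangle[of "k - n" n] by simp
      then show "k \<in> lball (2 * real R)" using k n \<rho>[OF n] by (auto simp: K_def)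
    qed
  qed (use f x in auto)
  finally show ?thesis using D(1) by (simp add: mult_left_mono)
qed

text \<open>Transference: the covering estimate holds along every orbit, and integrating it over \<open>X\<close> with orbit
  window and radius bound both equal to \<open>R\<close> loses only a doubling constant.\<close>

lemma maximal_window:
  fixes f :: "'x \<Rightarrow> real" and R :: nat
  assumes f: "\<And>x. x \<in> space X \<Longrightarrow> 0 \<le> f x" "integrable X f"
    and D: "0 \<le> D" "\<And>r. 1 \<le> r \<Longrightarrow> bcount TYPE('d) (5 * r) \<le> D * bcount TYPE('d) r"
    and R: "1 \<le> R"
  shows "measure X {x \<in> space X. \<exists>r\<in>{1..R}. bcount TYPE('d) r < osum f r x} \<le> D * D * (\<integral>x. f x \<partial>X)"
proof -
  have [measurable]: "f \<in> borel_measurable X" using f(2) by auto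
  define E where "E = {x \<in> space X. \<exists>r\<in>{1..R}. bcount TYPE('d) r < osum f r x}"
  have E [measurable]: "E \<in> sets X" unfolding E_def by measurable
  have int0: "0 \<le> (\<integral>x. f x \<partial>X)" using f(1) by (intro integral_nonneg_AE) auto
  have intT: "(\<integral>x. osum f r x \<partial>X) = bcount TYPE('d) r * (\<integral>x. f x \<partial>X)" for r
    unfolding osum_def
    by (subst Bochner_Integration.integral_sum) (auto simp: integral_T bcount_def intro: integrable_T f)
  have "bcount TYPE('d) R * measure X E = (\<Sum>n\<in>(lball R :: (int ^ 'd) set). measure X {x \<in> space X. T n x \<in> E})"
    by (simp add: measure_T bcount_def)
  also have "\<dots> = (\<Sum>n\<in>(lball R :: (int ^ 'd) set). \<integral>x. indicator {x \<in> space X. T n x \<in> E} x \<partial>X)"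
    by (intro sum.cong refl) simp
  also have "\<dots> = (\<integral>x. (\<Sum>n\<in>(lball R :: (int ^ 'd) set). indicator {x \<in> space X. T n x \<in> E} x) \<partial>X)"
    by (rule Bochner_Integration.integral_sum[symmetric]) (auto simp: emeasure_eq_measure)
  also have "\<dots> \<le> (\<integral>x. D * osum f (2 * real R) x \<partial>X)"
  proof (rule integral_mono)
    fix x assume x: "x \<in> space X"
    have "(\<Sum>n\<in>(lball R :: (int ^ 'd) set). indicator {x \<in> space X. T n x \<in> E} x :: real)
        = (\<Sum>n\<in>(lball R :: (int ^ 'd) set). if T n x \<in> E then 1 else 0)"
      using x by (intro sum.cong) (auto simp: indicator_def)
    also have "\<dots> = real (card {n \<in> lball R. T n x \<in> E})"
      by (subst sum.If_cases) (auto simp: Int_def)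
    also have "{n \<in> lball R. T n x \<in> E} = {n \<in> lball R. \<exists>r\<in>{1..R}. bcount TYPE('d) r < osum f r (T n x)}"
      using x by (auto simp: E_def)
    also have "real (card \<dots>) \<le> D * osum f (2 * real R) x" by (rule maximal_covering[OF f(1) D x])
    finally show "(\<Sum>n\<in>(lball R :: (int ^ 'd) set). indicator {x \<in> space X. T n x \<in> E} x) \<le> D * osum f (2 * real R) x" .
  qed (use f in \<open>auto simp: emeasure_eq_measure intro!: osum_integrable Bochner_Integration.integrable_sum\<close>)
  also have "\<dots> = D * (bcount TYPE('d) (2 * real R) * (\<integral>x. f x \<partial>X))" by (simp add: intT)
  \<comment> \<open>Since \<open>2 * R \<le> 5 * R\<close>, the constant of the covering argument
    also pays for enlarging the orbit window.\<close>
  also have "\<dots> \<le> D * ((D * bcount TYPE('d) R) * (\<integral>x. f x \<partial>X))"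
    using D(2)[of "real R"] R D(1) int0 bcount_mono[of "2 * real R" "5 * real R", where 'd='d]
    by (intro mult_left_mono mult_right_mono) auto
  finally have "measure X E * bcount TYPE('d) R \<le> (D * D * (\<integral>x. f x \<partial>X)) * bcount TYPE('d) R"
    by (simp add: mult_ac)
  then show ?thesis unfolding E_def by (rule mult_right_le_imp_le) (use R in simp)
qed

lemma maximal_inequality:
  fixes f :: "'x \<Rightarrow> real"
  assumes f: "\<And>x. x \<in> space X \<Longrightarrow> 0 \<le> f x" "integrable X f"
    and D: "0 \<le> D" "\<And>r. 1 \<le> r \<Longrightarrow> bcount TYPE('d) (5 * r) \<le> D * bcount TYPE('d) r"
    and c: "0 < c"
  shows "measure X {x \<in> space X. \<exists>r::nat. 1 \<le> r \<and> c * bcount TYPE('d) r < osum f r x} \<le> D * D * (\<integral>x. f x \<partial>X) / c"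
proof -
  have [measurable]: "f \<in> borel_measurable X" using f(2) by auto
  let ?f = "\<lambda>x. f x / c"
  \<comment> \<open>\<open>Suc R\<close> makes every radius bound at least 1, as
    \<open>maximal_window\<close> requires. The bound is uniform in the window, so it survives the
    increasing limit.\<close>
  define E where "E R = {x \<in> space X. \<exists>r\<in>{1..Suc R}. bcount TYPE('d) (real r) < osum ?f (real r) x}" for R
  have "(\<lambda>R. measure X (E R)) \<longlonglongrightarrow> measure X (\<Union>R. E R)"
  proof (rule finite_Lim_measure_incseq)
    show "range E \<subseteq> sets X" unfolding E_def by auto
    show "incseq E" by (rule incseq_SucI) (auto simp: E_def intro: rev_bexI)
  qed
  moreover have "measure X (E R) \<le> D * D * (\<integral>x. ?f x \<partial>X)" for R
    unfolding E_def
  proof (rule maximal_window[OF _ _ D])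
    show "integrable X ?f" using f(2) by simp
    show "0 \<le> ?f x" if "x \<in> space X" for x using f(1)[OF that] c by simp
  qed simp_all
  ultimately have "measure X (\<Union>R. E R) \<le> D * D * (\<integral>x. ?f x \<partial>X)"
    by (intro LIMSEQ_le_const2[of "\<lambda>R. measure X (E R)"] exI[of _ 0]) simp_all
  moreover have "(\<Union>R. E R) = {x \<in> space X. \<exists>r::nat. 1 \<le> r \<and> c * bcount TYPE('d) r < osum f r x}"
  proof -
    have *: "bcount TYPE('d) (real r) < osum ?f (real r) x \<longleftrightarrow> c * bcount TYPE('d) r < osum f r x" for r :: nat and x
      using c by (simp add: osum_def sum_divide_distrib[symmetric] pos_less_divide_eq mult.commute)
    show ?thesis
    proof (intro equalityI subsetI)
      fix x assume "x \<in> {x \<in> space X. \<exists>r::nat. 1 \<le> r \<and> c * bcount TYPE('d) r < osum f r x}"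
      then obtain r :: nat where "x \<in> space X" "1 \<le> r" "c * bcount TYPE('d) r < osum f r x" by auto
      then have "x \<in> E r" unfolding E_def * by (auto intro!: bexI[of _ r])
      then show "x \<in> (\<Union>R. E R)" by blast
    qed (auto simp: E_def *)
  qed
  ultimately show ?thesis by simp
qed

end

section \<open>Pointwise convergence of ball averages of bounded functions\<close>

text \<open>Borel-Cantelli with \<open>e = (1/2) ^ k\<close>: almost every point lies in only
  finitely many of the exceptional sets, so its sequence is Cauchy. No candidate for the limit is
  needed, and measurability is asked of the sets \<open>A\<close>, not of the oscillation.\<close>

lemma (in finite_measure) AE_convergent_of_oscillation:
  fixes u :: "nat \<Rightarrow> 'a \<Rightarrow> 'b :: {complete_space}"
  assumes *: "\<And>e::real. 0 < e \<Longrightarrow> \<exists>A\<in>sets M. measure M A \<le> e \<and>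
    (AE x in M. x \<notin> A \<longrightarrow> (\<exists>N. \<forall>r\<ge>N. \<forall>s\<ge>N. dist (u r x) (u s x) \<le> e))"
  shows "AE x in M. convergent (\<lambda>n. u n x)"
proof -
  have "\<forall>k. \<exists>A. A \<in> sets M \<and> measure M A \<le> (1/2) ^ k \<and>
    (AE x in M. x \<notin> A \<longrightarrow> (\<exists>N. \<forall>r\<ge>N. \<forall>s\<ge>N. dist (u r x) (u s x) \<le> (1/2) ^ k))"
    (is "\<forall>k. \<exists>A. ?P k A")
  proof
    fix k :: nat
    have "0 < (1/2::real) ^ k" by simp
    from *[OF this] show "\<exists>A. ?P k A" by (auto simp only: Bex_def)
  qed
  from choice[OF this] obtain A where "\<forall>k. ?P k (A k)" by (rule exE)
  then have A: "\<And>k. A k \<in> sets M" "\<And>k. measure M (A k) \<le> (1/2) ^ k"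
    "\<And>k. AE x in M. x \<notin> A k \<longrightarrow> (\<exists>N. \<forall>r\<ge>N. \<forall>s\<ge>N. dist (u r x) (u s x) \<le> (1/2) ^ k)"
    by (simp_all only:)
  have "AE x in M. eventually (\<lambda>k. x \<in> space M - A k) sequentially"
  proof (rule borel_cantelli_AE1)
    show "summable (\<lambda>k. measure M (A k))"
      by (rule summable_comparison_test'[of "\<lambda>k. (1/2::real) ^ k"]) (use A in auto)
  qed (use A in \<open>auto simp: emeasure_eq_measure\<close>)
  moreover have "AE x in M. \<forall>k. x \<notin> A k \<longrightarrow> (\<exists>N. \<forall>r\<ge>N. \<forall>s\<ge>N. dist (u r x) (u s x) \<le> (1/2) ^ k)"
    using A(3) by (simp add: AE_all_countable)
  ultimately show ?thesis
  proof eventually_elim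
    fix x assume x: "eventually (\<lambda>k. x \<in> space M - A k) sequentially"
      "\<forall>k. x \<notin> A k \<longrightarrow> (\<exists>N. \<forall>r\<ge>N. \<forall>s\<ge>N. dist (u r x) (u s x) \<le> (1/2) ^ k)"
    have "Cauchy (\<lambda>n. u n x)"
    proof (rule metric_CauchyI)
      fix e :: real assume e: "0 < e"
      have "(\<lambda>k. (1/2::real) ^ k) \<longlonglongrightarrow> 0" by (rule LIMSEQ_power_zero) simp
      then have "eventually (\<lambda>k. (1/2::real) ^ k < e) sequentially" using e by (rule order_tendstoD)
      with x(1) have "eventually (\<lambda>k. x \<in> space M - A k \<and> (1/2::real) ^ k < e) sequentially"
        by (rule eventually_conj)
      then obtain k where "x \<notin> A k" "(1/2::real) ^ k < e"
        by (auto dest!: eventually_happens)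
      with x(2) show "\<exists>N. \<forall>r\<ge>N. \<forall>s\<ge>N. dist (u r x) (u s x) < e"
        by (meson le_less_trans)
    qed
    then show "convergent (\<lambda>n. u n x)" by (simp add: Cauchy_convergent_iff)
  qed
qed

text \<open>Relative size of the shell between the radii \<open>q\<close> and \<open>q + s\<close>.
  It bounds the proportion of a ball that changes under translation by a vector of norm at most
  \<open>s\<close>; the factor 2 counts points lost and points gained.\<close>

definition folner :: "'d::finite itself \<Rightarrow> real \<Rightarrow> real \<Rightarrow> real" where
  "folner t q s = 2 * (bcount t (q + s) - bcount t q) / bcount t q"

lemma folner_nonneg: "0 \<le> s \<Longrightarrow> 0 \<le> folner TYPE('d::finite) q s"
  unfolding folner_def using bcount_mono[of q "q + s", where 'd='d] by (auto intro!: divide_nonneg_nonneg)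

lemma folner_mono: "s \<le> s' \<Longrightarrow> folner TYPE('d::finite) q s \<le> folner TYPE('d) q s'"
  unfolding folner_def by (intro divide_right_mono mult_left_mono diff_mono bcount_mono) auto

lemma folner_tendsto: "(\<lambda>q::nat. folner TYPE('d::finite) (real q) s) \<longlonglongrightarrow> 0"
proof -
  have "filterlim (\<lambda>q::nat. real q) at_top sequentially" "filterlim (\<lambda>q::nat. real q + s) at_top sequentially"
    by real_asymp+
  moreover have "(\<lambda>q::nat. (real q + s) / real q) \<longlonglongrightarrow> 1" by real_asymp
  ultimately have "(\<lambda>q::nat. bcount TYPE('d) (real q + s) / bcount TYPE('d) (real q)) \<longlonglongrightarrow> 1"
    by (rule bcount_ratio)
  then have "(\<lambda>q::nat. 2 * (bcount TYPE('d) (real q + s) / bcount TYPE('d) (real q) - 1)) \<longlonglongrightarrow> 2 * (1 - 1)"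
    by (intro tendsto_intros)
  moreover have "\<forall>\<^sub>F q in sequentially.
      2 * (bcount TYPE('d) (real q + s) / bcount TYPE('d) (real q) - 1) = folner TYPE('d) (real q) s"
    using eventually_gt_at_top[of 0]
  proof eventually_elim
    case (elim q)
    then have "bcount TYPE('d) (real q) > 0" by simp
    then show ?case by (simp add: folner_def field_simps)
  qed
  ultimately show ?thesis by (simp add: Lim_transform_eventually)
qed

section \<open>Almost invariance of ball averages, mean and pointwise ergodic theorems\<close>

context zd_action
begin

definition oavg :: "('x \<Rightarrow> real) \<Rightarrow> real \<Rightarrow> 'x \<Rightarrow> real" where
  "oavg f r x = osum f r x / bcount TYPE('d) r"

lemma oavg_measurable [measurable]:
  assumes [measurable]: "f \<in> borel_measurable X"
  shows "oavg f r \<in> borel_measurable X"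
  unfolding oavg_def by measurable

lemma oavg_abs_le:
  assumes "\<forall>x\<in>space X. \<bar>f x\<bar> \<le> K" "0 < r" "x \<in> space X"
  shows "\<bar>oavg f r x\<bar> \<le> K"
proof -
  have "\<bar>osum f r x\<bar> \<le> (\<Sum>n\<in>(lball r :: (int ^ 'd) set). \<bar>f (T n x)\<bar>)" unfolding osum_def by (rule sum_abs)
  also have "\<dots> \<le> (\<Sum>n\<in>(lball r :: (int ^ 'd) set). K)" using assms by (intro sum_mono) auto
  also have "\<dots> = bcount TYPE('d) r * K" by (simp add: bcount_def)
  finally show ?thesis using assms by (simp add: oavg_def pos_divide_le_eq mult.commute)
qed

text \<open>The ball and its translate have equally many points, so their two differences are
  equally large, and the one outside the original ball lies in the shell counted by
  \<open>folner\<close>.\<close>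

lemma oavg_folner:
  assumes f: "\<forall>x\<in>space X. \<bar>f x\<bar> \<le> K" and r: "0 < r" and x: "x \<in> space X"
  shows "\<bar>oavg f r (T m x) - oavg f r x\<bar> \<le> K * folner TYPE('d) r (lattice_norm m)"
proof -
  define A where "A = {k :: int ^ 'd. lattice_norm (k - m) < r}"
  let ?B = "lball r :: (int ^ 'd) set"
  let ?L = "lball (r + lattice_norm m) :: (int ^ 'd) set"
  let ?g = "\<lambda>k. f (T k x)"
  have K0: "0 \<le> K" using bspec[OF f x] by linarith
  have AL: "A \<subseteq> ?L"
  proof
    fix k assume "k \<in> A"
    then show "k \<in> ?L" using lattice_norm_triangle[of "k - m" m] by (simp add: A_def)
  qed
  have finA: "finite A" using AL by (rule finite_subset) simp
  have BL: "?B \<subseteq> ?L" by (intro lball_mono) simp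
  have cA: "card A = card ?B" using card_translate_lball[of m r] by (simp add: A_def bcount_def)
  have "card (A - ?B) \<le> card (?L - ?B)" using AL by (intro card_mono) auto
  also have "\<dots> = card ?L - card ?B" using BL by (intro card_Diff_subset) auto
  finally have c1: "real (card (A - ?B)) \<le> bcount TYPE('d) (r + lattice_norm m) - bcount TYPE('d) r"
    using card_mono[OF _ BL] by (simp add: bcount_def of_nat_diff)
  have c2: "card (?B - A) = card (A - ?B)"
  proof -
    have "card ?B = card (?B \<inter> A) + card (?B - A)" using card_Int_Diff[of ?B A] by simp
    moreover have "card A = card (?B \<inter> A) + card (A - ?B)" using card_Int_Diff[OF finA, of ?B] by (simp add: Int_commute)
    ultimately show ?thesis using cA by simp
  qed
  have bd: "\<bar>sum ?g S\<bar> \<le> real (card S) * K" if "finite S" for S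
  proof -
    have "\<bar>sum ?g S\<bar> \<le> (\<Sum>k\<in>S. \<bar>?g k\<bar>)" by (rule sum_abs)
    also have "\<dots> \<le> (\<Sum>k\<in>S. K)" using f x by (intro sum_mono) auto
    finally show ?thesis by simp
  qed
  have "osum f r (T m x) - osum f r x = sum ?g A - sum ?g ?B"
    using x by (simp add: osum_shift A_def) (simp add: osum_def)
  also have "\<dots> = sum ?g (A - ?B) - sum ?g (?B - A)"
    using sum.Int_Diff[OF finA, of ?g ?B] sum.Int_Diff[of ?B ?g A] by (simp add: Int_commute)
  finally have "\<bar>osum f r (T m x) - osum f r x\<bar> \<le> real (card (A - ?B)) * K + real (card (?B - A)) * K"
    using bd[of "A - ?B"] bd[of "?B - A"] finA by simp
  also have "\<dots> \<le> K * (2 * (bcount TYPE('d) (r + lattice_norm m) - bcount TYPE('d) r))"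
    unfolding c2 using mult_right_mono[OF c1 K0] by (simp add: algebra_simps)
  finally have "\<bar>osum f r (T m x) - osum f r x\<bar> / bcount TYPE('d) r
    \<le> K * (2 * (bcount TYPE('d) (r + lattice_norm m) - bcount TYPE('d) r)) / bcount TYPE('d) r"
    by (rule divide_right_mono) simp
  then show ?thesis using r by (simp add: oavg_def folner_def diff_divide_distrib[symmetric] abs_divide)
qed

lemma osum_osum:
  assumes "x \<in> space X"
  shows "osum (osum f s) q x = (\<Sum>m\<in>lball s. osum f q (T m x))"
proof -
  have "osum (osum f s) q x = (\<Sum>n\<in>lball q. \<Sum>m\<in>lball s. f (T m (T n x)))" by (simp add: osum_def)
  also have "\<dots> = (\<Sum>m\<in>lball s. \<Sum>n\<in>lball q. f (T m (T n x)))" by (rule sum.swap)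
  also have "\<dots> = (\<Sum>m\<in>lball s. osum f q (T m x))"
    unfolding osum_def using assms by (intro sum.cong refl) (simp add: T_add add.commute)
  finally show ?thesis .
qed

lemma osum_divide: "osum (\<lambda>x. f x / c) q x = osum f q x / c"
  by (simp add: osum_def sum_divide_distrib)

lemma oavg_oavg:
  assumes "x \<in> space X"
  shows "oavg (oavg f s) q x = (\<Sum>m\<in>lball s. oavg f q (T m x)) / bcount TYPE('d) s"
proof -
  have "oavg (oavg f s) q x = osum (osum f s) q x / bcount TYPE('d) s / bcount TYPE('d) q"
    unfolding oavg_def[abs_def] osum_divide ..
  also have "\<dots> = (\<Sum>m\<in>lball s. oavg f q (T m x)) / bcount TYPE('d) s"
    unfolding osum_osum[OF assms] by (simp add: oavg_def sum_divide_distrib[symmetric] mult.commute)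
  finally show ?thesis .
qed

lemma oavg_commute:
  assumes "x \<in> space X"
  shows "oavg (oavg f s) q x = oavg (oavg f q) s x"
proof -
  have "oavg (oavg f s) q x = osum (oavg f q) s x / bcount TYPE('d) s"
    unfolding oavg_oavg[OF assms] by (simp add: osum_def)
  then show ?thesis by (simp add: oavg_def)
qed

text \<open>Averaging beforehand over a ball of fixed radius \<open>s\<close> is invisible to
  averages over much larger balls. Both ergodic theorems use almost invariance in this form.\<close>

lemma oavg_oavg_near:
  assumes f: "\<forall>x\<in>space X. \<bar>f x\<bar> \<le> K" and r: "0 < q" "0 < s" and x: "x \<in> space X"
  shows "\<bar>oavg (oavg f s) q x - oavg f q x\<bar> \<le> K * folner TYPE('d) q s"
proof -
  let ?S = "lball s :: (int ^ 'd) set"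
  have K0: "0 \<le> K" using bspec[OF f x] by linarith
  have b: "bcount TYPE('d) s > 0" using r by simp
  have "oavg (oavg f s) q x - oavg f q x = (\<Sum>m\<in>?S. oavg f q (T m x) - oavg f q x) / bcount TYPE('d) s"
    using b unfolding oavg_oavg[OF x] by (auto simp: sum_subtractf bcount_def diff_divide_distrib)
  also have "\<bar>\<dots>\<bar> \<le> (\<Sum>m\<in>?S. \<bar>oavg f q (T m x) - oavg f q x\<bar>) / bcount TYPE('d) s"
    by (simp add: abs_divide divide_right_mono sum_abs)
  also have "\<dots> \<le> (\<Sum>m\<in>?S. K * folner TYPE('d) q s) / bcount TYPE('d) s"
  proof (intro divide_right_mono sum_mono)
    fix m assume "m \<in> ?S"
    then have "folner TYPE('d) q (lattice_norm m) \<le> folner TYPE('d) q s" by (intro folner_mono) auto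
    then show "\<bar>oavg f q (T m x) - oavg f q x\<bar> \<le> K * folner TYPE('d) q s"
      using oavg_folner[OF f r(1) x, of m] mult_left_mono[OF _ K0] by (blast intro: order_trans)
  qed simp
  also have "\<dots> = K * folner TYPE('d) q s" using b by (auto simp: bcount_def)
  finally show ?thesis .
qed

lemma bounded_integrable:
  fixes f :: "'x \<Rightarrow> real"
  assumes "f \<in> borel_measurable X" "\<forall>x\<in>space X. \<bar>f x\<bar> \<le> K"
  shows "integrable X f"
  by (rule integrable_const_bound[where B=K]) (use assms in auto)

lemma bounded_integrable_square:
  fixes f :: "'x \<Rightarrow> real"
  assumes [measurable]: "f \<in> borel_measurable X" and "\<forall>x\<in>space X. \<bar>f x\<bar> \<le> K"
  shows "integrable X (\<lambda>x. (f x)\<^sup>2)"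
proof (rule bounded_integrable[where K="K\<^sup>2"])
  show "\<forall>x\<in>space X. \<bar>(f x)\<^sup>2\<bar> \<le> K\<^sup>2"
    using power_mono[OF bspec[OF assms(2)], of _ 2] by auto
qed simp

text \<open>Cauchy-Schwarz inside the average, then invariance of the measure.\<close>

lemma oavg_contraction:
  assumes [measurable]: "f \<in> borel_measurable X" and f: "\<forall>x\<in>space X. \<bar>f x\<bar> \<le> K" and q: "0 < q"
  shows "(\<integral>x. (oavg f q x)\<^sup>2 \<partial>X) \<le> (\<integral>x. (f x)\<^sup>2 \<partial>X)"
proof -
  let ?Q = "lball q :: (int ^ 'd) set"
  let ?b = "bcount TYPE('d) q"
  have b: "?b > 0" using q by simp
  have i: "integrable X (\<lambda>x. (f x)\<^sup>2)" by (rule bounded_integrable_square[OF assms(1) f])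
  have "(\<integral>x. (oavg f q x)\<^sup>2 \<partial>X) \<le> (\<integral>x. (\<Sum>n\<in>?Q. (f (T n x))\<^sup>2) / ?b \<partial>X)"
  proof (rule integral_mono)
    show "integrable X (\<lambda>x. (oavg f q x)\<^sup>2)"
      by (rule bounded_integrable_square[where K=K]) (use oavg_abs_le[OF f q] in auto)
    show "integrable X (\<lambda>x. (\<Sum>n\<in>?Q. (f (T n x))\<^sup>2) / ?b)"
      using integrable_T[OF i] by (intro integrable_divide Bochner_Integration.integrable_sum) auto
    fix x
    have "(osum f q x)\<^sup>2 \<le> (\<Sum>n\<in>?Q. (f (T n x))\<^sup>2) * ?b"
      unfolding osum_def bcount_def by (rule sum_squared_le_sum_of_squares)
    then have "(osum f q x)\<^sup>2 / ?b\<^sup>2 \<le> (\<Sum>n\<in>?Q. (f (T n x))\<^sup>2) * ?b / ?b\<^sup>2"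
      by (rule divide_right_mono) simp
    then show "(oavg f q x)\<^sup>2 \<le> (\<Sum>n\<in>?Q. (f (T n x))\<^sup>2) / ?b"
      using b by (simp add: oavg_def power_divide) (simp add: power2_eq_square)
  qed
  also have "\<dots> = (\<Sum>n\<in>?Q. \<integral>x. (f (T n x))\<^sup>2 \<partial>X) / ?b"
    using integrable_T[OF i] by (simp add: Bochner_Integration.integral_sum)
  also have "\<dots> = (\<integral>x. (f x)\<^sup>2 \<partial>X)"
    using b integral_T[of "\<lambda>x. (f x)\<^sup>2"] by (auto simp: bcount_def)
  finally show ?thesis .
qed

lemma osum_linear:
  "osum (\<lambda>x. u x + v x) q x = osum u q x + osum v q x"
  "osum (\<lambda>x. u x - v x) q x = osum u q x - osum v q x"
  by (simp_all add: osum_def sum.distrib sum_subtractf)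

lemma integral_square_near:
  fixes u v :: "'x \<Rightarrow> real"
  assumes u [measurable]: "u \<in> borel_measurable X" and v [measurable]: "v \<in> borel_measurable X"
    and "\<forall>x\<in>space X. \<bar>u x\<bar> \<le> K" "\<forall>x\<in>space X. \<bar>v x\<bar> \<le> K"
    and "\<forall>x\<in>space X. \<bar>u x - v x\<bar> \<le> e"
  shows "(\<integral>x. (u x)\<^sup>2 \<partial>X) \<le> (\<integral>x. (v x)\<^sup>2 \<partial>X) + 2 * K * e"
proof -
  have i: "integrable X (\<lambda>x. (u x)\<^sup>2)" "integrable X (\<lambda>x. (v x)\<^sup>2)"
    by (rule bounded_integrable_square[OF u assms(3)], rule bounded_integrable_square[OF v assms(4)])

  have "(\<integral>x. (u x)\<^sup>2 \<partial>X) \<le> (\<integral>x. (v x)\<^sup>2 + 2 * K * e \<partial>X)"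
  proof (rule integral_mono)
    fix x assume x: "x \<in> space X"
    have "(u x)\<^sup>2 - (v x)\<^sup>2 = (u x + v x) * (u x - v x)" by (simp add: power2_eq_square algebra_simps)
    also have "\<dots> \<le> \<bar>u x + v x\<bar> * \<bar>u x - v x\<bar>" by (simp add: abs_mult[symmetric])
    also have "\<dots> \<le> (2 * K) * e"
      using bspec[OF assms(3) x] bspec[OF assms(4) x] bspec[OF assms(5) x] by (intro mult_mono) auto
    finally show "(u x)\<^sup>2 \<le> (v x)\<^sup>2 + 2 * K * e" by simp
  qed (use i in auto)
  also have "\<dots> = (\<integral>x. (v x)\<^sup>2 \<partial>X) + 2 * K * e" using i by (simp add: prob_space)
  finally show ?thesis .
qed

text \<open>The von Neumann theorem without completeness of \<open>L\<^sup>2\<close>: let the average \<open>g\<close> of \<open>f\<close> almost minimize the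
  norm among all averages of \<open>f\<close>. The midpoint of two averages of \<open>g\<close> cannot have a smaller norm, because
  averaging it over a large ball gives, up to a small error, an average of \<open>f\<close>. By the parallelogram law
  any two averages of \<open>g\<close> are close.\<close>

lemma mean_ergodic:
  assumes f [measurable]: "f \<in> borel_measurable X" and fK: "\<forall>x\<in>space X. \<bar>f x\<bar> \<le> K"
    and e: "0 < e"
  shows "\<exists>t::nat. 1 \<le> t \<and> (\<forall>r\<ge>t. \<forall>s\<ge>t. (\<integral>x. (oavg f (real r) x - oavg f (real s) x)\<^sup>2 \<partial>X) \<le> e)"
proof -
  define I where "I q = (\<integral>x. (oavg f (real q) x)\<^sup>2 \<partial>X)" for q :: nat
  define \<alpha> where "\<alpha> = (INF q\<in>{1..}. I q)"
  have K0: "0 \<le> K" using fK not_empty by fastforce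
  have I0: "0 \<le> I q" for q by (simp add: I_def)
  then have bdd: "bdd_below (I ` {1..})" by (intro bdd_belowI[of _ 0]) auto
  have \<alpha>: "\<alpha> \<le> I q" if "1 \<le> q" for q
    unfolding \<alpha>_def using that by (intro cINF_lower bdd) auto
  \<comment> \<open>The final bound is \<open>18 * \<delta>\<close>: three times the
    \<open>4 * \<delta>\<close> between averages of \<open>g\<close>, and
    \<open>6 * \<delta>\<close> for passing from \<open>f\<close> to \<open>g\<close> at two
    radii.\<close>
  define \<delta> where "\<delta> = e / 24"
  have \<delta>: "\<delta> > 0" using e by (simp add: \<delta>_def)
  obtain t1 where t1: "1 \<le> t1" "I t1 < \<alpha> + \<delta>"
  proof -
    have "(INF q\<in>{1..}. I q) < \<alpha> + \<delta>" using \<delta> by (simp add: \<alpha>_def)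
    then show ?thesis using that by (subst (asm) cINF_less_iff) (use bdd in auto)
  qed
  define g where "g = oavg f (real t1)"
  have g [measurable]: "g \<in> borel_measurable X" by (simp add: g_def)
  have gK: "\<forall>x\<in>space X. \<bar>g x\<bar> \<le> K"
    unfolding g_def using oavg_abs_le[OF fK] t1 by auto
  have agK: "\<bar>oavg g (real r) x\<bar> \<le> K" if "x \<in> space X" "1 \<le> r" for r x
    using oavg_abs_le[OF gK] that by auto
  have afK: "\<bar>oavg f (real r) x\<bar> \<le> K" if "x \<in> space X" "1 \<le> r" for r x
    using oavg_abs_le[OF fK] that by auto
  have mid: "\<alpha> \<le> (\<integral>x. ((oavg g (real r) x + oavg g (real s) x) / 2)\<^sup>2 \<partial>X)" if rs: "1 \<le> r" "1 \<le> s" for r s :: nat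
  proof -
    define v where "v = (\<lambda>x. (oavg g (real r) x + oavg g (real s) x) / 2)"
    have v [measurable]: "v \<in> borel_measurable X" by (simp add: v_def)
    have vK: "\<forall>x\<in>space X. \<bar>v x\<bar> \<le> K"
    proof
      fix x assume "x \<in> space X"
      from agK[OF this rs(1)] agK[OF this rs(2)] show "\<bar>v x\<bar> \<le> K" by (auto simp: v_def)
    qed
    \<comment> \<open>Three exchanges inside an average of radius \<open>q\<close>: the inner
      averages of radius \<open>r\<close> and \<open>s\<close> are dropped, and \<open>g\<close>, an
      average of radius \<open>t1\<close>, is replaced by \<open>f\<close>. All three errors vanish
      as \<open>q\<close> grows.\<close>
    define E where "E q = K * folner TYPE('d) (real q) (real r) + K * folner TYPE('d) (real q) (real s)
      + K * folner TYPE('d) (real q) (real t1)" for q :: nat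
    have "E \<longlonglongrightarrow> K * 0 + K * 0 + K * 0" unfolding E_def by (intro tendsto_intros folner_tendsto)
    then have "(\<lambda>q. (\<integral>x. (v x)\<^sup>2 \<partial>X) + 2 * K * E q) \<longlonglongrightarrow> (\<integral>x. (v x)\<^sup>2 \<partial>X) + 2 * K * (K * 0 + K * 0 + K * 0)"
      by (intro tendsto_intros)
    moreover have "\<alpha> \<le> (\<integral>x. (v x)\<^sup>2 \<partial>X) + 2 * K * E q" if q: "1 \<le> q" for q
    proof -
      have near: "\<forall>x\<in>space X. \<bar>oavg f q x - oavg v q x\<bar> \<le> E q"
      proof
        fix x assume x: "x \<in> space X"
        have 1: "\<bar>oavg (oavg g r) q x - oavg g q x\<bar> \<le> K * folner TYPE('d) q r"
          "\<bar>oavg (oavg g s) q x - oavg g q x\<bar> \<le> K * folner TYPE('d) q s"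
          "\<bar>oavg g q x - oavg f q x\<bar> \<le> K * folner TYPE('d) q t1"
          using oavg_oavg_near[OF gK, of q r x] oavg_oavg_near[OF gK, of q s x] oavg_oavg_near[OF fK, of q t1 x] q rs t1 x
          by (auto simp: g_def)
        have 2: "oavg v q x = (oavg (oavg g r) q x + oavg (oavg g s) q x) / 2"
          unfolding v_def oavg_def[where r="real q"] osum_divide osum_linear by (simp add: add_divide_distrib)
        have "0 \<le> K * folner TYPE('d) q r" "0 \<le> K * folner TYPE('d) q s" using K0 by (auto intro!: mult_nonneg_nonneg folner_nonneg)
        with 1 show "\<bar>oavg f q x - oavg v q x\<bar> \<le> E q" unfolding 2 E_def abs_le_iff by argo
      qed
      have avK: "\<forall>x\<in>space X. \<bar>oavg v q x\<bar> \<le> K" using oavg_abs_le[OF vK] q by auto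
      have "\<alpha> \<le> I q" by (rule \<alpha>[OF q])
      also have "\<dots> \<le> (\<integral>x. (oavg v q x)\<^sup>2 \<partial>X) + 2 * K * E q"
        unfolding I_def using afK[OF _ q] avK near by (intro integral_square_near) auto
      also have "(\<integral>x. (oavg v q x)\<^sup>2 \<partial>X) \<le> (\<integral>x. (v x)\<^sup>2 \<partial>X)"
        using vK q by (intro oavg_contraction[where K=K]) auto
      finally show ?thesis by simp
    qed
    ultimately have "\<alpha> \<le> (\<integral>x. (v x)\<^sup>2 \<partial>X) + 2 * K * (K * 0 + K * 0 + K * 0)"
      by (intro LIMSEQ_le_const) auto
    then show ?thesis by (simp add: v_def)
  qed
  have gcauchy: "(\<integral>x. (oavg g (real r) x - oavg g (real s) x)\<^sup>2 \<partial>X) \<le> 4 * \<delta>" if rs: "1 \<le> r" "1 \<le> s" for r s :: nat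
  proof -
    let ?u = "oavg g (real r)" and ?w = "oavg g (real s)"
    have i: "integrable X (\<lambda>x. (?u x)\<^sup>2)" "integrable X (\<lambda>x. (?w x)\<^sup>2)"
      using agK rs by (auto intro!: bounded_integrable_square[where K=K])
    have i2: "integrable X (\<lambda>x. ((?u x + ?w x) / 2)\<^sup>2)"
    proof (rule bounded_integrable_square[where K=K])
      show "\<forall>x\<in>space X. \<bar>(?u x + ?w x) / 2\<bar> \<le> K"
      proof
        fix x assume "x \<in> space X"
        from agK[OF this rs(1)] agK[OF this rs(2)] show "\<bar>(?u x + ?w x) / 2\<bar> \<le> K" by auto
      qed
    qed simp
    have "(\<integral>x. (?u x - ?w x)\<^sup>2 \<partial>X) = (\<integral>x. 2 * (?u x)\<^sup>2 + 2 * (?w x)\<^sup>2 - 4 * ((?u x + ?w x) / 2)\<^sup>2 \<partial>X)"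
      by (intro Bochner_Integration.integral_cong refl) (simp add: power2_eq_square field_simps)
    also have "\<dots> = 2 * (\<integral>x. (?u x)\<^sup>2 \<partial>X) + 2 * (\<integral>x. (?w x)\<^sup>2 \<partial>X) - 4 * (\<integral>x. ((?u x + ?w x) / 2)\<^sup>2 \<partial>X)"
      using i i2 by simp
    also have "\<dots> \<le> 2 * I t1 + 2 * I t1 - 4 * \<alpha>"
    proof -
      have "(\<integral>x. (?u x)\<^sup>2 \<partial>X) \<le> I t1" "(\<integral>x. (?w x)\<^sup>2 \<partial>X) \<le> I t1"
        unfolding I_def g_def[symmetric] using gK rs by (auto intro!: oavg_contraction[where K=K])
      with mid[OF rs] show ?thesis by linarith
    qed
    also have "\<dots> \<le> 4 * \<delta>" using t1 by simp
    finally show ?thesis .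
  qed
  have "(\<lambda>r::nat. K * folner TYPE('d) (real r) (real t1)) \<longlonglongrightarrow> K * 0" by (intro tendsto_intros folner_tendsto)
  then have "\<forall>\<^sub>F r in sequentially. K * folner TYPE('d) (real r) (real t1) < sqrt \<delta>"
    by (rule order_tendstoD) (use \<delta> in simp)
  then obtain t where t: "\<And>r. t \<le> r \<Longrightarrow> K * folner TYPE('d) (real r) (real t1) < sqrt \<delta>"
    by (auto simp: eventually_sequentially)
  have "(\<integral>x. (oavg f (real r) x - oavg f (real s) x)\<^sup>2 \<partial>X) \<le> e" if rs: "max 1 t \<le> r" "max 1 t \<le> s" for r s :: nat
  proof -
    have near: "(oavg f r x - oavg g r x)\<^sup>2 \<le> \<delta>" if x: "x \<in> space X" and r: "max 1 t \<le> r" for r x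
    proof -
      have "\<bar>oavg f r x - oavg g r x\<bar> \<le> K * folner TYPE('d) r t1"
        unfolding g_def using oavg_oavg_near[OF fK, of r t1 x] x r t1 by (simp add: abs_minus_commute)
      also have "\<dots> \<le> sqrt \<delta>" using t[of r] r by simp
      finally show ?thesis using \<delta> by (metis real_sqrt_abs real_sqrt_le_iff)
    qed
    have gi: "integrable X (\<lambda>x. (oavg g r x - oavg g s x)\<^sup>2)"
    proof (rule bounded_integrable_square[where K="2*K"])
      show "\<forall>x\<in>space X. \<bar>oavg g r x - oavg g s x\<bar> \<le> 2 * K"
      proof
        fix x assume "x \<in> space X"
        from agK[OF this, of r] agK[OF this, of s] rs show "\<bar>oavg g r x - oavg g s x\<bar> \<le> 2 * K" by auto
      qed
    qed simp
    have "(\<integral>x. (oavg f r x - oavg f s x)\<^sup>2 \<partial>X) \<le> (\<integral>x. 3 * (oavg g r x - oavg g s x)\<^sup>2 + 6 * \<delta> \<partial>X)"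
    proof (rule integral_mono)
      show "integrable X (\<lambda>x. (oavg f r x - oavg f s x)\<^sup>2)"
      proof (rule bounded_integrable_square[where K="2*K"])
        show "\<forall>x\<in>space X. \<bar>oavg f r x - oavg f s x\<bar> \<le> 2 * K"
        proof
          fix x assume "x \<in> space X"
          from afK[OF this, of r] afK[OF this, of s] rs show "\<bar>oavg f r x - oavg f s x\<bar> \<le> 2 * K" by auto
        qed
      qed simp
      show "integrable X (\<lambda>x. 3 * (oavg g r x - oavg g s x)\<^sup>2 + 6 * \<delta>)" using gi by simp
      fix x assume x: "x \<in> space X"
      have "(a + b + c)\<^sup>2 \<le> 3 * (a\<^sup>2 + b\<^sup>2 + c\<^sup>2)" for a b c :: real
        using sum_squares_ge_zero[of "a - b" "b - c"] zero_le_square[of "a - c"]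
        by (simp add: power2_eq_square algebra_simps)
      from this[of "oavg f r x - oavg g r x" "oavg g r x - oavg g s x" "oavg g s x - oavg f s x"]
      show "(oavg f r x - oavg f s x)\<^sup>2 \<le> 3 * (oavg g r x - oavg g s x)\<^sup>2 + 6 * \<delta>"
        using near[OF x rs(1)] near[OF x rs(2)] by (simp add: power2_commute[of "oavg g s x" "oavg f s x"])
    qed
    also have "\<dots> = 3 * (\<integral>x. (oavg g r x - oavg g s x)\<^sup>2 \<partial>X) + 6 * \<delta>"
      using gi by (simp add: prob_space)
    also have "\<dots> \<le> 18 * \<delta>" using gcauchy[of r s] rs by simp
    also have "\<dots> \<le> e" using e by (simp add: \<delta>_def)
    finally show ?thesis .
  qed
  then show ?thesis by (intro exI[of _ "max 1 t"]) auto
qed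

text \<open>Let \<open>h\<close> be the average of \<open>f\<close> over a fixed ball, and let
  \<open>q\<close> be much larger than the radii \<open>r\<close> under consideration. The average
  of radius \<open>r\<close> of \<open>f\<close> is close to that of \<open>h\<close>, and the
  average of radius \<open>r\<close> of the \<open>q\<close>-average is close to the
  \<open>q\<close>-average itself. Since \<open>h\<close> and the \<open>q\<close>-average are close
  in mean, the maximal inequality makes the averages of their distance small for all
  \<open>r\<close> at once, off a small set. Hence all averages of radius \<open>r\<close> lie near
  one number, and invariant functions never enter.\<close>

theorem pointwise_ergodic_bounded:
  assumes f [measurable]: "f \<in> borel_measurable X" and fK: "\<forall>x\<in>space X. \<bar>f x\<bar> \<le> K"
  shows "AE x in X. convergent (\<lambda>r::nat. oavg f (real r) x)"
proof (rule AE_convergent_of_oscillation)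
  fix e' :: real assume e': "0 < e'"
  have K0: "0 \<le> K" using fK not_empty by fastforce
  obtain D where D: "1 \<le> D" "\<And>r. 1 \<le> r \<Longrightarrow> bcount TYPE('d) (5 * r) \<le> D * bcount TYPE('d) r"
    using bcount_doubling[where 'd='d] by metis
  \<comment> \<open>The oscillation found below is \<open>6 * e\<close> and the exceptional measure
    \<open>2 * D * D * e\<close>; both have to be at most \<open>e'\<close>.\<close>
  define e where "e = e' / (6 * D * D)"
  have DD: "1 \<le> D * D" using mult_mono[OF D(1) D(1)] D(1) by simp
  have e: "0 < e" using e' D by (simp add: e_def)
  have e6: "6 * e \<le> e'" and De: "2 * D * D * e \<le> e'"
    using e' DD by (simp_all add: e_def field_simps)
  \<comment> \<open>A mean square distance of \<open>e ^ 4\<close> gives a mean distance of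
    \<open>2 * e\<^sup>2\<close>, hence measure \<open>2 * D * D * e\<close> in the maximal
    inequality at level \<open>e\<close>.\<close>
  obtain t where t: "1 \<le> t"
    "\<And>r s. t \<le> r \<Longrightarrow> t \<le> s \<Longrightarrow> (\<integral>x. (oavg f (real r) x - oavg f (real s) x)\<^sup>2 \<partial>X) \<le> e ^ 4"
    using mean_ergodic[OF f fK, of "e ^ 4"] e by auto
  define h where "h = oavg f (real t)"
  have "(\<lambda>r::nat. K * folner TYPE('d) (real r) (real t)) \<longlonglongrightarrow> K * 0" by (intro tendsto_intros folner_tendsto)
  then have "\<forall>\<^sub>F r in sequentially. K * folner TYPE('d) (real r) (real t) < e"
    by (rule order_tendstoD) (use e in simp)
  then obtain t0 where t0: "\<And>r. t0 \<le> r \<Longrightarrow> K * folner TYPE('d) (real r) (real t) < e" 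
    by (auto simp: eventually_sequentially)
  define t2 where "t2 = max 1 t0"
  define A where "A q = {x \<in> space X. \<exists>r\<in>{t2..q}. \<exists>s\<in>{t2..q}. 6 * e < \<bar>oavg f (real r) x - oavg f (real s) x\<bar>}" for q :: nat
  have A [measurable]: "A q \<in> sets X" for q unfolding A_def by measurable
  have mA: "measure X (A q0) \<le> 2 * D * D * e" for q0
  proof -
    have "(\<lambda>q::nat. K * folner TYPE('d) (real q) (real q0)) \<longlonglongrightarrow> K * 0" by (intro tendsto_intros folner_tendsto)
    then have "\<forall>\<^sub>F q in sequentially. K * folner TYPE('d) (real q) (real q0) < e"
      by (rule order_tendstoD) (use e in simp)
    moreover have "\<forall>\<^sub>F q in sequentially. t \<le> q" by (rule eventually_ge_at_top)
    \<comment> \<open>\<open>q\<close> depends on the window bound \<open>q0\<close>, but the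
      resulting bound on \<open>A q0\<close> does not; this permits the increasing union over
      \<open>q0\<close> below.\<close>
    ultimately obtain q where q: "t \<le> q" "K * folner TYPE('d) (real q) (real q0) < e"
      by (metis (mono_tags, lifting) eventually_conj eventually_happens trivial_limit_sequentially)
    define u where "u x = \<bar>h x - oavg f (real q) x\<bar>" for x
    have u [measurable]: "u \<in> borel_measurable X" by (simp add: u_def[abs_def] h_def)
    have uK: "\<forall>x\<in>space X. \<bar>u x\<bar> \<le> 2 * K"
    proof
      fix x assume "x \<in> space X"
      with oavg_abs_le[OF fK, of t x] oavg_abs_le[OF fK, of q x] t q show "\<bar>u x\<bar> \<le> 2 * K"
        by (simp add: u_def h_def)
    qed
    have ui: "integrable X u" by (rule bounded_integrable[OF u uK])
    have u2i: "integrable X (\<lambda>x. (u x)\<^sup>2)" by (rule bounded_integrable_square[OF u uK])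
    \<comment> \<open>The inequality between arithmetic and geometric means, weighted by
      \<open>e\<^sup>2\<close>, stands in for Cauchy-Schwarz.\<close>
    have "(\<integral>x. u x \<partial>X) \<le> (\<integral>x. e\<^sup>2 + (u x)\<^sup>2 / e\<^sup>2 \<partial>X)"
    proof (rule integral_mono)
      fix x
      have "2 * u x * e\<^sup>2 \<le> (e\<^sup>2)\<^sup>2 + (u x)\<^sup>2" using sum_squares_bound[of "u x" "e\<^sup>2"] by simp
      moreover have "0 \<le> u x * e\<^sup>2" by (simp add: u_def)
      ultimately have "u x * e\<^sup>2 \<le> (e\<^sup>2)\<^sup>2 + (u x)\<^sup>2" by linarith
      then show "u x \<le> e\<^sup>2 + (u x)\<^sup>2 / e\<^sup>2" using e by (simp add: field_simps power2_eq_square)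
    qed (use ui u2i in auto)
    also have "\<dots> = e\<^sup>2 + (\<integral>x. (u x)\<^sup>2 \<partial>X) / e\<^sup>2" using u2i by (simp add: prob_space)
    also have "(\<integral>x. (u x)\<^sup>2 \<partial>X) \<le> e ^ 4" using t(2)[OF order_refl q(1)] by (simp add: u_def h_def)
    finally have u1: "(\<integral>x. u x \<partial>X) \<le> 2 * e\<^sup>2" using e by (simp add: divide_right_mono field_simps power2_eq_square power4_eq_xxxx)
    have "A q0 \<subseteq> {x \<in> space X. \<exists>r::nat. 1 \<le> r \<and> e * bcount TYPE('d) r < osum u r x}"
    proof (rule subsetI, rule ccontr)
      fix x assume xA: "x \<in> A q0" and nx: "x \<notin> {x \<in> space X. \<exists>r::nat. 1 \<le> r \<and> e * bcount TYPE('d) r < osum u r x}"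
      have x: "x \<in> space X" using xA by (simp add: A_def)
      have near: "\<bar>oavg f (real r) x - oavg f (real q) x\<bar> \<le> 3 * e" if r: "r \<in> {t2..q0}" for r
      proof -
        have r1: "1 \<le> r" "t0 \<le> r" using r by (auto simp: t2_def)
        have b: "bcount TYPE('d) r > 0" using r1 by simp
        have "osum u r x \<le> e * bcount TYPE('d) r" using nx x r1 by (auto simp: not_less)
        moreover have "\<bar>osum h r x - osum (oavg f q) r x\<bar> \<le> osum u r x"
          unfolding osum_linear(2)[symmetric] unfolding osum_def u_def by (rule sum_abs)
        ultimately have 2: "\<bar>oavg h r x - oavg (oavg f q) r x\<bar> \<le> e"
          using b by (simp add: oavg_def diff_divide_distrib[symmetric] abs_divide pos_divide_le_eq)
        have 1: "\<bar>oavg h r x - oavg f r x\<bar> \<le> e"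
          using oavg_oavg_near[OF fK, of r t x] t0[of r] r1 t x by (simp add: h_def)
        have "\<bar>oavg (oavg f q) r x - oavg f q x\<bar> \<le> K * folner TYPE('d) q r"
          using oavg_oavg_near[OF fK, of q r x] r1 q t x by (simp add: oavg_commute[OF x, of f q r])
        also have "\<dots> \<le> K * folner TYPE('d) q q0" using r K0 by (intro mult_left_mono folner_mono) auto
        finally have 3: "\<bar>oavg (oavg f q) r x - oavg f q x\<bar> \<le> e" using q by simp
        from 1 2 3 show ?thesis by linarith
      qed
      obtain r s where rs: "r \<in> {t2..q0}" "s \<in> {t2..q0}" "6 * e < \<bar>oavg f (real r) x - oavg f (real s) x\<bar>"
        using xA unfolding A_def by blast
      from near[OF rs(1)] near[OF rs(2)] rs(3) show False by linarith
    qed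
    then have "measure X (A q0) \<le> measure X {x \<in> space X. \<exists>r::nat. 1 \<le> r \<and> e * bcount TYPE('d) r < osum u r x}"
      by (intro finite_measure_mono) auto
    also have "\<dots> \<le> D * D * (\<integral>x. u x \<partial>X) / e"
    proof (rule maximal_inequality)
      show "0 \<le> u x" for x by (simp add: u_def)
    qed (use D ui e in auto)
    also have "\<dots> \<le> D * D * (2 * e\<^sup>2) / e" using e u1 DD by (intro divide_right_mono mult_left_mono) auto
    also have "\<dots> = 2 * D * D * e" using e by (simp add: power2_eq_square)
    finally show ?thesis .
  qed
  have "(\<lambda>q. measure X (A q)) \<longlonglongrightarrow> measure X (\<Union>q. A q)"
  proof (rule finite_Lim_measure_incseq)
    have "{t2..n} \<subseteq> {t2..Suc n}" for n by auto
    then show "incseq A" unfolding A_def by (intro incseq_SucI) blast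
  qed auto
  then have mU: "measure X (\<Union>q. A q) \<le> 2 * D * D * e"
    by (rule LIMSEQ_le_const2) (use mA in auto)
  show "\<exists>A\<in>sets X. measure X A \<le> e' \<and>
    (AE x in X. x \<notin> A \<longrightarrow> (\<exists>N. \<forall>r\<ge>N. \<forall>s\<ge>N. dist (oavg f (real r) x) (oavg f (real s) x) \<le> e'))"
  proof (intro bexI[of _ "\<Union>q. A q"] conjI AE_I2 impI exI[of _ t2] allI)
    show "measure X (\<Union>q. A q) \<le> e'" using mU De by simp
    fix x r s assume x: "x \<in> space X" "x \<notin> (\<Union>q. A q)" and rs: "t2 \<le> r" "t2 \<le> s"
    have "x \<notin> A (max r s)" using x by blast
    then have "\<not> 6 * e < \<bar>oavg f (real r) x - oavg f (real s) x\<bar>"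
      using x rs unfolding A_def by auto
    then show "dist (oavg f (real r) x) (oavg f (real s) x) \<le> e'" using e6 by (simp add: dist_real_def)
  qed auto
qed

end

section \<open>Dyadic radial weights\<close>

lemma dyadic_level:
  fixes x :: real
  assumes "1 \<le> x"
  obtains j :: nat where "2 ^ j \<le> x" "x < 2 ^ (j + 1)"
proof -
  obtain k :: nat where k: "x < 2 ^ k" using real_arch_pow[of 2 x] by auto
  define m where "m = (LEAST k. x < 2 ^ k)"
  have m: "x < 2 ^ m" unfolding m_def using k by (rule LeastI)
  with assms have "m \<noteq> 0" by (cases m) auto
  then obtain j where j: "m = Suc j" by (cases m) auto
  have "\<not> x < 2 ^ j" using not_less_Least[of j "\<lambda>k. x < 2 ^ k"] j by (simp add: m_def)
  with m j show ?thesis by (intro that[of j]) auto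
qed

lemma lball_1: "lball 1 = {0 :: int ^ 'd::finite}"
  using lattice_norm_ge_1 by (fastforce simp: not_less[symmetric])

lemma bcount_1 [simp]: "bcount TYPE('d::finite) 1 = 1"
  by (simp add: bcount_def lball_1)

lemma bcount_ge_2: "1 < r \<Longrightarrow> 2 \<le> bcount TYPE('d::finite) r"
proof -
  assume r: "1 < r"
  obtain i :: 'd where True by simp
  have "lattice_norm (axis i 1 :: int ^ 'd) = 1"
  proof -
    have "lat (axis i 1 :: int ^ 'd) = axis i 1" by (simp add: vec_eq_iff axis_def)
    then show ?thesis by (simp add: lattice_norm_lat)
  qed
  then have "{0, axis i 1} \<subseteq> (lball r :: (int ^ 'd) set)" using r by auto
  then have "card {0, axis i 1 :: int ^ 'd} \<le> card (lball r :: (int ^ 'd) set)" by (intro card_mono) auto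
  moreover have "(0 :: int ^ 'd) \<noteq> axis i 1" by (auto simp: vec_eq_iff axis_def)
  ultimately show ?thesis by (simp add: bcount_def)
qed

text \<open>Asking only \<open>\<gamma> < CARD('d)\<close> makes the squared weight, with exponent
  \<open>2 * \<gamma>\<close>, another instance; that instance bounds the variances of the
  correlations. At the origin, which lies in no shell, \<open>p\<close> is any number in
  \<open>[0, 1]\<close>.\<close>

locale dyadic_weight =
  fixes p :: "int ^ 'd::finite \<Rightarrow> real" and \<gamma> :: real
  assumes \<gamma>_nonneg: "0 \<le> \<gamma>" and \<gamma>_less: "\<gamma> < CARD('d)"
    and p_nonneg: "0 \<le> p n" and p_le_1: "p n \<le> 1"
    and p_level: "2 ^ j \<le> lattice_norm n \<Longrightarrow> lattice_norm n < 2 ^ (j + 1) \<Longrightarrow> p n = 2 powr (- \<gamma> * real j)"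
begin

definition wsum :: "real \<Rightarrow> real" where
  "wsum R = (\<Sum>n\<in>lball R. p n)"

lemma wsum_nonneg: "0 \<le> wsum R"
  unfolding wsum_def by (intro sum_nonneg p_nonneg)

lemma wsum_mono: "R \<le> S \<Longrightarrow> wsum R \<le> wsum S"
  unfolding wsum_def by (intro sum_mono2 lball_mono) (auto simp: p_nonneg)

lemma p_lower: "n \<noteq> 0 \<Longrightarrow> lattice_norm n < R \<Longrightarrow> R powr (- \<gamma>) \<le> p n"
proof -
  assume n: "n \<noteq> 0" and R: "lattice_norm n < R"
  obtain j :: nat where j: "2 ^ j \<le> lattice_norm n" "lattice_norm n < 2 ^ (j + 1)"
    using dyadic_level[OF lattice_norm_ge_1[OF n]] by metis
  have "R powr (- \<gamma>) \<le> (2 ^ j) powr (- \<gamma>)"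
    using \<gamma>_nonneg j R by (intro powr_mono2') auto
  also have "\<dots> = p n" using p_level[OF j] by (simp add: powr_realpow[symmetric] powr_powr mult.commute)
  finally show ?thesis .
qed

text \<open>The weight is constant on a shell whose norms vary by a factor of 2, whence the loss
  \<open>2 powr \<gamma>\<close>.\<close>

lemma p_upper: "1 \<le> R \<Longrightarrow> R \<le> lattice_norm n \<Longrightarrow> p n \<le> 2 powr \<gamma> * R powr (- \<gamma>)"
proof -
  assume R: "1 \<le> R" "R \<le> lattice_norm n"
  obtain j :: nat where j: "2 ^ j \<le> lattice_norm n" "lattice_norm n < 2 ^ (j + 1)"
    using dyadic_level[of "lattice_norm n"] R by (metis order_trans)
  have "p n = 2 powr \<gamma> * (2 ^ (j + 1)) powr (- \<gamma>)"
    using p_level[OF j] by (simp add: powr_realpow[symmetric] powr_powr powr_add[symmetric] algebra_simps del: power_Suc power_add)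
  also have "(2 ^ (j + 1)) powr (- \<gamma>) \<le> R powr (- \<gamma>)"
    using \<gamma>_nonneg j R by (intro powr_mono2') auto
  finally show ?thesis by simp
qed

text \<open>The drop of the weight from one shell to the next. It is the coefficient of the ball of
  radius \<open>2 ^ (i + 1)\<close> when \<open>p\<close> is written as a combination of indicator
  functions of balls.\<close>

definition layer :: "nat \<Rightarrow> real" where
  "layer i = 2 powr (- \<gamma> * real i) - 2 powr (- \<gamma> * real (Suc i))"

lemma layer_nonneg: "0 \<le> layer i"
  unfolding layer_def using \<gamma>_nonneg by (auto intro!: powr_mono mult_left_mono)

lemma layer_le: "layer i \<le> 2 powr (- \<gamma> * real i)"
  unfolding layer_def by simp

lemma layer_sum: "k \<le> J \<Longrightarrow> (\<Sum>i=k..<J. layer i) = 2 powr (- \<gamma> * real k) - 2 powr (- \<gamma> * real J)"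
  by (induction J rule: dec_induct) (simp_all add: layer_def)

text \<open>The value \<open>p 0\<close> is arbitrary, hence the correction at the origin.\<close>

lemma p_layers:
  assumes J: "2 ^ J \<le> R" "R \<le> 2 ^ (J + 1)" and n: "lattice_norm n < R"
  shows "p n = (if n = 0 then p 0 - 1 else 0)
    + (\<Sum>i<J. layer i * (if lattice_norm n < 2 ^ (i + 1) then 1 else 0)) + 2 powr (- \<gamma> * real J)"
proof (cases "n = 0")
  case True
  have "(\<Sum>i<J. layer i) = 1 - 2 powr (- \<gamma> * real J)"
    using layer_sum[of 0 J] by (simp add: atLeast0LessThan)
  then show ?thesis using True by simp
next
  case False
  obtain j :: nat where j: "2 ^ j \<le> lattice_norm n" "lattice_norm n < 2 ^ (j + 1)"
    using dyadic_level[OF lattice_norm_ge_1[OF False]] by metis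
  have "(2::real) ^ j < 2 ^ (J + 1)" using j n J by linarith
  then have jJ: "j \<le> J" by (simp add: power_strict_increasing_iff del: power_Suc)
  have *: "lattice_norm n < 2 ^ (i + 1) \<longleftrightarrow> j \<le> i" for i
  proof
    assume "lattice_norm n < 2 ^ (i + 1)"
    then have "(2::real) ^ j < 2 ^ (i + 1)" using j by linarith
    then show "j \<le> i" by (simp add: power_strict_increasing_iff del: power_Suc)
  next
    assume "j \<le> i"
    then have "(2::real) ^ (j + 1) \<le> 2 ^ (i + 1)" by (intro power_increasing) auto
    then show "lattice_norm n < 2 ^ (i + 1)" using j by linarith
  qed
  have "(\<Sum>i<J. layer i * (if lattice_norm n < 2 ^ (i + 1) then 1 else 0)) = (\<Sum>i\<in>{..<J}. if j \<le> i then layer i else 0)"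
    unfolding * by (intro sum.cong) auto
  also have "\<dots> = (\<Sum>i=j..<J. layer i)"
    by (subst sum.inter_filter[symmetric]) (auto intro!: sum.cong)
  also have "\<dots> = 2 powr (- \<gamma> * real j) - 2 powr (- \<gamma> * real J)" using jJ by (rule layer_sum)
  finally show ?thesis using False p_level[OF j] by simp
qed

text \<open>Summation by parts in the radius. Apart from the origin all coefficients are
  nonnegative, so estimates for ball sums pass to weighted sums; the constant \<open>h = 1\<close>
  yields the mass itself.\<close>

lemma weighted_sum_layers:
  assumes J: "2 ^ J \<le> R" "R \<le> 2 ^ (J + 1)"
  shows "(\<Sum>n\<in>lball R. p n * h n) = (p 0 - 1) * h 0
    + (\<Sum>i<J. layer i * (\<Sum>n\<in>lball (2 ^ (i + 1)). h n)) + 2 powr (- \<gamma> * real J) * (\<Sum>n\<in>lball R. h n)"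
proof -
  have R1: "1 \<le> R" using J(1) by (meson dual_order.trans one_le_numeral one_le_power)
  have "(\<Sum>n\<in>lball R. p n * h n) = (\<Sum>n\<in>lball R. (if n = 0 then (p 0 - 1) * h n else 0)
    + (\<Sum>i<J. layer i * (if lattice_norm n < 2 ^ (i + 1) then h n else 0)) + 2 powr (- \<gamma> * real J) * h n)"
    by (intro sum.cong refl, subst p_layers[OF J])
      (auto simp: sum_distrib_right distrib_right if_distrib[of "\<lambda>x. x * _"] if_distrib[of "\<lambda>x. _ * x"] cong: if_cong)
  also have "\<dots> = (\<Sum>n\<in>lball R. if n = 0 then (p 0 - 1) * h n else 0)
    + (\<Sum>n\<in>lball R. \<Sum>i<J. layer i * (if lattice_norm n < 2 ^ (i + 1) then h n else 0))
    + 2 powr (- \<gamma> * real J) * (\<Sum>n\<in>lball R. h n)"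
    by (simp add: sum.distrib sum_distrib_left)
  also have "(\<Sum>n\<in>lball R. if n = 0 then (p 0 - 1) * h n else 0) = (p 0 - 1) * h 0"
    using R1 by (subst sum.delta) auto
  also have "(\<Sum>n\<in>lball R. \<Sum>i<J. layer i * (if lattice_norm n < 2 ^ (i + 1) then h n else 0))
    = (\<Sum>i<J. layer i * (\<Sum>n\<in>lball R. if lattice_norm n < 2 ^ (i + 1) then h n else 0))"
    by (subst sum.swap) (simp add: sum_distrib_left)
  also have "\<dots> = (\<Sum>i<J. layer i * (\<Sum>n\<in>lball (2 ^ (i + 1)). h n))"
  proof (rule sum.cong[OF refl], rule arg_cong2[where f="(*)", OF refl])
    fix i assume "i \<in> {..<J}"
    then have "(2::real) ^ (i + 1) \<le> 2 ^ J" by (intro power_increasing) auto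
    then have sub: "lball (2 ^ (i + 1)) \<subseteq> (lball R :: (int ^ 'd) set)" using J by (intro lball_mono) linarith
    have "{n \<in> (lball R :: (int ^ 'd) set). lattice_norm n < 2 ^ (i + 1)} = lball (2 ^ (i + 1))"
      using sub by auto
    then show "(\<Sum>n\<in>lball R. if lattice_norm n < 2 ^ (i + 1) then h n else 0) = (\<Sum>n\<in>lball (2 ^ (i + 1)). h n)"
      by (subst sum.inter_filter[symmetric]) simp_all
  qed
  finally show ?thesis .
qed

lemma wsum_layers:
  assumes J: "2 ^ J \<le> R" "R \<le> 2 ^ (J + 1)"
  shows "wsum R = (p 0 - 1) + (\<Sum>i<J. layer i * bcount TYPE('d) (2 ^ (i + 1)))
    + 2 powr (- \<gamma> * real J) * bcount TYPE('d) R"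
  using weighted_sum_layers[OF J, of "\<lambda>_. 1"] by (simp add: wsum_def bcount_def)

text \<open>The coefficients of the balls add up to 1, so \<open>M\<close> is inherited once.
  Weighted by the sizes of the balls they give back \<open>wsum R\<close> up to the correction at
  the origin, which is the \<open>+ 1\<close>.\<close>

lemma weighted_sum_bound:
  fixes h :: "int ^ 'd \<Rightarrow> real" and R :: nat
  assumes h: "\<And>r::nat. (1::nat) \<le> r \<Longrightarrow> \<bar>\<Sum>n\<in>lball r. h n\<bar> \<le> M + \<epsilon> * bcount TYPE('d) r"
    and \<epsilon>: "0 \<le> \<epsilon>" and R: "1 \<le> R"
  shows "\<bar>\<Sum>n\<in>lball R. p n * h n\<bar> \<le> \<bar>h 0\<bar> + M + \<epsilon> * (wsum R + 1)"
proof -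
  obtain J :: nat where J: "2 ^ J \<le> real R" "real R \<le> 2 ^ (J + 1)"
    using dyadic_level[of "real R"] R by (metis less_imp_le of_nat_1 of_nat_le_iff)
  let ?w = "2 powr (- \<gamma> * real J)"
  have h2: "\<bar>\<Sum>n\<in>lball (2 ^ (i + 1)). h n\<bar> \<le> M + \<epsilon> * bcount TYPE('d) (2 ^ (i + 1))" for i :: nat
  proof -
    have "(1::nat) \<le> 2 ^ (i + 1)" by (rule one_le_power) simp
    from h[OF this] show ?thesis by simp
  qed
  have "\<bar>\<Sum>n\<in>lball R. p n * h n\<bar> \<le> \<bar>(p 0 - 1) * h 0\<bar>
    + \<bar>\<Sum>i<J. layer i * (\<Sum>n\<in>lball (2 ^ (i + 1)). h n)\<bar> + \<bar>?w * (\<Sum>n\<in>lball R. h n)\<bar>"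
    unfolding weighted_sum_layers[OF J] by linarith
  also have "\<bar>(p 0 - 1) * h 0\<bar> \<le> 1 * \<bar>h 0\<bar>"
    unfolding abs_mult using p_nonneg[of 0] p_le_1[of 0] by (intro mult_right_mono) auto
  also have "\<bar>\<Sum>i<J. layer i * (\<Sum>n\<in>lball (2 ^ (i + 1)). h n)\<bar>
    \<le> (\<Sum>i<J. layer i * (M + \<epsilon> * bcount TYPE('d) (2 ^ (i + 1))))"
    using layer_nonneg h2
    by (intro order_trans[OF sum_abs] sum_mono) (auto simp: abs_mult intro!: mult_left_mono)
  also have "\<bar>?w * (\<Sum>n\<in>lball R. h n)\<bar> \<le> ?w * (M + \<epsilon> * bcount TYPE('d) R)"
    using h[OF R] by (simp add: abs_mult)
  also have "1 * \<bar>h 0\<bar> + (\<Sum>i<J. layer i * (M + \<epsilon> * bcount TYPE('d) (2 ^ (i + 1)))) + ?w * (M + \<epsilon> * bcount TYPE('d) R)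
    = \<bar>h 0\<bar> + M * ((\<Sum>i<J. layer i) + ?w)
      + \<epsilon> * ((\<Sum>i<J. layer i * bcount TYPE('d) (2 ^ (i + 1))) + ?w * bcount TYPE('d) R)"
    by (simp add: algebra_simps sum.distrib sum_distrib_left)
  also have "(\<Sum>i<J. layer i) + ?w = 1" using layer_sum[of 0 J] by (simp add: atLeast0LessThan)
  also have "(\<Sum>i<J. layer i * bcount TYPE('d) (2 ^ (i + 1))) + ?w * bcount TYPE('d) R = wsum R + 1 - p 0"
    unfolding wsum_layers[OF J] by simp
  also have "\<epsilon> * (wsum R + 1 - p 0) \<le> \<epsilon> * (wsum R + 1)"
    using \<epsilon> p_nonneg[of 0] by (intro mult_left_mono) auto
  finally show ?thesis by simp
qed

section \<open>Growth of the weighted mass of balls\<close>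

lemma wsum_upper: "\<exists>C>0. \<forall>R\<ge>1. wsum R \<le> C * R powr (CARD('d) - \<gamma>)"
proof -
  obtain C where C: "0 < C" "\<And>r. 1 \<le> r \<Longrightarrow> bcount TYPE('d) r \<le> C * r ^ CARD('d)"
    using bcount_bounds[where 'd='d] by metis
  \<comment> \<open>Dyadic balls have mass of order \<open>q ^ J\<close>; as \<open>q > 1\<close>,
    the geometric sum over the layers is governed by its last term.\<close>
  define q where "q = (2::real) powr (CARD('d) - \<gamma>)"
  have q: "1 < q" unfolding q_def using \<gamma>_less by simp
  define C' where "C' = C * 2 ^ CARD('d) * (q / (q - 1))"
  have C': "0 < C'" using C q by (simp add: C'_def)
  moreover have "wsum R \<le> C' * R powr (CARD('d) - \<gamma>)" if R: "1 \<le> R" for R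
  proof -
    obtain J :: nat where J: "2 ^ J \<le> R" "R \<le> 2 ^ (J + 1)"
      using dyadic_level[OF R] by (metis less_imp_le)
    have b: "2 powr (- \<gamma> * real i) * bcount TYPE('d) (2 ^ (i + 1)) \<le> C * 2 ^ CARD('d) * q ^ i" for i
    proof -
      have "2 powr (- \<gamma> * real i) * bcount TYPE('d) (2 ^ (i + 1)) \<le> 2 powr (- \<gamma> * real i) * (C * (2 ^ (i + 1)) ^ CARD('d))"
        by (intro mult_left_mono C) (simp_all add: one_le_power del: power_Suc)
      also have "(2 ^ (i + 1)) ^ CARD('d) = 2 ^ CARD('d) * (2::real) powr (CARD('d) * real i)"
        by (simp add: powr_realpow[symmetric] powr_powr powr_add[symmetric] power_mult_distrib algebra_simps)
      also have "2 powr (- \<gamma> * real i) * (C * (2 ^ CARD('d) * 2 powr (CARD('d) * real i)))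
         = C * 2 ^ CARD('d) * 2 powr ((CARD('d) - \<gamma>) * real i)"
        by (simp add: powr_add[symmetric] algebra_simps)
      also have "2 powr ((CARD('d) - \<gamma>) * real i) = q ^ i"
        by (simp add: q_def powr_realpow[symmetric] powr_powr)
      finally show ?thesis .
    qed
    have "wsum R \<le> (\<Sum>i<J. layer i * bcount TYPE('d) (2 ^ (i + 1))) + 2 powr (- \<gamma> * real J) * bcount TYPE('d) R"
      unfolding wsum_layers[OF J] using p_le_1[of 0] by simp
    also have "\<dots> \<le> (\<Sum>i<J. C * 2 ^ CARD('d) * q ^ i) + C * 2 ^ CARD('d) * q ^ J"
    proof (intro add_mono sum_mono)
      show "layer i * bcount TYPE('d) (2 ^ (i + 1)) \<le> C * 2 ^ CARD('d) * q ^ i" for i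
        using layer_le[of i] by (intro order_trans[OF _ b]) (auto intro!: mult_right_mono)
      show "2 powr (- \<gamma> * real J) * bcount TYPE('d) R \<le> C * 2 ^ CARD('d) * q ^ J"
        using J(2) by (intro order_trans[OF _ b] mult_left_mono bcount_mono) auto
    qed
    also have "\<dots> = C * 2 ^ CARD('d) * (\<Sum>i<Suc J. q ^ i)"
      by (simp add: sum_distrib_left[symmetric] distrib_left)
    also have "(\<Sum>i<Suc J. q ^ i) = (q ^ Suc J - 1) / (q - 1)" using q by (subst geometric_sum) auto
    also have "\<dots> \<le> q ^ Suc J / (q - 1)" using q by (intro divide_right_mono) auto
    also have "C * 2 ^ CARD('d) * (q ^ Suc J / (q - 1)) = C' * q ^ J" by (simp add: C'_def)
    also have "q ^ J = (2 ^ J) powr (CARD('d) - \<gamma>)"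
      by (simp add: q_def powr_realpow[symmetric] powr_powr mult.commute)
    also have "\<dots> \<le> R powr (CARD('d) - \<gamma>)" using J \<gamma>_less by (intro powr_mono2) auto
    finally show ?thesis using C C' by simp
  qed
  ultimately show ?thesis by blast
qed

text \<open>Every nonzero point of the ball weighs at least \<open>R powr (- \<gamma>)\<close>.
  Discarding the origin costs at most half of the points, because for \<open>R \<ge> 2\<close> the
  ball has at least two.\<close>

lemma wsum_lower: "\<exists>c>0. \<forall>R\<ge>2. c * R powr (CARD('d) - \<gamma>) \<le> wsum R"
proof -
  obtain c where c: "0 < c" "\<And>r. 1 \<le> r \<Longrightarrow> c * r ^ CARD('d) \<le> bcount TYPE('d) r"
    using bcount_bounds[where 'd='d] by metis
  have "c / 2 * R powr (CARD('d) - \<gamma>) \<le> wsum R" if R: "2 \<le> R" for R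
  proof -
    have "c / 2 * R powr (CARD('d) - \<gamma>) = R powr (- \<gamma>) * ((c * R ^ CARD('d)) / 2)"
      using R by (simp add: powr_diff powr_minus powr_realpow field_simps)
    also have "\<dots> \<le> R powr (- \<gamma>) * (bcount TYPE('d) R / 2)"
      using c R by (intro mult_left_mono divide_right_mono) auto
    also have "\<dots> \<le> R powr (- \<gamma>) * (bcount TYPE('d) R - 1)"
      using bcount_ge_2[of R, where 'd='d] R by (intro mult_left_mono) auto
    also have "\<dots> = (\<Sum>n\<in>(lball R :: (int ^ 'd) set) - {0}. R powr (- \<gamma>))"
    proof -
      have "1 \<le> card (lball R :: (int ^ 'd) set)"
        using bcount_ge_1[of R, where 'd='d] R by (simp add: bcount_def)
      then show ?thesis
        using R by (subst sum_constant, subst card_Diff_singleton) (auto simp: bcount_def of_nat_diff)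
    qed
    also have "\<dots> \<le> (\<Sum>n\<in>(lball R :: (int ^ 'd) set) - {0}. p n)"
      by (intro sum_mono p_lower) auto
    also have "\<dots> \<le> wsum R" unfolding wsum_def by (intro sum_mono2) (auto simp: p_nonneg)
    finally show ?thesis .
  qed
  then show ?thesis using c by (intro exI[of _ "c / 2"]) auto
qed

lemma wsum_pos: "2 \<le> R \<Longrightarrow> 0 < wsum R"
  using wsum_lower by (metis less_le_trans mult_pos_pos powr_gt_zero not_numeral_le_zero)

lemma wsum_at_top: "filterlim wsum at_top at_top"
proof -
  obtain c where c: "c > 0" "\<And>R. 2 \<le> R \<Longrightarrow> c * R powr (CARD('d) - \<gamma>) \<le> wsum R" using wsum_lower by blast
  have "filterlim (\<lambda>R. c * R powr (CARD('d) - \<gamma>)) at_top at_top"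
    using c(1) \<gamma>_less by real_asymp
  then show ?thesis
    by (rule filterlim_at_top_mono) (rule eventually_mono[OF eventually_ge_at_top[of 2]], rule c(2))
qed

text \<open>The added shell carries at most \<open>2 powr \<gamma> * r powr (- \<gamma>)\<close> per
  point, while the mass already present is at least of order
  \<open>r powr (CARD('d) - \<gamma>)\<close>. So the relative growth of the mass is at most
  \<open>B\<close> times the relative growth of the number of points, and
  \<open>bcount_ratio\<close> applies.\<close>

lemma wsum_ratio:
  fixes r s :: "nat \<Rightarrow> real"
  assumes r: "filterlim r at_top sequentially" and s: "filterlim s at_top sequentially"
    and "(\<lambda>i. s i / r i) \<longlonglongrightarrow> 1" and le: "\<And>i. r i \<le> s i"
  shows "(\<lambda>i. wsum (s i) / wsum (r i)) \<longlonglongrightarrow> 1"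
proof -
  obtain c where c: "c > 0" "\<And>R. 2 \<le> R \<Longrightarrow> c * R powr (CARD('d) - \<gamma>) \<le> wsum R" using wsum_lower by blast
  obtain C where C: "0 < C" "\<And>r. 1 \<le> r \<Longrightarrow> bcount TYPE('d) r \<le> C * r ^ CARD('d)"
    using bcount_bounds[where 'd='d] by metis
  define B where "B = 2 powr \<gamma> * C / c"
  let ?b = "\<lambda>i. bcount TYPE('d) (s i) / bcount TYPE('d) (r i)"
  have "(\<lambda>i. 1 + B * (?b i - 1)) \<longlonglongrightarrow> 1 + B * (1 - 1)"
    by (intro tendsto_intros bcount_ratio r s assms(3))
  then have up: "(\<lambda>i. 1 + B * (?b i - 1)) \<longlonglongrightarrow> 1" by simp
  have ev: "\<forall>\<^sub>F i in sequentially. 2 \<le> r i" using r by (auto simp: filterlim_at_top)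
  show ?thesis
  proof (rule real_tendsto_sandwich[OF _ _ tendsto_const up])
    show "\<forall>\<^sub>F i in sequentially. 1 \<le> wsum (s i) / wsum (r i)"
      using ev by eventually_elim (use wsum_pos wsum_mono le in \<open>simp add: divide_simps\<close>)
    show "\<forall>\<^sub>F i in sequentially. wsum (s i) / wsum (r i) \<le> 1 + B * (?b i - 1)"
      using ev
    proof eventually_elim
      case (elim i)
      let ?r = "r i" and ?s = "s i"
      have b: "bcount TYPE('d) ?r > 0" using elim by simp
      have sub: "lball ?r \<subseteq> (lball ?s :: (int ^ 'd) set)" using le by (intro lball_mono)
      have "wsum ?s - wsum ?r = (\<Sum>n\<in>lball ?s - lball ?r. p n)"
        unfolding wsum_def using sub by (subst sum_diff) auto
      also have "\<dots> \<le> (\<Sum>n\<in>(lball ?s - lball ?r :: (int ^ 'd) set). 2 powr \<gamma> * ?r powr (- \<gamma>))"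
        using elim by (intro sum_mono p_upper) auto
      also have "\<dots> = (bcount TYPE('d) ?s - bcount TYPE('d) ?r) * (2 powr \<gamma> * ?r powr (- \<gamma>))"
        using sub card_mono[OF finite_lball sub] by (simp add: card_Diff_subset bcount_def of_nat_diff)
      also have "\<dots> = (?b i - 1) * (2 powr \<gamma> * (bcount TYPE('d) ?r * ?r powr (- \<gamma>)))"
        using b by (simp add: field_simps)
      also have "\<dots> \<le> (?b i - 1) * (2 powr \<gamma> * (C / c * wsum ?r))"
      proof (intro mult_left_mono)
        have "bcount TYPE('d) ?r * ?r powr (- \<gamma>) \<le> C * ?r ^ CARD('d) * ?r powr (- \<gamma>)"
          using C elim by (intro mult_right_mono) auto
        also have "\<dots> = C / c * (c * ?r powr (CARD('d) - \<gamma>))"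
          using elim c by (simp add: powr_diff powr_minus powr_realpow field_simps)
        also have "\<dots> \<le> C / c * wsum ?r" using c C elim by (intro mult_left_mono) auto
        finally show "bcount TYPE('d) ?r * ?r powr (- \<gamma>) \<le> C / c * wsum ?r" .
        show "0 \<le> ?b i - 1" using b bcount_mono[OF le, of i, where 'd='d] by (simp add: pos_le_divide_eq)
      qed auto
      also have "\<dots> = B * (?b i - 1) * wsum ?r" by (simp add: B_def)
      finally show ?case using wsum_pos[OF elim] by (simp add: field_simps)
    qed
  qed
qed

text \<open>A Toeplitz argument: after subtracting \<open>L\<close>, the ball sums at small radii
  contribute a constant \<open>M\<close> and the others at most \<open>\<epsilon>\<close> times the
  size of the ball. The mass tends to infinity and absorbs the constant.\<close>

lemma weighted_average_tendsto:
  fixes h :: "int ^ 'd \<Rightarrow> real"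
  assumes "(\<lambda>r::nat. (\<Sum>n\<in>lball r. h n) / bcount TYPE('d) r) \<longlonglongrightarrow> L"
  shows "(\<lambda>R::nat. (\<Sum>n\<in>lball R. p n * h n) / wsum R) \<longlonglongrightarrow> L"
proof -
  define u where "u n = h n - L" for n
  have Su: "(\<Sum>n\<in>lball r. u n) = (\<Sum>n\<in>lball r. h n) - L * bcount TYPE('d) r" for r
    by (simp add: u_def sum_subtractf bcount_def)
  have W: "filterlim (\<lambda>R::nat. wsum R) at_top sequentially"
    by (rule filterlim_compose[OF wsum_at_top filterlim_real_sequentially])
  have "(\<lambda>R::nat. (\<Sum>n\<in>lball R. p n * u n) / wsum R) \<longlonglongrightarrow> 0"
  proof (rule LIMSEQ_I)
    fix e :: real assume e: "0 < e"
    define \<epsilon> where "\<epsilon> = e / 4"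
    obtain r0 where r0: "\<And>r. r0 \<le> r \<Longrightarrow> \<bar>(\<Sum>n\<in>lball (real r). h n) / bcount TYPE('d) r - L\<bar> < \<epsilon>"
      using LIMSEQ_D[OF assms, of \<epsilon>] e by (auto simp: \<epsilon>_def)
    define M where "M = (\<Sum>r<r0. \<bar>\<Sum>n\<in>lball (real r). u n\<bar>)"
    have M0: "0 \<le> M" by (simp add: M_def sum_nonneg)
    have bd: "\<bar>\<Sum>n\<in>lball r. u n\<bar> \<le> M + \<epsilon> * bcount TYPE('d) r" if "1 \<le> r" for r :: nat
    proof (cases "r < r0")
      case True
      then have "\<bar>\<Sum>n\<in>lball r. u n\<bar> \<le> M" unfolding M_def by (intro member_le_sum) auto
      moreover have "0 \<le> \<epsilon> * bcount TYPE('d) r" using e by (simp add: \<epsilon>_def)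
      ultimately show ?thesis by linarith
    next
      case False
      have b: "bcount TYPE('d) r > 0" using that by simp
      have "(\<Sum>n\<in>lball r. u n) = ((\<Sum>n\<in>lball (real r). h n) / bcount TYPE('d) r - L) * bcount TYPE('d) r"
        using b by (simp add: Su field_simps)
      then have "\<bar>\<Sum>n\<in>lball r. u n\<bar> = \<bar>(\<Sum>n\<in>lball (real r). h n) / bcount TYPE('d) r - L\<bar> * bcount TYPE('d) r"
        by (simp add: abs_mult)
      also have "\<dots> \<le> \<epsilon> * bcount TYPE('d) r" using r0[of r] False by (intro mult_right_mono) auto
      finally show ?thesis using M0 by linarith
    qed
    \<comment> \<open>From mass \<open>A\<close> on, the constants amount to at most
      \<open>\<epsilon> * wsum R\<close>, so the total is at most
      \<open>2 * \<epsilon> * wsum R\<close>, half of what is allowed.\<close>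
    define A where "A = max 1 ((\<bar>u 0\<bar> + M + \<epsilon>) / \<epsilon>)"
    obtain R0 where R0: "\<And>R. R0 \<le> R \<Longrightarrow> A \<le> wsum (real R)"
      using W by (auto simp: filterlim_at_top eventually_sequentially)
    show "\<exists>no. \<forall>R\<ge>no. norm ((\<Sum>n\<in>lball (real R). p n * u n) / wsum (real R) - 0) < e"
    proof (intro exI[of _ "max 1 R0"] allI impI)
      fix R assume R: "max 1 R0 \<le> R"
      then have A: "A \<le> wsum R" using R0 by auto
      then have w: "1 \<le> wsum R" "(\<bar>u 0\<bar> + M + \<epsilon>) / \<epsilon> \<le> wsum R" by (auto simp: A_def)
      have "\<bar>\<Sum>n\<in>lball R. p n * u n\<bar> \<le> \<bar>u 0\<bar> + M + \<epsilon> * (wsum R + 1)"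
        using bd e R by (intro weighted_sum_bound) (auto simp: \<epsilon>_def)
      also have "\<dots> \<le> 2 * \<epsilon> * wsum R" using w(2) e by (simp add: \<epsilon>_def field_simps)
      also have "\<dots> < e * wsum R" using w e by (intro mult_strict_right_mono) (auto simp: \<epsilon>_def)
      finally show "norm ((\<Sum>n\<in>lball (real R). p n * u n) / wsum (real R) - 0) < e"
        using w by (simp add: abs_divide pos_divide_less_eq)
    qed
  qed
  then have "(\<lambda>R::nat. (\<Sum>n\<in>lball R. p n * u n) / wsum R + L) \<longlonglongrightarrow> 0 + L" by (intro tendsto_intros)
  moreover have "\<forall>\<^sub>F R::nat in sequentially. (\<Sum>n\<in>lball R. p n * u n) / wsum R + L = (\<Sum>n\<in>lball R. p n * h n) / wsum R"
    using eventually_ge_at_top[of 2]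
  proof eventually_elim
    case (elim R)
    then have "wsum R > 0" by (intro wsum_pos) auto
    then show ?case
      by (simp add: u_def right_diff_distrib sum_subtractf sum_distrib_right[symmetric] sum_distrib_left[symmetric] wsum_def[symmetric] field_simps)
  qed
  ultimately show ?thesis by (simp add: Lim_transform_eventually)
qed

end

section \<open>Sparse sets with small correlations\<close>

lemma (in finite_measure) measure_UN_le_of_partial_sums:
  assumes A: "\<And>i::nat. A i \<in> sets M" and B: "\<And>J. (\<Sum>j<J. measure M (A j)) \<le> B"
  shows "measure M (\<Union>i. A i) \<le> B"
proof -
  have s: "summable (\<lambda>i. measure M (A i))"
    by (rule summableI_nonneg_bounded[where x=B]) (use B in auto)
  have "measure M (\<Union>i. A i) \<le> (\<Sum>i. measure M (A i))"
    by (rule finite_measure_subadditive_countably[OF _ s]) (use A in auto)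
  also have "\<dots> \<le> B" by (rule suminf_le_const[OF s B])
  finally show ?thesis .
qed

text \<open>For \<open>y = f x\<close> this sums, over all scales, the price of the points where
  \<open>f\<close> exceeds the truncation height \<open>q ^ j\<close>. The largest term below
  \<open>y\<close> dominates.\<close>

lemma sum_geometric_below:
  fixes q y :: real
  assumes q: "1 < q" and y: "0 \<le> y"
  shows "(\<Sum>j<J. if q ^ j < y then q ^ j else 0) \<le> q / (q - 1) * y"
proof (induction J)
  case 0
  then show ?case using q y by simp
next
  case (Suc J)
  show ?case
  proof (cases "q ^ J < y")
    case True
    have "(\<Sum>j<Suc J. if q ^ j < y then q ^ j else 0) \<le> (\<Sum>j<Suc J. q ^ j)"
      using q by (intro sum_mono) auto
    also have "\<dots> = (q ^ Suc J - 1) / (q - 1)" using q by (subst geometric_sum) auto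
    also have "\<dots> \<le> q * y / (q - 1)" using q True by (intro divide_right_mono) (auto intro: order_trans[of _ "q * q ^ J"])
    finally show ?thesis by simp
  qed (use Suc in simp)
qed

text \<open>The complementary sum, for the square of the truncated function; now the first
  admissible scale dominates.\<close>

lemma sum_geometric_above:
  fixes q y :: real
  assumes q: "1 < q" and y: "0 \<le> y"
  shows "(\<Sum>j<J. if y \<le> q ^ j then y\<^sup>2 / q ^ j else 0) \<le> q / (q - 1) * y"
proof (cases "\<exists>j. y \<le> q ^ j \<and> j < J")
  case False
  then have "(\<Sum>j<J. if y \<le> q ^ j then y\<^sup>2 / q ^ j else 0) = 0" by (intro sum.neutral) auto
  then show ?thesis using q y by simp
next
  case True
  define k where "k = (LEAST j. y \<le> q ^ j)"
  have k: "y \<le> q ^ k" unfolding k_def using True by (auto intro: LeastI)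
  have least: "k \<le> j" if "y \<le> q ^ j" for j unfolding k_def using that by (rule Least_le)
  have "(\<Sum>j<J. if y \<le> q ^ j then y\<^sup>2 / q ^ j else 0) = (\<Sum>j\<in>{j\<in>{..<J}. y \<le> q ^ j}. y\<^sup>2 / q ^ j)"
    by (subst sum.inter_filter) auto
  also have "\<dots> \<le> (\<Sum>j\<in>{k..<k+J}. y\<^sup>2 / q ^ j)"
    using q least by (intro sum_mono2) auto
  also have "\<dots> = (\<Sum>i<J. y\<^sup>2 / q ^ k * (1/q) ^ i)"
    by (rule sum.reindex_bij_witness[of _ "\<lambda>i. i + k" "\<lambda>j. j - k"]) (auto simp: power_add[symmetric] power_divide)
  also have "\<dots> = y\<^sup>2 / q ^ k * (((1/q) ^ J - 1) / (1/q - 1))"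
    using q by (subst sum_distrib_left[symmetric], subst geometric_sum) auto
  also have "\<dots> \<le> y\<^sup>2 / q ^ k * (q / (q - 1))"
  proof (rule mult_left_mono)
    have "((1/q) ^ J - 1) / (1/q - 1) = (1 - (1/q) ^ J) * (q / (q - 1))"
      using q by (simp add: field_simps)
    also have "\<dots> \<le> 1 * (q / (q - 1))" using q by (intro mult_right_mono) auto
    finally show "((1/q) ^ J - 1) / (1/q - 1) \<le> q / (q - 1)" by simp
  qed (use q in simp)
  also have "\<dots> \<le> y * (q / (q - 1))"
  proof (rule mult_right_mono)
    have "y * y \<le> y * q ^ k" using k y by (rule mult_left_mono)
    then show "y\<^sup>2 / q ^ k \<le> y" using q by (simp add: pos_divide_le_eq power2_eq_square)
  qed (use q in simp)
  finally show ?thesis by (simp add: mult.commute)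
qed

text \<open>The predecessor of the least index beyond \<open>i0\<close> whose value exceeds
  \<open>n\<close> has the required property. Minimality takes the place of monotonicity of
  \<open>N\<close>.\<close>

lemma bracket_index:
  fixes N :: "nat \<Rightarrow> nat"
  assumes "filterlim N at_top sequentially" "N i0 \<le> n"
  obtains i where "i0 \<le> i" "N i \<le> n" "n < N (Suc i)"
proof -
  have "\<forall>\<^sub>F i in sequentially. Suc n \<le> N i \<and> i0 < i"
    using assms(1) by (intro eventually_conj) (auto simp: filterlim_at_top eventually_gt_at_top)
  then obtain j where "Suc n \<le> N j \<and> i0 < j" by (auto dest!: eventually_happens)
  then have j: "n < N j \<and> i0 < j" by auto
  define k where "k = (LEAST j. n < N j \<and> i0 < j)"
  have k: "n < N k" "i0 < k" using LeastI[of "\<lambda>j. n < N j \<and> i0 < j", OF j] by (auto simp: k_def)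
  obtain i where i: "k = Suc i" using k by (cases k) auto
  have "\<not> (n < N i \<and> i0 < i)" using not_less_Least[of i "\<lambda>j. n < N j \<and> i0 < j"] i by (simp add: k_def)
  moreover have "i0 \<le> i" using k i by simp
  ultimately show ?thesis using that[of i] k i assms(2) by (cases "i = i0") auto
qed

text \<open>Between consecutive times the block of new terms has vanishing relative length. It
  enters twice, through the added terms and through the changed denominator, whence
  \<open>2 * K\<close> in the error.\<close>

lemma averages_tendsto_of_subsequence:
  fixes u :: "nat \<Rightarrow> real" and N :: "nat \<Rightarrow> nat"
  assumes K: "\<And>k. \<bar>u k\<bar> \<le> K"
    and N: "filterlim N at_top sequentially" "(\<lambda>i. real (N (Suc i)) / real (N i)) \<longlonglongrightarrow> 1"
    and L: "(\<lambda>i. (\<Sum>k=1..N i. u k) / real (N i)) \<longlonglongrightarrow> L"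
  shows "(\<lambda>n. (\<Sum>k=1..n. u k) / real n) \<longlonglongrightarrow> L"
proof (rule LIMSEQ_I)
  fix e :: real assume e: "0 < e"
  have K0: "0 \<le> K" using K[of 0] by linarith
  \<comment> \<open>The total error is \<open>(2 * K + 1) * \<delta> = e / 2\<close>; the summand 1
    is the distance to \<open>L\<close> along the subsequence.\<close>
  define \<delta> where "\<delta> = e / (2 * (2 * K + 1))"
  have \<delta>: "0 < \<delta>" using e K0 by (simp add: \<delta>_def)
  have "\<forall>\<^sub>F i in sequentially. 1 \<le> N i \<and> real (N (Suc i)) / real (N i) < 1 + \<delta> \<and>
      dist ((\<Sum>k=1..N i. u k) / real (N i)) L < \<delta>"
    using N(1) order_tendstoD(2)[OF N(2), of "1 + \<delta>"] tendstoD[OF L \<delta>] \<delta>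
    by (intro eventually_conj) (auto simp: filterlim_at_top)
  then obtain i0 where i0: "\<And>i. i0 \<le> i \<Longrightarrow> 1 \<le> N i \<and> real (N (Suc i)) / real (N i) < 1 + \<delta> \<and>
      dist ((\<Sum>k=1..N i. u k) / real (N i)) L < \<delta>"
    by (auto simp: eventually_sequentially)
  have bd: "\<bar>sum u A\<bar> \<le> K * real (card A)" for A
    using sum_norm_bound[of A u K] K by (simp add: mult.commute)
  show "\<exists>no. \<forall>n\<ge>no. norm ((\<Sum>k=1..n. u k) / real n - L) < e"
  proof (intro exI[of _ "N i0"] allI impI)
    fix n assume n: "N i0 \<le> n"
    obtain i where i: "i0 \<le> i" "N i \<le> n" "n < N (Suc i)" using bracket_index[OF N(1) n] by metis
    note i0 = i0[OF i(1)]
    have N1: "0 < real (N i)" using i0 by simp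
    have n1: "0 < real n" using N1 i(2) by linarith
    define s t where "s = (\<Sum>k=1..N i. u k)" and "t = (\<Sum>k=N i + 1..n. u k)"
    have st: "(\<Sum>k=1..n. u k) = s + t"
      unfolding s_def t_def using sum.ub_add_nat[of 1 "N i" u "n - N i"] i0 i(2) by simp
    have sb: "\<bar>s\<bar> \<le> K * real (N i)" unfolding s_def using bd[of "{1..N i}"] by simp
    have tb: "\<bar>t\<bar> \<le> K * (real n - real (N i))" unfolding t_def using bd[of "{N i + 1..n}"] i(2) by (simp add: of_nat_diff)
    have "(s + t) / n - s / N i = t / n - s / N i * ((real n - real (N i)) / n)"
      using N1 n1 by (simp add: field_simps)
    also have "\<bar>\<dots>\<bar> \<le> \<bar>t / n\<bar> + \<bar>s / N i\<bar> * ((real n - real (N i)) / n)"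
      using i(2) n1 by (intro order_trans[OF abs_triangle_ineq4]) (simp add: abs_mult)
    also have "\<dots> \<le> K * ((real n - real (N i)) / n) + K * ((real n - real (N i)) / n)"
      using sb tb N1 n1 i(2)
      by (intro add_mono mult_right_mono) (auto simp: abs_divide pos_divide_le_eq)
    also have "\<dots> = 2 * K * ((real n - real (N i)) / n)" by simp
    also have "\<dots> \<le> 2 * K * \<delta>"
    proof (rule mult_left_mono)
      have "(real n - real (N i)) / n \<le> (real n - real (N i)) / N i"
        using i(2) N1 n1 by (intro divide_left_mono) auto
      also have "\<dots> \<le> (real (N (Suc i)) - real (N i)) / N i" using i(3) by (intro divide_right_mono) auto
      also have "\<dots> \<le> \<delta>" using i0 N1 by (simp add: diff_divide_distrib)
      finally show "(real n - real (N i)) / n \<le> \<delta>" .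
    qed (use K0 in simp)
    finally have "\<bar>(s + t) / n - s / N i\<bar> \<le> 2 * K * \<delta>" .
    moreover have "\<bar>s / N i - L\<bar> < \<delta>" using i0 by (simp add: s_def dist_real_def)
    ultimately have "\<bar>(s + t) / n - L\<bar> < 2 * K * \<delta> + \<delta>" by linarith
    also have "\<dots> = (2 * K + 1) * \<delta>" by (simp add: algebra_simps)
    also have "\<dots> = e / 2"
    proof -
      have "2 * K + 1 \<noteq> 0" using K0 by linarith
      moreover have "c * (e / (2 * c)) = e / 2" if "c \<noteq> 0" for c :: real using that by simp
      ultimately show ?thesis unfolding \<delta>_def by blast
    qed
    also have "\<dots> < e" using e by simp
    finally show "norm ((\<Sum>k=1..n. u k) / real n - L) < e" unfolding st by simp
  qed
qed

text \<open>The indices whose points lie in the ball form a finite set that is closed downwards,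
  because the norms are nondecreasing; hence they are an initial segment starting at 1. Points of
  equal norm are in the ball together or not at all, so the order among ties is immaterial.\<close>

lemma norm_enumeration_prefix:
  assumes a: "norm_enumeration a (S :: (int ^ 'd::finite) set)"
  shows "a ` {1..card (S \<inter> lball R)} = S \<inter> lball R"
proof -
  define K where "K = {k\<in>{1..}. lattice_norm (a k) < R}"
  have bij: "bij_betw a {1..} S" and mono: "mono_on {1..} (\<lambda>k. lattice_norm (a k))"
    using a by (auto simp: norm_enumeration_def)
  have img: "a ` K = S \<inter> lball R" using bij by (auto simp: K_def bij_betw_def)
  have inj: "inj_on a K" using bij by (auto simp: K_def bij_betw_def inj_on_def)
  have fin: "finite K" using finite_imageD[OF _ inj] img by simp
  have card: "card K = card (S \<inter> lball R)" using card_image[OF inj] img by simp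
  have down: "k \<in> K" if "l \<in> K" "1 \<le> k" "k \<le> l" for k l
  proof -
    have "lattice_norm (a k) \<le> lattice_norm (a l)" using mono that by (auto simp: mono_on_def K_def)
    then show ?thesis using that by (auto simp: K_def)
  qed
  have "K = {1..card K}"
  proof (cases "K = {}")
    case False
    define M where "M = Max K"
    have "M \<in> K" unfolding M_def using fin False by (rule Max_in)
    have "K = {1..M}"
    proof (intro equalityI subsetI)
      show "k \<in> {1..M}" if "k \<in> K" for k
        using that Max_ge[OF fin that] by (simp add: M_def K_def)
      show "k \<in> K" if "k \<in> {1..M}" for k
        using down[OF \<open>M \<in> K\<close>] that by simp
    qed
    then show ?thesis by simp
  qed simp
  then show ?thesis using img card by metis
qed

text \<open>The deterministic outcome of the probabilistic part. Both exponents are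
  \<open>3 / 2\<close> times that of a standard deviation: \<open>(CARD('d) - \<gamma>) / 2\<close>
  for the count and \<open>CARD('d) / 2 - \<gamma>\<close> for a correlation. The factor 2 stems
  from splitting a correlation into two parity classes. No action occurs, so one null set serves all
  systems.\<close>

locale sparse_set = dyadic_weight p \<gamma> for p :: "int ^ 'd::finite \<Rightarrow> real" and \<gamma> :: real +
  fixes S :: "(int ^ 'd) set"
  assumes \<gamma>_half: "\<gamma> < CARD('d) / 2"
    and count_error: "\<forall>\<^sub>F R::nat in sequentially.
      \<bar>\<Sum>n\<in>lball R. indicator S n - p n\<bar> \<le> R powr (3 / 4 * (CARD('d) - \<gamma>))"
    and correlation_error: "\<forall>\<^sub>F R::nat in sequentially. \<forall>m. m \<noteq> 0 \<longrightarrow>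
      \<bar>\<Sum>n | n \<in> lball R \<and> n + m \<in> lball R. (indicator S n - p n) * (indicator S (n + m) - p (n + m))\<bar>
        \<le> 2 * R powr (3 / 2 * (CARD('d) / 2 - \<gamma>))"
begin

abbreviation \<eta> :: "int ^ 'd \<Rightarrow> real" where "\<eta> n \<equiv> indicator S n - p n"

definition cnt :: "real \<Rightarrow> nat" where "cnt R = card (S \<inter> lball R)"

lemma cnt_eq: "real (cnt R) = wsum R + (\<Sum>n\<in>lball R. \<eta> n)"
proof -
  have "real (cnt R) = (\<Sum>n\<in>lball R. indicator S n)"
    by (simp add: cnt_def sum.If_cases indicator_def Int_commute)
  then show ?thesis by (simp add: wsum_def sum_subtractf)
qed

lemma cnt_ratio: "(\<lambda>R::nat. real (cnt R) / wsum R) \<longlonglongrightarrow> 1"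
proof -
  define a where "a = CARD('d) - \<gamma>"
  have a: "a > 0" using \<gamma>_less by (simp add: a_def)
  obtain c where c: "c > 0" "\<And>R. 2 \<le> R \<Longrightarrow> c * R powr a \<le> wsum R" using wsum_lower unfolding a_def by blast
  have "(\<lambda>R::nat. (\<Sum>n\<in>lball R. \<eta> n) / wsum R) \<longlonglongrightarrow> 0"
  proof (rule Lim_null_comparison)
    show "\<forall>\<^sub>F R::nat in sequentially. norm ((\<Sum>n\<in>lball R. \<eta> n) / wsum R) \<le> R powr (3/4 * a) / (c * R powr a)"
      using count_error eventually_ge_at_top[of 2]
    proof eventually_elim
      case (elim R)
      have cw: "0 < c * R powr a" "c * R powr a \<le> wsum R" using c elim by auto
      have "norm ((\<Sum>n\<in>lball R. \<eta> n) / wsum R) = \<bar>\<Sum>n\<in>lball R. \<eta> n\<bar> / wsum R"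
        using cw by (simp add: abs_divide)
      also have "\<dots> \<le> R powr (3/4 * a) / (c * R powr a)"
        using elim(1) cw by (intro frac_le) (auto simp: a_def)
      finally show ?case .
    qed
    show "(\<lambda>R::nat. R powr (3/4 * a) / (c * R powr a)) \<longlonglongrightarrow> 0"
      using a c by real_asymp
  qed
  then have "(\<lambda>R::nat. 1 + (\<Sum>n\<in>lball R. \<eta> n) / wsum R) \<longlonglongrightarrow> 1 + 0" by (intro tendsto_intros)
  moreover have "\<forall>\<^sub>F R::nat in sequentially. 1 + (\<Sum>n\<in>lball R. \<eta> n) / wsum R = real (cnt R) / wsum R"
    using eventually_ge_at_top[of 2]
  proof eventually_elim
    case (elim R)
    then have "wsum R > 0" by (intro wsum_pos) auto
    then show ?case by (simp add: cnt_eq add_divide_distrib)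
  qed
  ultimately show ?thesis by (simp add: Lim_transform_eventually)
qed

lemma cnt_bounds:
  "\<forall>\<^sub>F R::nat in sequentially. wsum R / 2 \<le> real (cnt R) \<and> real (cnt R) \<le> 2 * wsum R \<and> 0 < wsum R"
proof -
  have "\<forall>\<^sub>F R::nat in sequentially. 1 / 2 < real (cnt R) / wsum R"
    by (rule order_tendstoD(1)[OF cnt_ratio]) simp
  moreover have "\<forall>\<^sub>F R::nat in sequentially. real (cnt R) / wsum R < 2"
    by (rule order_tendstoD(2)[OF cnt_ratio]) simp
  ultimately show ?thesis using eventually_ge_at_top[of 2]
  proof eventually_elim
    case (elim R)
    then have "wsum R > 0" by (intro wsum_pos) auto
    then show ?case using elim by (simp add: field_simps)
  qed
qed

lemma cnt_at_top: "filterlim (\<lambda>R::nat. cnt R) at_top sequentially"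
proof -
  have "filterlim (\<lambda>R::nat. wsum R) at_top sequentially"
    by (rule filterlim_compose[OF wsum_at_top filterlim_real_sequentially])
  then have "filterlim (\<lambda>R::nat. 1 / 2 * wsum R) at_top sequentially"
    by (rule filterlim_tendsto_pos_mult_at_top[OF tendsto_const, rotated]) simp
  then have real: "filterlim (\<lambda>R::nat. real (cnt R)) at_top sequentially"
    by (rule filterlim_at_top_mono) (rule eventually_mono[OF cnt_bounds], simp)
  show ?thesis
    unfolding filterlim_at_top
  proof
    fix Z
    have "\<forall>\<^sub>F R::nat in sequentially. real Z \<le> real (cnt R)" using real unfolding filterlim_at_top by blast
    then show "\<forall>\<^sub>F R::nat in sequentially. Z \<le> cnt R" by simp
  qed
qed

lemma sum_\<eta>_square_le: "(\<Sum>n\<in>lball R. \<eta> n * \<eta> n) \<le> real (cnt R) + wsum R"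
proof -
  have "(\<Sum>n\<in>lball R. \<eta> n * \<eta> n) \<le> (\<Sum>n\<in>lball R. indicator S n + p n)"
  proof (rule sum_mono)
    fix n
    have "p n * p n \<le> 1 * p n" using p_le_1 p_nonneg by (intro mult_right_mono)
    then show "\<eta> n * \<eta> n \<le> indicator S n + p n"
      using p_nonneg[of n] p_le_1[of n] by (cases "n \<in> S") (auto simp: algebra_simps)
  qed
  also have "\<dots> = real (cnt R) + wsum R"
    by (simp add: cnt_def sum.If_cases indicator_def Int_commute sum.distrib wsum_def)
  finally show ?thesis .
qed

end

section \<open>Second moments of the error sums\<close>

locale sparse_action = zd_action X T + sparse_set p \<gamma> S
  for X :: "'x measure" and T :: "int ^ 'd::finite \<Rightarrow> 'x \<Rightarrow> 'x"
    and p :: "int ^ 'd \<Rightarrow> real" and \<gamma> :: real and S :: "(int ^ 'd) set"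
begin

definition esum :: "('x \<Rightarrow> real) \<Rightarrow> real \<Rightarrow> 'x \<Rightarrow> real" where
  "esum f R x = (\<Sum>n\<in>lball R. \<eta> n * f (T n x))"

definition ssum :: "('x \<Rightarrow> real) \<Rightarrow> real \<Rightarrow> 'x \<Rightarrow> real" where
  "ssum f R x = (\<Sum>n\<in>S \<inter> lball R. f (T n x))"

lemma ssum_eq: "ssum f R x = (\<Sum>n\<in>lball R. p n * f (T n x)) + esum f R x"
proof -
  have "ssum f R x = (\<Sum>n\<in>lball R. indicator S n * f (T n x))"
    unfolding ssum_def
    by (rule sum.mono_neutral_cong_left) (auto simp: indicator_def)
  then show ?thesis by (simp add: esum_def sum.distrib[symmetric] algebra_simps)
qed

lemma esum_measurable [measurable]:
  assumes [measurable]: "f \<in> borel_measurable X"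
  shows "esum f R \<in> borel_measurable X"
  unfolding esum_def by measurable

lemma ssum_measurable [measurable]:
  assumes [measurable]: "f \<in> borel_measurable X"
  shows "ssum f R \<in> borel_measurable X"
  unfolding ssum_def by measurable

text \<open>By invariance the integral of \<open>f (T n x) * f (T k x)\<close> depends only on
  \<open>m = k - n\<close>; grouping by \<open>m\<close> collects the correlations of
  \<open>\<eta>\<close> as coefficients.\<close>

lemma esum_square_integral:
  assumes f [measurable]: "f \<in> borel_measurable X" and fK: "\<forall>x\<in>space X. \<bar>f x\<bar> \<le> K"
  shows "(\<integral>x. (esum f R x)\<^sup>2 \<partial>X) = (\<Sum>m\<in>lball (2 * R).
    (\<Sum>n | n \<in> lball R \<and> n + m \<in> lball R. \<eta> n * \<eta> (n + m)) * (\<integral>x. f x * f (T m x) \<partial>X))"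
proof -
  let ?B = "lball R :: (int ^ 'd) set" and ?L = "lball (2 * R) :: (int ^ 'd) set"
  define g where "g m = (\<integral>x. f x * f (T m x) \<partial>X)" for m
  have prod: "integrable X (\<lambda>x. f (T n x) * f (T k x))" for n k
  proof (rule bounded_integrable[where K="K * K"])
    show "\<forall>x\<in>space X. \<bar>f (T n x) * f (T k x)\<bar> \<le> K * K"
    proof
      fix x assume x: "x \<in> space X"
      have "\<bar>f (T n x)\<bar> \<le> K" "\<bar>f (T k x)\<bar> \<le> K" using fK x by auto
      then show "\<bar>f (T n x) * f (T k x)\<bar> \<le> K * K" unfolding abs_mult by (intro mult_mono) auto
    qed
  qed simp
  have gT: "(\<integral>x. f (T n x) * f (T k x) \<partial>X) = g (k - n)" for n k
  proof -
    have "g (k - n) = (\<integral>x. f (T n x) * f (T (k - n) (T n x)) \<partial>X)"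
      unfolding g_def by (rule integral_T[symmetric]) simp
    also have "\<dots> = (\<integral>x. f (T n x) * f (T k x) \<partial>X)"
      by (intro Bochner_Integration.integral_cong refl) (simp add: T_add)
    finally show ?thesis by simp
  qed
  have "(\<integral>x. (esum f R x)\<^sup>2 \<partial>X) = (\<integral>x. (\<Sum>n\<in>?B. \<Sum>k\<in>?B. (\<eta> n * \<eta> k) * (f (T n x) * f (T k x))) \<partial>X)"
    by (intro Bochner_Integration.integral_cong refl) (simp add: esum_def power2_eq_square sum_product mult_ac)
  also have "\<dots> = (\<Sum>n\<in>?B. \<Sum>k\<in>?B. (\<eta> n * \<eta> k) * g (k - n))"
    using prod by (simp add: Bochner_Integration.integral_sum gT)
  also have "\<dots> = (\<Sum>n\<in>?B. \<Sum>m\<in>?L. if n + m \<in> ?B then (\<eta> n * \<eta> (n + m)) * g m else 0)"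
  proof (rule sum.cong[OF refl])
    fix n assume n: "n \<in> ?B"
    have "(\<Sum>k\<in>?B. (\<eta> n * \<eta> k) * g (k - n)) = (\<Sum>m\<in>{m\<in>?L. n + m \<in> ?B}. (\<eta> n * \<eta> (n + m)) * g m)"
    proof (rule sum.reindex_bij_witness[of _ "\<lambda>m. n + m" "\<lambda>k. k - n"])
      fix k assume k: "k \<in> ?B"
      have "lattice_norm (k - n) \<le> lattice_norm k + lattice_norm n"
        using lattice_norm_triangle[of k "- n"] by simp
      then show "k - n \<in> {m\<in>?L. n + m \<in> ?B}" using k n by auto
    qed auto
    also have "\<dots> = (\<Sum>m\<in>?L. if n + m \<in> ?B then (\<eta> n * \<eta> (n + m)) * g m else 0)"
      by (rule sum.inter_filter) simp
    finally show "(\<Sum>k\<in>?B. (\<eta> n * \<eta> k) * g (k - n)) = (\<Sum>m\<in>?L. if n + m \<in> ?B then (\<eta> n * \<eta> (n + m)) * g m else 0)" .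
  qed
  also have "\<dots> = (\<Sum>m\<in>?L. \<Sum>n\<in>?B. if n + m \<in> ?B then (\<eta> n * \<eta> (n + m)) * g m else 0)"
    by (rule sum.swap)
  also have "\<dots> = (\<Sum>m\<in>?L. (\<Sum>n | n \<in> ?B \<and> n + m \<in> ?B. \<eta> n * \<eta> (n + m)) * g m)"
  proof (rule sum.cong[OF refl])
    fix m
    have "(\<Sum>n\<in>?B. if n + m \<in> ?B then (\<eta> n * \<eta> (n + m)) * g m else 0)
      = (\<Sum>n | n \<in> ?B \<and> n + m \<in> ?B. \<eta> n * \<eta> (n + m) * g m)"
      by (rule sum.inter_filter[symmetric]) simp
    then show "(\<Sum>n\<in>?B. if n + m \<in> ?B then (\<eta> n * \<eta> (n + m)) * g m else 0)
      = (\<Sum>n | n \<in> ?B \<and> n + m \<in> ?B. \<eta> n * \<eta> (n + m)) * g m"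
      by (simp add: sum_distrib_right)
  qed
  finally show ?thesis by (simp add: g_def)
qed

text \<open>The diagonal coefficient, the sum of \<open>\<eta> n * \<eta> n\<close>, is comparable
  to the mass. Off the diagonal the uniform correlation bound is taken out and the shifts of
  \<open>\<bar>f\<bar>\<close> reassemble to a ball sum. \<open>f\<close> and \<open>K\<close> are
  quantified under \<open>eventually\<close> because the truncations applied later depend on the
  radius.\<close>

lemma esum_L2_bound:
  "\<forall>\<^sub>F R::nat in sequentially. \<forall>f K. f \<in> borel_measurable X \<longrightarrow> (\<forall>x\<in>space X. \<bar>f x\<bar> \<le> K) \<longrightarrow>
     (\<integral>x. (esum f R x)\<^sup>2 \<partial>X) \<le> 3 * wsum R * (\<integral>x. (f x)\<^sup>2 \<partial>X)
       + 2 * R powr (3 / 2 * (CARD('d) / 2 - \<gamma>)) * (\<integral>x. \<bar>f x\<bar> * osum (\<lambda>x. \<bar>f x\<bar>) (2 * real R) x \<partial>X)"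
  using correlation_error cnt_bounds eventually_gt_at_top[of 0]
proof (eventually_elim, intro allI impI)
  fix R :: nat and f :: "'x \<Rightarrow> real" and K :: real
  assume corr: "\<forall>m. m \<noteq> 0 \<longrightarrow> \<bar>\<Sum>n | n \<in> lball R \<and> n + m \<in> lball R. \<eta> n * \<eta> (n + m)\<bar>
        \<le> 2 * R powr (3 / 2 * (CARD('d) / 2 - \<gamma>))"
    and cnt: "wsum R / 2 \<le> real (cnt R) \<and> real (cnt R) \<le> 2 * wsum R \<and> 0 < wsum R" and R: "0 < R"
    and f [measurable]: "f \<in> borel_measurable X" and fK: "\<forall>x\<in>space X. \<bar>f x\<bar> \<le> K"
  define \<beta> where "\<beta> = 2 * R powr (3 / 2 * (CARD('d) / 2 - \<gamma>))"
  have \<beta>: "0 \<le> \<beta>" by (simp add: \<beta>_def)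
  define \<kappa> where "\<kappa> m = (\<Sum>n | n \<in> lball R \<and> n + m \<in> lball R. \<eta> n * \<eta> (n + m))" for m :: "int ^ 'd"
  define g where "g m = (\<integral>x. f x * f (T m x) \<partial>X)" for m
  define G where "G m = (\<integral>x. \<bar>f x\<bar> * \<bar>f (T m x)\<bar> \<partial>X)" for m
  let ?L = "lball (2 * real R) :: (int ^ 'd) set"
  have iG: "integrable X (\<lambda>x. \<bar>f x\<bar> * \<bar>f (T m x)\<bar>)" for m
  proof (rule bounded_integrable[where K="K * K"])
    show "\<forall>x\<in>space X. \<bar>\<bar>f x\<bar> * \<bar>f (T m x)\<bar>\<bar> \<le> K * K"
    proof
      fix x assume x: "x \<in> space X"
      have "\<bar>f x\<bar> \<le> K" "\<bar>f (T m x)\<bar> \<le> K" using fK x by auto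
      then show "\<bar>\<bar>f x\<bar> * \<bar>f (T m x)\<bar>\<bar> \<le> K * K" unfolding abs_mult by (intro mult_mono) auto
    qed
  qed simp
  have G0: "0 \<le> G m" for m by (simp add: G_def)
  have gG: "\<bar>g m\<bar> \<le> G m" for m
  proof -
    have "\<bar>g m\<bar> \<le> (\<integral>x. \<bar>f x * f (T m x)\<bar> \<partial>X)" unfolding g_def by (rule integral_abs_bound)
    then show ?thesis by (simp add: G_def abs_mult)
  qed
  have g0: "g 0 = (\<integral>x. (f x)\<^sup>2 \<partial>X)"
    unfolding g_def by (intro Bochner_Integration.integral_cong refl) (simp add: power2_eq_square)
  have "(\<integral>x. (esum f R x)\<^sup>2 \<partial>X) = (\<Sum>m\<in>?L. \<kappa> m * g m)"
    unfolding \<kappa>_def g_def by (rule esum_square_integral[OF f fK])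
  also have "\<dots> = \<kappa> 0 * g 0 + (\<Sum>m\<in>?L - {0}. \<kappa> m * g m)"
    using R by (subst sum.remove[of _ 0]) auto
  also have "\<kappa> 0 * g 0 \<le> 3 * wsum R * (\<integral>x. (f x)\<^sup>2 \<partial>X)"
  proof -
    have "\<kappa> 0 = (\<Sum>n\<in>lball R. \<eta> n * \<eta> n)" unfolding \<kappa>_def by (intro sum.cong) auto
    also have "\<dots> \<le> real (cnt R) + wsum R" by (rule sum_\<eta>_square_le)
    also have "\<dots> \<le> 3 * wsum R" using cnt by simp
    finally show ?thesis unfolding g0 by (intro mult_right_mono) auto
  qed
  also have "(\<Sum>m\<in>?L - {0}. \<kappa> m * g m) \<le> (\<Sum>m\<in>?L - {0}. \<beta> * G m)"
  proof (rule sum_mono)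
    fix m assume "m \<in> ?L - {0}"
    then have "\<bar>\<kappa> m\<bar> \<le> \<beta>" using corr by (simp add: \<kappa>_def \<beta>_def)
    then have "\<bar>\<kappa> m\<bar> * \<bar>g m\<bar> \<le> \<beta> * G m" using gG \<beta> by (intro mult_mono) auto
    then show "\<kappa> m * g m \<le> \<beta> * G m" by (metis abs_ge_self abs_mult order_trans)
  qed
  also have "\<dots> \<le> (\<Sum>m\<in>?L. \<beta> * G m)" using \<beta> G0 by (intro sum_mono2) auto
  also have "\<dots> = \<beta> * (\<integral>x. \<bar>f x\<bar> * osum (\<lambda>x. \<bar>f x\<bar>) (2 * real R) x \<partial>X)"
    unfolding osum_def G_def sum_distrib_left[symmetric] using iG
    by (simp add: sum_distrib_left Bochner_Integration.integral_sum)
  finally show "(\<integral>x. (esum f R x)\<^sup>2 \<partial>X) \<le> 3 * wsum R * (\<integral>x. (f x)\<^sup>2 \<partial>X)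
       + 2 * R powr (3 / 2 * (CARD('d) / 2 - \<gamma>)) * (\<integral>x. \<bar>f x\<bar> * osum (\<lambda>x. \<bar>f x\<bar>) (2 * real R) x \<partial>X)"
    by (simp add: \<beta>_def)
qed

end

section \<open>The maximal inequality along a sparse set\<close>

lemma filterlim_power2_nat: "filterlim (\<lambda>j::nat. 2 ^ j :: nat) sequentially sequentially"
  by (rule filterlim_subseq) (simp add: strict_mono_def power_strict_increasing)

context sparse_action
begin

lemma esum_abs_le:
  assumes "\<forall>x\<in>space X. \<bar>f x\<bar> \<le> K" "x \<in> space X"
  shows "\<bar>esum f R x\<bar> \<le> (\<Sum>n\<in>lball R. \<bar>\<eta> n\<bar> * K)"
  unfolding esum_def
  by (intro order_trans[OF sum_abs] sum_mono) (use assms in \<open>auto simp: abs_mult intro!: mult_left_mono\<close>)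

text \<open>At scale \<open>2 ^ j\<close> replace \<open>f\<close> by \<open>F j\<close>, its
  restriction to \<open>G j\<close>. For \<open>x\<close> outside \<open>H\<close> and
  \<open>E2 j\<close> every orbit point counted by \<open>ssum\<close> lies in \<open>G j\<close>,
  so nothing is lost. The weighted part of the sum is at most that of \<open>f\<close>, which is
  controlled since \<open>x \<notin> H\<close>; the error part is at most the mass since
  \<open>x \<notin> E4 j\<close>. Because ball sums are bounded at points of \<open>G j\<close>, the
  off-diagonal term of \<open>esum_L2_bound\<close> becomes a multiple of the integral of
  \<open>f\<close>, and after division by the squared mass it decays geometrically in
  \<open>j\<close>.\<close>

lemma sparse_maximal_dyadic:
  obtains C j0 where "0 < C" "\<And>f. integrable X f \<Longrightarrow> (\<forall>x\<in>space X. 0 \<le> f x) \<Longrightarrow>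
    measure X {x \<in> space X. \<exists>j\<ge>j0. C * wsum (2 ^ j) < ssum f (2 ^ j) x} \<le> C * (\<integral>x. f x \<partial>X)"
proof -
  \<comment> \<open>\<open>q ^ j\<close> is the order of the mass at radius \<open>2 ^ j\<close> and
    serves as truncation height; \<open>\<tau> ^ j\<close> is the decay left to the off-diagonal
    term.\<close>
  define a \<theta> q \<tau> where "a = CARD('d) - \<gamma>" and "\<theta> = CARD('d) / 2 - \<gamma>"
    and "q = (2::real) powr a" and "\<tau> = (2::real) powr (- \<theta> / 2)"
  have a: "a > 0" and \<theta>: "\<theta> > 0" using \<gamma>_less \<gamma>_half by (auto simp: a_def \<theta>_def)
  have q: "1 < q" using a by (simp add: q_def)
  have \<tau>: "0 < \<tau>" "\<tau> < 1" using \<theta> by (auto simp: \<tau>_def powr_less_one)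
  obtain cw where cw: "cw > 0" "\<And>R. 2 \<le> R \<Longrightarrow> cw * R powr a \<le> wsum R"
    using wsum_lower unfolding a_def by blast
  obtain Cw where Cw: "Cw > 0" "\<And>R. 1 \<le> R \<Longrightarrow> wsum R \<le> Cw * R powr a"
    using wsum_upper unfolding a_def by blast
  obtain Cb where Cb: "0 < Cb" "\<And>r. 1 \<le> r \<Longrightarrow> bcount TYPE('d) r \<le> Cb * r ^ CARD('d)"
    using bcount_bounds[where 'd='d] by metis
  obtain D where D: "1 \<le> D" "\<And>r. 1 \<le> r \<Longrightarrow> bcount TYPE('d) (5 * r) \<le> D * bcount TYPE('d) r"
    using bcount_doubling[where 'd='d] by metis
  have qj: "(2 ^ j) powr a = q ^ j" for j :: nat
    by (simp add: q_def powr_realpow[symmetric] powr_powr mult.commute)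
  have \<tau>j: "(2 ^ j) powr (- \<theta> / 2) = \<tau> ^ j" for j :: nat
    by (simp add: \<tau>_def powr_realpow[symmetric] powr_powr mult.commute)
  have e1: "\<forall>\<^sub>F j::nat in sequentially. wsum (2 ^ j) / 2 \<le> real (cnt (2 ^ j)) \<and> real (cnt (2 ^ j)) \<le> 2 * wsum (2 ^ j) \<and> 0 < wsum (2 ^ j)"
    using eventually_compose_filterlim[OF cnt_bounds filterlim_power2_nat] by simp
  have e2: "\<forall>\<^sub>F j::nat in sequentially. \<forall>f K. f \<in> borel_measurable X \<longrightarrow> (\<forall>x\<in>space X. \<bar>f x\<bar> \<le> K) \<longrightarrow>
     (\<integral>x. (esum f (2 ^ j) x)\<^sup>2 \<partial>X) \<le> 3 * wsum (2 ^ j) * (\<integral>x. (f x)\<^sup>2 \<partial>X)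
       + 2 * (2 ^ j) powr (3 / 2 * \<theta>) * (\<integral>x. \<bar>f x\<bar> * osum (\<lambda>x. \<bar>f x\<bar>) (2 * 2 ^ j) x \<partial>X)"
    using eventually_compose_filterlim[OF esum_L2_bound filterlim_power2_nat] by (simp add: \<theta>_def)
  have e3: "\<forall>\<^sub>F j::nat in sequentially. 1 \<le> j" by (rule eventually_ge_at_top)
  obtain j0 :: nat where j0: "\<forall>j\<ge>j0.
     (wsum (2 ^ j) / 2 \<le> real (cnt (2 ^ j)) \<and> real (cnt (2 ^ j)) \<le> 2 * wsum (2 ^ j) \<and> 0 < wsum (2 ^ j)) \<and>
     (\<forall>f K. f \<in> borel_measurable X \<longrightarrow> (\<forall>x\<in>space X. \<bar>f x\<bar> \<le> K) \<longrightarrow>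
     (\<integral>x. (esum f (2 ^ j) x)\<^sup>2 \<partial>X) \<le> 3 * wsum (2 ^ j) * (\<integral>x. (f x)\<^sup>2 \<partial>X)
       + 2 * (2 ^ j) powr (3 / 2 * \<theta>) * (\<integral>x. \<bar>f x\<bar> * osum (\<lambda>x. \<bar>f x\<bar>) (2 * 2 ^ j) x \<partial>X)) \<and> 1 \<le> j"
    using eventually_conj[OF e1 eventually_conj[OF e2 e3]]
    unfolding eventually_sequentially by (elim exE)
  have cnt: "real (cnt (2 ^ j)) \<le> 2 * wsum (2 ^ j)" "0 < wsum (2 ^ j)" "1 \<le> j" if "j0 \<le> j" for j
    using j0 that by auto
  have L2: "(\<integral>x. (esum f (2 ^ j) x)\<^sup>2 \<partial>X) \<le> 3 * wsum (2 ^ j) * (\<integral>x. (f x)\<^sup>2 \<partial>X)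
       + 2 * (2 ^ j) powr (3 / 2 * \<theta>) * (\<integral>x. \<bar>f x\<bar> * osum (\<lambda>x. \<bar>f x\<bar>) (2 * 2 ^ j) x \<partial>X)"
    if "j0 \<le> j" "f \<in> borel_measurable X" "\<forall>x\<in>space X. \<bar>f x\<bar> \<le> K" for j f K
    using j0 that by blast
  have two: "2 \<le> (2::real) ^ j" if "j0 \<le> j" for j
    using cnt(3)[OF that] power_increasing[of 1 j "2::real"] by simp
  have wl: "cw * q ^ j \<le> wsum (2 ^ j)" if "j0 \<le> j" for j using cw(2)[OF two[OF that]] by (simp add: qj)
  have wu: "wsum (2 ^ j) \<le> Cw * q ^ j" for j using Cw(2)[of "2 ^ j"] by (simp add: qj one_le_power)
  define B where "B = 2 * D * Cb * 2 ^ CARD('d) / cw\<^sup>2"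
  have B: "0 \<le> B" using D Cb by (simp add: B_def)
  \<comment> \<open>\<open>C1\<close> collects the measures of \<open>H\<close>, of all
    \<open>E2 j\<close>, and of the diagonal and off-diagonal parts of all \<open>E4 j\<close>.
    \<open>C2\<close> is the level not exceeded elsewhere: twice the mass plus 2, where the 2 is at
    most \<open>2 / cw\<close> times the mass.\<close>
  define C1 where "C1 = D * D + (2 * Cw * (q / (q - 1)) + (3 / cw * (q / (q - 1)) + B / (1 - \<tau>)))"
  define C2 where "C2 = 2 + 2 / cw"
  define C where "C = max C1 C2"
  have "0 < C2" using cw(1) unfolding C2_def by (intro add_pos_pos divide_pos_pos) auto
  then have C: "0 < C" by (simp add: C_def less_max_iff_disj)
  show ?thesis
  proof (rule that[OF C])
    fix f :: "'x \<Rightarrow> real" assume fi: "integrable X f" and f0: "\<forall>x\<in>space X. 0 \<le> f x"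
    have f [measurable]: "f \<in> borel_measurable X" using fi by auto
    define If where "If = (\<integral>x. f x \<partial>X)"
    have If0: "0 \<le> If" unfolding If_def using f0 by (intro integral_nonneg_AE) auto
    define H where "H = {x \<in> space X. \<exists>r::nat. 1 \<le> r \<and> 1 * bcount TYPE('d) r < osum f r x}"
    \<comment> \<open>The slack \<open>D\<close> is the cost of doubling when the bound at
      \<open>x\<close> over radius \<open>3 * 2 ^ j\<close> is moved to an orbit point with radius
      \<open>2 * 2 ^ j\<close>.\<close>
    define G where "G j = {x \<in> space X. osum f (2 * 2 ^ j) x \<le> D * bcount TYPE('d) (2 * 2 ^ j) \<and> f x \<le> q ^ j}" for j :: nat
    define F where "F j x = (if x \<in> G j then f x else 0)" for j x
    \<comment> \<open>The union over \<open>S \<inter> lball (2 ^ j)\<close> costs a factor of order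
      \<open>q ^ j\<close>, the same power as the truncation height;
      \<open>sum_geometric_below\<close> needs this balance.\<close>
    define E2 where "E2 j = (\<Union>n\<in>S \<inter> lball (2 ^ j). {x \<in> space X. T n x \<in> {x \<in> space X. q ^ j < f x}})" for j :: nat
    define E4 where "E4 j = {x \<in> space X. wsum (2 ^ j) < esum (F j) (2 ^ j) x}" for j :: nat
    have H [measurable]: "H \<in> sets X" unfolding H_def by measurable
    have G [measurable]: "G j \<in> sets X" for j unfolding G_def by measurable
    have F [measurable]: "F j \<in> borel_measurable X" for j unfolding F_def[abs_def] by measurable
    have E2 [measurable]: "E2 j \<in> sets X" for j unfolding E2_def by (intro sets.finite_UN) auto
    have E4 [measurable]: "E4 j \<in> sets X" for j unfolding E4_def by measurable
    have F0: "0 \<le> F j x" and Ff: "F j x \<le> f x" and Fq: "F j x \<le> q ^ j" if "x \<in> space X" for j x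
      using f0 that q by (auto simp: F_def G_def)
    have Fb: "\<forall>x\<in>space X. \<bar>F j x\<bar> \<le> q ^ j" for j using F0 Fq by auto
    have mH: "measure X H \<le> D * D * If"
      using maximal_inequality[of f D 1] f0 fi D by (simp add: H_def If_def)
    have mE2: "measure X (E2 j) \<le> 2 * Cw * (q ^ j * measure X {x \<in> space X. q ^ j < f x})" if j: "j0 \<le> j" for j
    proof -
      have "measure X (E2 j) \<le> (\<Sum>n\<in>S \<inter> lball (2 ^ j). measure X {x \<in> space X. T n x \<in> {x \<in> space X. q ^ j < f x}})"
        unfolding E2_def by (rule measure_UNION_le) auto
      also have "\<dots> = real (cnt (2 ^ j)) * measure X {x \<in> space X. q ^ j < f x}"
        by (subst measure_T) (auto simp: cnt_def)
      also have "\<dots> \<le> (2 * (Cw * q ^ j)) * measure X {x \<in> space X. q ^ j < f x}"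
        using cnt(1)[OF j] wu[of j] by (intro mult_right_mono) auto
      finally show ?thesis by simp
    qed
    have mE4: "measure X (E4 j) \<le> 3 / cw * ((\<integral>x. (F j x)\<^sup>2 \<partial>X) / q ^ j) + B * If * \<tau> ^ j" if j: "j0 \<le> j" for j
    proof -
      let ?w = "wsum (2 ^ j)" and ?R = "(2::real) ^ j"
      have w: "0 < ?w" by (rule cnt(2)[OF j])
      have q0: "0 < q ^ j" using q by simp
      have ie: "integrable X (\<lambda>x. (esum (F j) ?R x)\<^sup>2)"
        by (rule bounded_integrable_square[where K="\<Sum>n\<in>lball ?R. \<bar>\<eta> n\<bar> * q ^ j"]) (use esum_abs_le[OF Fb] in auto)
      have "measure X (E4 j) \<le> measure X {x \<in> space X. (esum (F j) ?R x)\<^sup>2 \<ge> ?w\<^sup>2}"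
        unfolding E4_def using w by (intro finite_measure_mono) (auto intro!: power_mono)
      also have "\<dots> \<le> (\<integral>x. (esum (F j) ?R x)\<^sup>2 \<partial>X) / ?w\<^sup>2"
        using ie w by (intro integral_Markov_inequality_measure[where A="{}"]) auto
      also have "\<dots> \<le> (3 * ?w * (\<integral>x. (F j x)\<^sup>2 \<partial>X) + 2 * ?R powr (3 / 2 * \<theta>) * (D * (Cb * (2 * ?R) ^ CARD('d)) * If)) / ?w\<^sup>2"
      proof (rule divide_right_mono)
        have "(\<integral>x. \<bar>F j x\<bar> * osum (\<lambda>x. \<bar>F j x\<bar>) (2 * ?R) x \<partial>X) \<le> (\<integral>x. (D * (Cb * (2 * ?R) ^ CARD('d))) * f x \<partial>X)"
        proof (rule integral_mono_AE')
          show "integrable X (\<lambda>x. (D * (Cb * (2 * ?R) ^ CARD('d))) * f x)" using fi by simp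
          show "AE x in X. \<bar>F j x\<bar> * osum (\<lambda>x. \<bar>F j x\<bar>) (2 * ?R) x \<le> (D * (Cb * (2 * ?R) ^ CARD('d))) * f x"
          proof (rule AE_I2)
            fix x assume x: "x \<in> space X"
            show "\<bar>F j x\<bar> * osum (\<lambda>x. \<bar>F j x\<bar>) (2 * ?R) x \<le> (D * (Cb * (2 * ?R) ^ CARD('d))) * f x"
            proof (cases "x \<in> G j")
              case True
              have "osum (\<lambda>x. \<bar>F j x\<bar>) (2 * ?R) x \<le> osum f (2 * ?R) x"
                unfolding osum_def using F0 Ff x by (intro sum_mono) auto
              also have "\<dots> \<le> D * bcount TYPE('d) (2 * ?R)" using True by (simp add: G_def)
              also have "\<dots> \<le> D * (Cb * (2 * ?R) ^ CARD('d))"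
                using D two[OF j] by (intro mult_left_mono Cb) auto
              finally have "f x * osum (\<lambda>x. \<bar>F j x\<bar>) (2 * ?R) x \<le> f x * (D * (Cb * (2 * ?R) ^ CARD('d)))"
                using f0 x by (intro mult_left_mono) auto
              then show ?thesis using True f0 x by (simp add: F_def mult.commute)
            next
              case False
              then show ?thesis using f0 x D Cb by (simp add: F_def)
            qed
          qed
          show "AE x in X. 0 \<le> (D * (Cb * (2 * ?R) ^ CARD('d))) * f x"
            by (rule AE_I2) (use f0 D Cb in \<open>auto intro!: mult_nonneg_nonneg\<close>)
        qed
        then have "(\<integral>x. \<bar>F j x\<bar> * osum (\<lambda>x. \<bar>F j x\<bar>) (2 * ?R) x \<partial>X) \<le> D * (Cb * (2 * ?R) ^ CARD('d)) * If"
          by (simp add: If_def)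
        then have "2 * ?R powr (3 / 2 * \<theta>) * (\<integral>x. \<bar>F j x\<bar> * osum (\<lambda>x. \<bar>F j x\<bar>) (2 * ?R) x \<partial>X)
          \<le> 2 * ?R powr (3 / 2 * \<theta>) * (D * (Cb * (2 * ?R) ^ CARD('d)) * If)"
          by (rule mult_left_mono) simp
        then show "(\<integral>x. (esum (F j) ?R x)\<^sup>2 \<partial>X)
          \<le> 3 * ?w * (\<integral>x. (F j x)\<^sup>2 \<partial>X) + 2 * ?R powr (3 / 2 * \<theta>) * (D * (Cb * (2 * ?R) ^ CARD('d)) * If)"
          using L2[OF j F[of j] Fb[of j]] by linarith
      qed simp
      also have "\<dots> = 3 * (\<integral>x. (F j x)\<^sup>2 \<partial>X) / ?w + 2 * ?R powr (3 / 2 * \<theta>) * (D * (Cb * (2 * ?R) ^ CARD('d)) * If) / ?w\<^sup>2"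
        using w by (simp add: add_divide_distrib power2_eq_square)
      also have "\<dots> \<le> 3 * (\<integral>x. (F j x)\<^sup>2 \<partial>X) / (cw * q ^ j) + 2 * ?R powr (3 / 2 * \<theta>) * (D * (Cb * (2 * ?R) ^ CARD('d)) * If) / (cw * q ^ j)\<^sup>2"
      proof -
        have v: "v \<le> ?w \<Longrightarrow> 0 < v \<Longrightarrow> 3 * (\<integral>x. (F j x)\<^sup>2 \<partial>X) / ?w + 2 * ?R powr (3 / 2 * \<theta>) * (D * (Cb * (2 * ?R) ^ CARD('d)) * If) / ?w\<^sup>2
          \<le> 3 * (\<integral>x. (F j x)\<^sup>2 \<partial>X) / v + 2 * ?R powr (3 / 2 * \<theta>) * (D * (Cb * (2 * ?R) ^ CARD('d)) * If) / v\<^sup>2" for v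
          using w If0 D(1) Cb(1) by (intro add_mono divide_left_mono power_mono mult_pos_pos zero_less_power) auto
        show ?thesis by (rule v[OF wl[OF j] mult_pos_pos[OF cw(1) q0]])
      qed
      also have "2 * ?R powr (3 / 2 * \<theta>) * (D * (Cb * (2 * ?R) ^ CARD('d)) * If) / (cw * q ^ j)\<^sup>2 = B * If * \<tau> ^ j"
      proof -
        have "?R powr (3 / 2 * \<theta>) * ?R ^ CARD('d) / (q ^ j)\<^sup>2 = ?R powr (3 / 2 * \<theta> + CARD('d) - (a + a))"
          unfolding qj[symmetric] power2_eq_square powr_add powr_diff by (simp add: powr_realpow)
        \<comment> \<open>The identity behind it is
          \<open>2 * a = CARD('d) + 2 * \<theta>\<close>.\<close>
        also have "3 / 2 * \<theta> + CARD('d) - (a + a) = - \<theta> / 2" by (simp add: \<theta>_def a_def field_simps)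
        finally have e: "?R powr (3 / 2 * \<theta>) * ?R ^ CARD('d) / (q ^ j)\<^sup>2 = \<tau> ^ j" by (simp only: \<tau>j)
        have "2 * ?R powr (3 / 2 * \<theta>) * (D * (Cb * (2 * ?R) ^ CARD('d)) * If) / (cw * q ^ j)\<^sup>2
          = B * If * (?R powr (3 / 2 * \<theta>) * ?R ^ CARD('d) / (q ^ j)\<^sup>2)"
          by (simp add: B_def power_mult_distrib)
        then show ?thesis by (simp only: e)
      qed
      finally show ?thesis by simp
    qed
    define E where "E j = (if j0 \<le> j then E2 j \<union> E4 j else {})" for j
    have mE: "measure X (E j) \<le> 2 * Cw * (q ^ j * measure X {x \<in> space X. q ^ j < f x})
        + (3 / cw * ((\<integral>x. (F j x)\<^sup>2 \<partial>X) / q ^ j) + B * If * \<tau> ^ j)" for j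
    proof (cases "j0 \<le> j")
      case True
      have "measure X (E j) \<le> measure X (E2 j) + measure X (E4 j)"
        using True by (simp add: E_def measure_Un_le)
      then show ?thesis using mE2[OF True] mE4[OF True] by linarith
    next
      case False
      then show ?thesis using Cw cw B If0 q \<tau> by (auto simp: E_def intro!: add_nonneg_nonneg mult_nonneg_nonneg)
    qed
    have sum1: "(\<Sum>j<J. q ^ j * measure X {x \<in> space X. q ^ j < f x}) \<le> q / (q - 1) * If" for J
    proof -
      have ii: "integrable X (\<lambda>x. q ^ j * indicator {x \<in> space X. q ^ j < f x} x)" for j
        by (intro integrable_mult_right integrable_real_indicator) (auto simp: emeasure_eq_measure)
      have "(\<Sum>j<J. q ^ j * measure X {x \<in> space X. q ^ j < f x}) = (\<integral>x. (\<Sum>j<J. q ^ j * indicator {x \<in> space X. q ^ j < f x} x) \<partial>X)"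
        using ii by (subst Bochner_Integration.integral_sum) auto
      also have "\<dots> \<le> (\<integral>x. q / (q - 1) * f x \<partial>X)"
      proof (rule integral_mono)
        fix x assume x: "x \<in> space X"
        have "(\<Sum>j<J. q ^ j * indicator {x \<in> space X. q ^ j < f x} x) = (\<Sum>j<J. if q ^ j < f x then q ^ j else 0)"
          using x by (intro sum.cong) auto
        also have "\<dots> \<le> q / (q - 1) * f x" using f0 x q by (intro sum_geometric_below) auto
        finally show "(\<Sum>j<J. q ^ j * indicator {x \<in> space X. q ^ j < f x} x) \<le> q / (q - 1) * f x" .
      next
        show "integrable X (\<lambda>x. q / (q - 1) * f x)" using fi by simp
      qed (intro Bochner_Integration.integrable_sum ii)
      finally show ?thesis by (simp add: If_def)
    qed
    have sum2: "(\<Sum>j<J. (\<integral>x. (F j x)\<^sup>2 \<partial>X) / q ^ j) \<le> q / (q - 1) * If" for J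
    proof -
      have ii: "integrable X (\<lambda>x. (F j x)\<^sup>2 / q ^ j)" for j
        using bounded_integrable_square[OF F Fb] by simp
      have "(\<Sum>j<J. (\<integral>x. (F j x)\<^sup>2 \<partial>X) / q ^ j) = (\<integral>x. (\<Sum>j<J. (F j x)\<^sup>2 / q ^ j) \<partial>X)"
        using ii by (subst Bochner_Integration.integral_sum) auto
      also have "\<dots> \<le> (\<integral>x. q / (q - 1) * f x \<partial>X)"
      proof (rule integral_mono)
        fix x assume x: "x \<in> space X"
        have "(\<Sum>j<J. (F j x)\<^sup>2 / q ^ j) \<le> (\<Sum>j<J. if f x \<le> q ^ j then (f x)\<^sup>2 / q ^ j else 0)"
          using q by (intro sum_mono) (auto simp: F_def G_def)
        also have "\<dots> \<le> q / (q - 1) * f x" using f0 x q by (intro sum_geometric_above) auto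
        finally show "(\<Sum>j<J. (F j x)\<^sup>2 / q ^ j) \<le> q / (q - 1) * f x" .
      next
        show "integrable X (\<lambda>x. q / (q - 1) * f x)" using fi by simp
      qed (intro Bochner_Integration.integrable_sum ii)
      finally show ?thesis by (simp add: If_def)
    qed
    have sum3: "(\<Sum>j<J. B * If * \<tau> ^ j) \<le> B / (1 - \<tau>) * If" for J
    proof -
      have "(\<Sum>j<J. \<tau> ^ j) = (1 - \<tau> ^ J) / (1 - \<tau>)" using \<tau> by (subst geometric_sum) (auto simp: field_simps)
      also have "\<dots> \<le> 1 / (1 - \<tau>)" using \<tau> by (intro divide_right_mono) auto
      finally have "B * If * (\<Sum>j<J. \<tau> ^ j) \<le> B * If * (1 / (1 - \<tau>))" using B If0 by (intro mult_left_mono) auto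
      then show ?thesis by (simp add: sum_distrib_left)
    qed
    have "measure X (\<Union>j. E j) \<le> 2 * Cw * (q / (q - 1) * If) + (3 / cw * (q / (q - 1) * If) + B / (1 - \<tau>) * If)"
    proof (rule measure_UN_le_of_partial_sums)
      show "E i \<in> sets X" for i by (simp add: E_def)
      fix J
      have "(\<Sum>j<J. measure X (E j)) \<le> (\<Sum>j<J. 2 * Cw * (q ^ j * measure X {x \<in> space X. q ^ j < f x})
        + (3 / cw * ((\<integral>x. (F j x)\<^sup>2 \<partial>X) / q ^ j) + B * If * \<tau> ^ j))"
        by (intro sum_mono mE)
      also have "\<dots> = 2 * Cw * (\<Sum>j<J. q ^ j * measure X {x \<in> space X. q ^ j < f x})
        + (3 / cw * (\<Sum>j<J. (\<integral>x. (F j x)\<^sup>2 \<partial>X) / q ^ j) + (\<Sum>j<J. B * If * \<tau> ^ j))"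
        by (simp only: sum.distrib sum_distrib_left)
      also have "\<dots> \<le> 2 * Cw * (q / (q - 1) * If) + (3 / cw * (q / (q - 1) * If) + B / (1 - \<tau>) * If)"
        using Cw cw by (intro add_mono mult_left_mono sum1 sum2 sum3) auto
      finally show "(\<Sum>j<J. measure X (E j)) \<le> 2 * Cw * (q / (q - 1) * If) + (3 / cw * (q / (q - 1) * If) + B / (1 - \<tau>) * If)" .
    qed
    then have mU: "measure X (H \<union> (\<Union>j. E j)) \<le> C1 * If"
      using measure_Un_le[of H X "\<Union>j. E j"] mH by (simp add: E_def C1_def algebra_simps)
    have "{x \<in> space X. \<exists>j\<ge>j0. C * wsum (2 ^ j) < ssum f (2 ^ j) x} \<subseteq> H \<union> (\<Union>j. E j)"
    proof (rule subsetI, rule ccontr)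
      fix x assume xA: "x \<in> {x \<in> space X. \<exists>j\<ge>j0. C * wsum (2 ^ j) < ssum f (2 ^ j) x}"
        and nx: "x \<notin> H \<union> (\<Union>j. E j)"
      then obtain j where x: "x \<in> space X" and j: "j0 \<le> j" and big: "C * wsum (2 ^ j) < ssum f (2 ^ j) x" by blast
      have nH: "osum f r x \<le> bcount TYPE('d) r" if "(1::nat) \<le> r" for r :: nat
        using nx x that by (auto simp: H_def not_less)
      have "x \<notin> E j" using nx by blast
      then have n2: "x \<notin> E2 j" and n4: "x \<notin> E4 j" using j by (auto simp: E_def)
      let ?R = "(2::real) ^ j"
      have R2: "2 \<le> ?R" using two[OF j] .
      have inG: "T n x \<in> G j" if n: "n \<in> S \<inter> lball ?R" for n
      proof -
        have "f (T n x) \<le> q ^ j" using n2 n x by (auto simp: E2_def not_less)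
        moreover have "osum f (2 * ?R) (T n x) \<le> D * bcount TYPE('d) (2 * ?R)"
        proof -
          have "osum f (2 * ?R) (T n x) = (\<Sum>k | lattice_norm (k - n) < 2 * ?R. f (T k x))" by (rule osum_shift[OF x])
          also have "\<dots> \<le> osum f (real (3 * 2 ^ j)) x"
            unfolding osum_def
          proof (rule sum_mono2)
            show "{k. lattice_norm (k - n) < 2 * ?R} \<subseteq> lball (real (3 * 2 ^ j))"
            proof
              fix k assume "k \<in> {k. lattice_norm (k - n) < 2 * ?R}"
              then show "k \<in> lball (real (3 * 2 ^ j))" using n lattice_norm_triangle[of "k - n" n] by simp
            qed
          qed (use f0 x in auto)
          also have "\<dots> \<le> bcount TYPE('d) (real (3 * 2 ^ j))" by (rule nH) (simp add: Suc_leI)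
          also have "\<dots> \<le> bcount TYPE('d) (5 * (2 * ?R))" by (intro bcount_mono) simp
          also have "\<dots> \<le> D * bcount TYPE('d) (2 * ?R)" using R2 by (intro D) simp
          finally show ?thesis .
        qed
        ultimately show ?thesis using x by (simp add: G_def)
      qed
      have "ssum f ?R x = ssum (F j) ?R x"
        unfolding ssum_def using inG by (intro sum.cong refl) (simp add: F_def)
      also have "\<dots> = (\<Sum>n\<in>lball ?R. p n * F j (T n x)) + esum (F j) ?R x" by (rule ssum_eq)
      also have "esum (F j) ?R x \<le> wsum ?R" using n4 x by (simp add: E4_def not_less)
      also have "(\<Sum>n\<in>lball ?R. p n * F j (T n x)) \<le> (\<Sum>n\<in>lball ?R. p n * f (T n x))"
        using p_nonneg Ff x by (intro sum_mono mult_left_mono) auto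
      also have "\<dots> \<le> \<bar>f (T 0 x)\<bar> + 0 + 1 * (wsum ?R + 1)"
      proof -
        have "\<bar>\<Sum>n\<in>lball (real (2 ^ j)). p n * f (T n x)\<bar> \<le> \<bar>f (T 0 x)\<bar> + 0 + 1 * (wsum (real (2 ^ j)) + 1)"
        proof (rule weighted_sum_bound)
          fix r :: nat assume r: "1 \<le> r"
          have "\<bar>osum f r x\<bar> = osum f r x" unfolding osum_def using f0 x by (intro abs_of_nonneg sum_nonneg) auto
          then show "\<bar>\<Sum>n\<in>lball (real r). f (T n x)\<bar> \<le> 0 + 1 * bcount TYPE('d) (real r)"
            using nH[OF r] by (simp add: osum_def)
        qed auto
        then show ?thesis by simp
      qed
      \<comment> \<open>Radius 1 in the definition of \<open>H\<close>: that ball is the origin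
        alone, which controls the correction for the arbitrary weight there.\<close>
      also have "\<bar>f (T 0 x)\<bar> \<le> 1"
        using nH[of 1] f0 x by (simp add: osum_def lball_1)
      also have "1 + 0 + 1 * (wsum ?R + 1) + wsum ?R \<le> C2 * wsum ?R"
      proof -
        have "cw * 1 \<le> cw * q ^ j" using cw q by (intro mult_left_mono) (auto simp: one_le_power)
        also have "\<dots> \<le> wsum ?R" by (rule wl[OF j])
        finally have "2 \<le> 2 / cw * wsum ?R" using cw by (simp add: field_simps)
        then show ?thesis by (simp add: C2_def distrib_right)
      qed
      also have "\<dots> \<le> C * wsum ?R" using wsum_nonneg by (intro mult_right_mono) (auto simp: C_def)
      finally show False using big by simp
    qed
    then have "measure X {x \<in> space X. \<exists>j\<ge>j0. C * wsum (2 ^ j) < ssum f (2 ^ j) x} \<le> measure X (H \<union> (\<Union>j. E j))"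
      by (rule finite_measure_mono) (auto simp: E_def)
    also have "\<dots> \<le> C1 * If" by (rule mU)
    also have "\<dots> \<le> C * If" using If0 by (intro mult_right_mono) (auto simp: C_def)
    finally show "measure X {x \<in> space X. \<exists>j\<ge>j0. C * wsum (2 ^ j) < ssum f (2 ^ j) x} \<le> C * (\<integral>x. f x \<partial>X)"
      by (simp add: If_def)
  qed
qed

end

section \<open>Convergence along a sparse set\<close>

lemma (in prob_space) AE_tendsto_zero_of_summable:
  fixes u :: "nat \<Rightarrow> 'a \<Rightarrow> real"
  assumes u: "\<And>i. integrable M (u i)" "\<And>i x. 0 \<le> u i x"
    and s: "summable (\<lambda>i. \<integral>x. u i x \<partial>M)"
  shows "AE x in M. (\<lambda>i. u i x) \<longlonglongrightarrow> 0"
proof -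
  have m [measurable]: "\<And>i. u i \<in> borel_measurable M" using u by auto
  have "(\<integral>\<^sup>+x. (\<Sum>i. ennreal (u i x)) \<partial>M) = (\<Sum>i. \<integral>\<^sup>+x. ennreal (u i x) \<partial>M)"
    by (rule nn_integral_suminf) simp
  also have "\<dots> = (\<Sum>i. ennreal (\<integral>x. u i x \<partial>M))"
    using u by (intro suminf_cong nn_integral_eq_integral) auto
  also have "\<dots> = ennreal (\<Sum>i. \<integral>x. u i x \<partial>M)"
    using u s by (intro suminf_ennreal2 integral_nonneg_AE) auto
  finally have "(\<integral>\<^sup>+x. (\<Sum>i. ennreal (u i x)) \<partial>M) \<noteq> \<infinity>" by simp
  then have "AE x in M. (\<Sum>i. ennreal (u i x)) \<noteq> \<infinity>" by (intro nn_integral_noteq_infinite) auto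
  then show ?thesis
  proof eventually_elim
    fix x assume "(\<Sum>i. ennreal (u i x)) \<noteq> \<infinity>"
    then have "summable (\<lambda>i. u i x)" using u by (intro summable_suminf_not_top) auto
    then show "(\<lambda>i. u i x) \<longlonglongrightarrow> 0" by (rule summable_LIMSEQ_zero)
  qed
qed

context sparse_set
begin

lemma enumeration_sum:
  assumes a: "norm_enumeration a S"
  shows "(\<Sum>k=1..cnt R. h (a k)) = (\<Sum>n\<in>S \<inter> lball R. h n)"
proof -
  have "inj_on a {1..}" using a by (auto simp: norm_enumeration_def bij_betw_def)
  then have "inj_on a {1..cnt R}" by (rule inj_on_subset) auto
  then have "(\<Sum>n\<in>a ` {1..cnt R}. h n) = (\<Sum>k=1..cnt R. h (a k))" by (rule sum.reindex_cong) auto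
  then show ?thesis using norm_enumeration_prefix[OF a, of R] by (simp add: cnt_def)
qed

end

context sparse_action
begin

text \<open>For \<open>N\<close> between \<open>cnt (2 ^ j)\<close> and
  \<open>cnt (2 ^ Suc j)\<close> the sum of a nonnegative function is enlarged to the next dyadic
  ball. This loses the factor \<open>\<Delta>\<close> by which the mass grows and a factor 2 between
  mass and count; a general level \<open>c\<close> is reached by scaling \<open>f\<close>.\<close>

lemma sparse_maximal:
  assumes a: "norm_enumeration a S"
  obtains C N0 where "0 < C" "\<And>f c. integrable X f \<Longrightarrow> (\<forall>x\<in>space X. 0 \<le> f x) \<Longrightarrow> 0 < c \<Longrightarrow>
    measure X {x \<in> space X. \<exists>N\<ge>N0. c * real N < (\<Sum>k=1..N. f (T (a k) x))} \<le> C * (\<integral>x. f x \<partial>X) / c"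
proof -
  obtain C j0 where C: "0 < C" and max: "\<And>f. integrable X f \<Longrightarrow> (\<forall>x\<in>space X. 0 \<le> f x) \<Longrightarrow>
    measure X {x \<in> space X. \<exists>j\<ge>j0. C * wsum (2 ^ j) < ssum f (2 ^ j) x} \<le> C * (\<integral>x. f x \<partial>X)"
    by (rule sparse_maximal_dyadic) blast
  define b where "b = CARD('d) - \<gamma>"
  have b: "b > 0" using \<gamma>_less by (simp add: b_def)
  obtain cw where cw: "cw > 0" "\<And>R. 2 \<le> R \<Longrightarrow> cw * R powr b \<le> wsum R"
    using wsum_lower unfolding b_def by blast
  obtain Cw where Cw: "Cw > 0" "\<And>R. 1 \<le> R \<Longrightarrow> wsum R \<le> Cw * R powr b"
    using wsum_upper unfolding b_def by blast
  define \<Delta> where "\<Delta> = Cw * 2 powr b / cw"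
  have \<Delta>: "\<Delta> > 0" using Cw cw by (simp add: \<Delta>_def)
  have dbl: "wsum (2 * R) \<le> \<Delta> * wsum R" if "2 \<le> R" for R
  proof -
    have "wsum (2 * R) \<le> Cw * (2 * R) powr b" using that by (intro Cw) auto
    also have "\<dots> = \<Delta> * (cw * R powr b)" using that cw by (simp add: \<Delta>_def powr_mult)
    also have "\<dots> \<le> \<Delta> * wsum R" using cw that \<Delta> by (intro mult_left_mono) auto
    finally show ?thesis .
  qed
  have cnt_lim: "filterlim (\<lambda>j::nat. cnt (2 ^ j)) at_top sequentially"
    using filterlim_compose[OF cnt_at_top filterlim_power2_nat] by simp
  have e1: "\<forall>\<^sub>F j::nat in sequentially. wsum (2 ^ j) / 2 \<le> real (cnt (2 ^ j)) \<and> real (cnt (2 ^ j)) \<le> 2 * wsum (2 ^ j) \<and> 0 < wsum (2 ^ j)"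
    using eventually_compose_filterlim[OF cnt_bounds filterlim_power2_nat] by simp
  obtain j1 where j1: "\<forall>j\<ge>j1. (wsum (2 ^ j) / 2 \<le> real (cnt (2 ^ j)) \<and> real (cnt (2 ^ j)) \<le> 2 * wsum (2 ^ j) \<and> 0 < wsum (2 ^ j)) \<and> max 1 j0 \<le> j"
    using eventually_conj[OF e1 eventually_ge_at_top[of "max 1 j0"]]
    unfolding eventually_sequentially by (elim exE)
  define C' where "C' = C * (2 * \<Delta> * C)"
  show ?thesis
  proof (rule that[of C' "cnt (2 ^ j1)"])
    show "0 < C'" using C \<Delta> by (simp add: C'_def)
    fix f :: "'x \<Rightarrow> real" and c :: real
    assume fi: "integrable X f" and f0: "\<forall>x\<in>space X. 0 \<le> f x" and c: "0 < c"
    have [measurable]: "f \<in> borel_measurable X" using fi by auto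
    \<comment> \<open>Division by \<open>\<sigma>\<close> turns the level
      \<open>c / (2 * \<Delta>)\<close> into the fixed level \<open>C\<close> of the dyadic
      inequality.\<close>
    define \<sigma> where "\<sigma> = c / (2 * \<Delta> * C)"
    have \<sigma>: "\<sigma> > 0" using c \<Delta> C by (simp add: \<sigma>_def)
    define g where "g x = f x / \<sigma>" for x
    have [measurable]: "g \<in> borel_measurable X" by (simp add: g_def[abs_def])
    have "{x \<in> space X. \<exists>N\<ge>cnt (2 ^ j1). c * real N < (\<Sum>k=1..N. f (T (a k) x))}
      \<subseteq> {x \<in> space X. \<exists>j\<ge>j0. C * wsum (2 ^ j) < ssum g (2 ^ j) x}"
    proof
      fix x assume "x \<in> {x \<in> space X. \<exists>N\<ge>cnt (2 ^ j1). c * real N < (\<Sum>k=1..N. f (T (a k) x))}"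
      then obtain N where x: "x \<in> space X" and N: "cnt (2 ^ j1) \<le> N" "c * real N < (\<Sum>k=1..N. f (T (a k) x))"
        by auto
      obtain j where j: "j1 \<le> j" "cnt (2 ^ j) \<le> N" "N < cnt (2 ^ Suc j)"
        using bracket_index[OF cnt_lim N(1)] by metis
      have j': "wsum (2 ^ j) / 2 \<le> real (cnt (2 ^ j))" "1 \<le> j" "j0 \<le> j" using j1 j(1) by auto
      have two: "2 \<le> (2::real) ^ j" using j'(2) power_increasing[of 1 j "2::real"] by simp
      have "c * (wsum (2 ^ Suc j) / \<Delta> / 2) \<le> c * (wsum (2 ^ j) / 2)"
        using dbl[OF two] \<Delta> c by (intro mult_left_mono divide_right_mono) (simp_all add: pos_divide_le_eq mult.commute)
      also have "\<dots> \<le> c * real N" using c j'(1) j(2) by (intro mult_left_mono) auto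
      also have "\<dots> < (\<Sum>k=1..N. f (T (a k) x))" by (rule N(2))
      also have "\<dots> \<le> (\<Sum>k=1..cnt (2 ^ Suc j). f (T (a k) x))"
        using j(3) f0 x by (intro sum_mono2) auto
      also have "\<dots> = ssum f (2 ^ Suc j) x" unfolding ssum_def by (rule enumeration_sum[OF a])
      finally have "c * (wsum (2 ^ Suc j) / \<Delta> / 2) / \<sigma> < ssum f (2 ^ Suc j) x / \<sigma>" using \<sigma> by (rule divide_strict_right_mono)
      moreover have "c * (wsum (2 ^ Suc j) / \<Delta> / 2) / \<sigma> = C * wsum (2 ^ Suc j)"
        using c \<Delta> C by (simp add: \<sigma>_def)
      moreover have "ssum f (2 ^ Suc j) x / \<sigma> = ssum g (2 ^ Suc j) x"
        by (simp add: ssum_def g_def sum_divide_distrib)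
      ultimately have "C * wsum (2 ^ Suc j) < ssum g (2 ^ Suc j) x" by simp
      then show "x \<in> {x \<in> space X. \<exists>j\<ge>j0. C * wsum (2 ^ j) < ssum g (2 ^ j) x}"
        using x j'(3) by (intro CollectI conjI exI[of _ "Suc j"]) auto
    qed
    then have "measure X {x \<in> space X. \<exists>N\<ge>cnt (2 ^ j1). c * real N < (\<Sum>k=1..N. f (T (a k) x))}
      \<le> measure X {x \<in> space X. \<exists>j\<ge>j0. C * wsum (2 ^ j) < ssum g (2 ^ j) x}"
      by (rule finite_measure_mono) measurable
    also have "\<dots> \<le> C * (\<integral>x. g x \<partial>X)"
      by (rule max) (use fi f0 \<sigma> in \<open>auto simp: g_def[abs_def]\<close>)
    also have "\<dots> = C' * (\<integral>x. f x \<partial>X) / c"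
      using c \<Delta> C by (simp add: g_def C'_def \<sigma>_def)
    finally show "measure X {x \<in> space X. \<exists>N\<ge>cnt (2 ^ j1). c * real N < (\<Sum>k=1..N. f (T (a k) x))} \<le> C' * (\<integral>x. f x \<partial>X) / c" .
  qed
qed

lemma esum_tendsto_zero:
  assumes f [measurable]: "f \<in> borel_measurable X" and fK: "\<forall>x\<in>space X. \<bar>f x\<bar> \<le> K"
  obtains L :: nat where "1 \<le> L" "AE x in X. (\<lambda>i::nat. esum f (real (i ^ L)) x / wsum (real (i ^ L))) \<longlonglongrightarrow> 0"
proof -
  define b \<theta> where "b = CARD('d) - \<gamma>" and "\<theta> = CARD('d) / 2 - \<gamma>"
  have b: "b > 0" and \<theta>: "\<theta> > 0" using \<gamma>_less \<gamma>_half by (auto simp: b_def \<theta>_def)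
  have K0: "0 \<le> K" using fK not_empty by fastforce
  obtain cw where cw: "cw > 0" "\<And>R. 2 \<le> R \<Longrightarrow> cw * R powr b \<le> wsum R"
    using wsum_lower unfolding b_def by blast
  obtain Cb where Cb: "0 < Cb" "\<And>r. 1 \<le> r \<Longrightarrow> bcount TYPE('d) r \<le> Cb * r ^ CARD('d)"
    using bcount_bounds[where 'd='d] by metis
  \<comment> \<open>Once \<open>L * \<theta> \<ge> 4\<close>, the bound
    \<open>R powr (- \<theta> / 2)\<close> at \<open>R = i ^ L\<close> is at most
    \<open>i powr (- 2)\<close> and hence summable.\<close>
  define L where "L = nat \<lceil>4 / \<theta>\<rceil> + 1"
  have L: "1 \<le> L" "4 \<le> real L * \<theta>"
  proof -
    have "4 / \<theta> \<le> real L" unfolding L_def by linarith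
    then show "4 \<le> real L * \<theta>" using \<theta> by (simp add: pos_divide_le_eq)
  qed (simp add: L_def)
  define B where "B = K\<^sup>2 * (3 / cw + 2 * Cb * 2 ^ CARD('d) / cw\<^sup>2)"
  have B: "0 \<le> B" using cw Cb by (simp add: B_def)
  define u where "u i x = (esum f (real (i ^ L)) x / wsum (real (i ^ L)))\<^sup>2" for i x
  have ui: "integrable X (u i)" for i
  proof -
    have "integrable X (\<lambda>x. (esum f (real (i ^ L)) x)\<^sup>2)"
      by (rule bounded_integrable_square[where K="\<Sum>n\<in>lball (real (i ^ L)). \<bar>\<eta> n\<bar> * K"]) (use esum_abs_le[OF fK] in auto)
    then show ?thesis by (simp add: u_def[abs_def] power_divide)
  qed
  have "\<forall>\<^sub>F R::nat in sequentially. (\<integral>x. (esum f R x / wsum R)\<^sup>2 \<partial>X) \<le> B * R powr (- \<theta> / 2)"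
    using esum_L2_bound eventually_ge_at_top[of 2]
  proof eventually_elim
    case (elim R)
    have R: "2 \<le> real R" using elim(2) by simp
    have w: "cw * R powr b \<le> wsum R" "0 < wsum R" using cw(2)[OF R] wsum_pos[OF R] by auto
    have c0: "0 < cw * R powr b" using cw R by simp
    have "(\<integral>x. (f x)\<^sup>2 \<partial>X) \<le> (\<integral>x. K\<^sup>2 \<partial>X)"
    proof (rule integral_mono)
      show "integrable X (\<lambda>x. (f x)\<^sup>2)" by (rule bounded_integrable_square[OF f fK])
      show "(f x)\<^sup>2 \<le> K\<^sup>2" if "x \<in> space X" for x using fK that K0 by (simp add: abs_le_square_iff[symmetric])
    qed simp
    then have i1: "(\<integral>x. (f x)\<^sup>2 \<partial>X) \<le> K\<^sup>2" by (simp add: prob_space)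
    have "(\<integral>x. \<bar>f x\<bar> * osum (\<lambda>x. \<bar>f x\<bar>) (2 * real R) x \<partial>X) \<le> (\<integral>x. K * (bcount TYPE('d) (2 * real R) * K) \<partial>X)"
    proof (rule integral_mono_AE')
      show "AE x in X. \<bar>f x\<bar> * osum (\<lambda>x. \<bar>f x\<bar>) (2 * real R) x \<le> K * (bcount TYPE('d) (2 * real R) * K)"
      proof (rule AE_I2)
        fix x assume x: "x \<in> space X"
        have "osum (\<lambda>x. \<bar>f x\<bar>) (2 * real R) x \<le> (\<Sum>n\<in>(lball (2 * real R) :: (int ^ 'd) set). K)"
          unfolding osum_def using fK x by (intro sum_mono) auto
        then have "osum (\<lambda>x. \<bar>f x\<bar>) (2 * real R) x \<le> bcount TYPE('d) (2 * real R) * K" by (simp add: bcount_def)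
        then show "\<bar>f x\<bar> * osum (\<lambda>x. \<bar>f x\<bar>) (2 * real R) x \<le> K * (bcount TYPE('d) (2 * real R) * K)"
          using fK x K0 by (intro mult_mono) (auto simp: osum_def intro!: sum_nonneg)
      qed
    qed (use K0 in simp_all)
    also have "\<dots> = bcount TYPE('d) (2 * real R) * K\<^sup>2" by (simp add: prob_space power2_eq_square)
    also have "\<dots> \<le> (Cb * (2 * real R) ^ CARD('d)) * K\<^sup>2" using R by (intro mult_right_mono Cb) auto
    finally have i2: "(\<integral>x. \<bar>f x\<bar> * osum (\<lambda>x. \<bar>f x\<bar>) (2 * real R) x \<partial>X) \<le> (Cb * (2 * real R) ^ CARD('d)) * K\<^sup>2" .
    have "(\<integral>x. (esum f R x)\<^sup>2 \<partial>X) \<le> 3 * wsum R * (\<integral>x. (f x)\<^sup>2 \<partial>X)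
       + 2 * R powr (3 / 2 * \<theta>) * (\<integral>x. \<bar>f x\<bar> * osum (\<lambda>x. \<bar>f x\<bar>) (2 * real R) x \<partial>X)"
      using elim(1) fK f unfolding \<theta>_def by blast
    also have "\<dots> \<le> 3 * wsum R * K\<^sup>2 + 2 * R powr (3 / 2 * \<theta>) * ((Cb * (2 * real R) ^ CARD('d)) * K\<^sup>2)"
      using i1 i2 w by (intro add_mono mult_left_mono) auto
    finally have "(\<integral>x. (esum f R x)\<^sup>2 \<partial>X) / (wsum R)\<^sup>2
      \<le> (3 * wsum R * K\<^sup>2 + 2 * R powr (3 / 2 * \<theta>) * ((Cb * (2 * real R) ^ CARD('d)) * K\<^sup>2)) / (wsum R)\<^sup>2"
      by (rule divide_right_mono) simp
    also have "\<dots> = 3 * K\<^sup>2 / wsum R + 2 * R powr (3 / 2 * \<theta>) * ((Cb * (2 * real R) ^ CARD('d)) * K\<^sup>2) / (wsum R)\<^sup>2"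
      using w by (simp add: add_divide_distrib power2_eq_square)
    also have "\<dots> \<le> 3 * K\<^sup>2 / (cw * R powr b) + 2 * R powr (3 / 2 * \<theta>) * ((Cb * (2 * real R) ^ CARD('d)) * K\<^sup>2) / (cw * R powr b)\<^sup>2"
    proof -
      have "v \<le> wsum R \<Longrightarrow> 0 < v \<Longrightarrow> 3 * K\<^sup>2 / wsum R + 2 * R powr (3 / 2 * \<theta>) * ((Cb * (2 * real R) ^ CARD('d)) * K\<^sup>2) / (wsum R)\<^sup>2
        \<le> 3 * K\<^sup>2 / v + 2 * R powr (3 / 2 * \<theta>) * ((Cb * (2 * real R) ^ CARD('d)) * K\<^sup>2) / v\<^sup>2" for v
        using w(2) Cb(1) by (intro add_mono divide_left_mono power_mono mult_pos_pos zero_less_power) auto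
      from this[OF w(1) c0] show ?thesis .
    qed
    also have "3 * K\<^sup>2 / (cw * R powr b) = K\<^sup>2 * (3 / cw) * R powr (- b)"
      using R by (simp add: powr_minus field_simps)
    also have "2 * R powr (3 / 2 * \<theta>) * ((Cb * (2 * real R) ^ CARD('d)) * K\<^sup>2) / (cw * R powr b)\<^sup>2
      = K\<^sup>2 * (2 * Cb * 2 ^ CARD('d) / cw\<^sup>2) * R powr (- \<theta> / 2)"
    proof -
      have "R powr (3 / 2 * \<theta>) * R ^ CARD('d) / (R powr b)\<^sup>2 = R powr (3 / 2 * \<theta> + CARD('d) - (b + b))"
        using R unfolding power2_eq_square powr_add powr_diff by (simp add: powr_realpow)
      also have "3 / 2 * \<theta> + CARD('d) - (b + b) = - \<theta> / 2" by (simp add: \<theta>_def b_def field_simps)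
      finally have e: "R powr (3 / 2 * \<theta>) * R ^ CARD('d) / (R powr b)\<^sup>2 = R powr (- \<theta> / 2)" .
      have "2 * R powr (3 / 2 * \<theta>) * ((Cb * (2 * real R) ^ CARD('d)) * K\<^sup>2) / (cw * R powr b)\<^sup>2
        = K\<^sup>2 * (2 * Cb * 2 ^ CARD('d) / cw\<^sup>2) * (R powr (3 / 2 * \<theta>) * R ^ CARD('d) / (R powr b)\<^sup>2)"
        by (simp add: power_mult_distrib)
      then show ?thesis by (simp only: e)
    qed
    \<comment> \<open>The diagonal part decays faster, since
      \<open>b = \<theta> + CARD('d) / 2\<close>.\<close>
    also have "K\<^sup>2 * (3 / cw) * R powr (- b) \<le> K\<^sup>2 * (3 / cw) * R powr (- \<theta> / 2)"
      using R cw \<theta> by (intro mult_left_mono powr_mono) (auto simp: \<theta>_def b_def field_simps)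
    also have "K\<^sup>2 * (3 / cw) * R powr (- \<theta> / 2) + K\<^sup>2 * (2 * Cb * 2 ^ CARD('d) / cw\<^sup>2) * R powr (- \<theta> / 2) = B * R powr (- \<theta> / 2)"
      by (simp add: B_def algebra_simps)
    finally show ?case by (simp add: power_divide)
  qed
  moreover have "filterlim (\<lambda>i::nat. i ^ L) sequentially sequentially"
    using L(1) by (intro filterlim_subseq) (simp add: strict_mono_def power_strict_mono)
  ultimately have "\<forall>\<^sub>F i::nat in sequentially. (\<integral>x. u i x \<partial>X) \<le> B * (real (i ^ L)) powr (- \<theta> / 2)"
    unfolding u_def by (rule eventually_compose_filterlim)
  moreover have "\<forall>\<^sub>F i::nat in sequentially. B * (real (i ^ L)) powr (- \<theta> / 2) \<le> B * (1 / real i ^ 2)"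
    using eventually_ge_at_top[of 1]
  proof eventually_elim
    case (elim i)
    have "real (i ^ L) powr (- \<theta> / 2) = real i powr (- (real L * \<theta> / 2))"
      using elim by (simp add: powr_realpow[symmetric] powr_powr)
    also have "\<dots> \<le> real i powr (- 2)" using elim L by (intro powr_mono) auto
    also have "\<dots> = 1 / real i ^ 2" using elim by (simp add: powr_minus_divide powr_numeral)
    finally show ?case using B by (rule mult_left_mono)
  qed
  ultimately have "\<forall>\<^sub>F i::nat in sequentially. norm (\<integral>x. u i x \<partial>X) \<le> B * (1 / real i ^ 2)"
  proof eventually_elim
    case (elim i)
    have "0 \<le> (\<integral>x. u i x \<partial>X)" by (simp add: u_def)
    then show ?case using elim by simp
  qed
  then have "summable (\<lambda>i. \<integral>x. u i x \<partial>X)"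
    by (rule summable_comparison_test_ev)
      (intro summable_mult inverse_power_summable[of 2, where 'a=real, unfolded inverse_eq_divide], simp)
  then have "AE x in X. (\<lambda>i. u i x) \<longlonglongrightarrow> 0"
    by (intro AE_tendsto_zero_of_summable ui) (auto simp: u_def)
  then have "AE x in X. (\<lambda>i::nat. esum f (real (i ^ L)) x / wsum (real (i ^ L))) \<longlonglongrightarrow> 0"
  proof eventually_elim
    fix x assume "(\<lambda>i. u i x) \<longlonglongrightarrow> 0"
    then have "(\<lambda>i. sqrt (u i x)) \<longlonglongrightarrow> sqrt 0" by (rule tendsto_real_sqrt)
    then have "(\<lambda>i. \<bar>esum f (real (i ^ L)) x / wsum (real (i ^ L))\<bar>) \<longlonglongrightarrow> 0" by (simp add: u_def)
    then show "(\<lambda>i::nat. esum f (real (i ^ L)) x / wsum (real (i ^ L))) \<longlonglongrightarrow> 0" by (rule tendsto_rabs_zero_cancel)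
  qed
  with L(1) show ?thesis by (rule that)
qed

text \<open>Along the radii \<open>R i\<close> the weighted averages inherit convergence from ball
  averages and the error vanishes. As count and mass are asymptotic, consecutive counts have ratio
  tending to 1, which fills the gaps between these radii.\<close>

lemma sparse_average_bounded:
  assumes a: "norm_enumeration a S"
    and f [measurable]: "f \<in> borel_measurable X" and fK: "\<forall>x\<in>space X. \<bar>f x\<bar> \<le> K"
  shows "AE x in X. convergent (\<lambda>N. (\<Sum>k=1..N. f (T (a k) x)) / real N)"
proof -
  obtain L :: nat where L: "1 \<le> L" and es: "AE x in X. (\<lambda>i::nat. esum f (real (i ^ L)) x / wsum (real (i ^ L))) \<longlonglongrightarrow> 0"
    by (rule esum_tendsto_zero[OF f fK])
  \<comment> \<open>\<open>Suc i\<close> keeps the radii at least 1; limits along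
    \<open>i ^ L\<close> are moved here by \<open>LIMSEQ_Suc\<close>.\<close>
  define R where "R i = (Suc i) ^ L" for i :: nat
  have R: "filterlim R sequentially sequentially"
    unfolding R_def using L by (intro filterlim_subseq) (simp add: strict_mono_def power_strict_mono)
  define N where "N i = cnt (R i)" for i
  have N: "filterlim N at_top sequentially"
    unfolding N_def by (rule filterlim_compose[OF cnt_at_top R])
  have cr: "(\<lambda>i. real (N i) / wsum (R i)) \<longlonglongrightarrow> 1"
    unfolding N_def by (rule filterlim_compose[OF cnt_ratio R])
  have R': "filterlim (\<lambda>i. real (R i)) at_top sequentially"
    by (rule filterlim_compose[OF filterlim_real_sequentially R])
  have wr: "(\<lambda>i. wsum (R (Suc i)) / wsum (R i)) \<longlonglongrightarrow> 1"
  proof (rule wsum_ratio[OF R'])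
    show "filterlim (\<lambda>i. real (R (Suc i))) at_top sequentially"
      using R' by (subst filterlim_sequentially_Suc)
    have "(\<lambda>i. (real (Suc (Suc i)) / real (Suc i)) ^ L) \<longlonglongrightarrow> 1 ^ L"
    proof (rule tendsto_power)
      show "(\<lambda>i. real (Suc (Suc i)) / real (Suc i)) \<longlonglongrightarrow> 1" by real_asymp
    qed
    then show "(\<lambda>i. real (R (Suc i)) / real (R i)) \<longlonglongrightarrow> 1"
      by (simp only: R_def of_nat_power power_divide power_one)
    show "real (R i) \<le> real (R (Suc i))" for i
      unfolding R_def of_nat_le_iff by (rule power_mono) auto
  qed
  have wpos: "\<forall>\<^sub>F i in sequentially. 0 < wsum (R i) \<and> 0 < real (N i)"
    using eventually_compose_filterlim[OF cnt_bounds R]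
    by eventually_elim (auto simp: N_def)
  have Nr: "(\<lambda>i. real (N (Suc i)) / real (N i)) \<longlonglongrightarrow> 1"
  proof -
    have "(\<lambda>i. real (N (Suc i)) / wsum (R (Suc i))) \<longlonglongrightarrow> 1"
      using cr by (rule LIMSEQ_Suc)
    then have "(\<lambda>i. (real (N (Suc i)) / wsum (R (Suc i))) * (wsum (R (Suc i)) / wsum (R i)) / (real (N i) / wsum (R i))) \<longlonglongrightarrow> 1 * 1 / 1"
      by (intro tendsto_divide tendsto_mult wr cr) auto
    moreover have "\<forall>\<^sub>F i in sequentially. (real (N (Suc i)) / wsum (R (Suc i))) * (wsum (R (Suc i)) / wsum (R i)) / (real (N i) / wsum (R i)) = real (N (Suc i)) / real (N i)"
      using wpos eventually_sequentially_Suc[THEN iffD2, OF wpos] by eventually_elim auto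
    ultimately show ?thesis by (simp add: Lim_transform_eventually)
  qed
  have "AE x in X. convergent (\<lambda>r::nat. oavg f (real r) x)" by (rule pointwise_ergodic_bounded[OF f fK])
  then show ?thesis using es AE_space
  proof eventually_elim
    fix x assume "convergent (\<lambda>r::nat. oavg f (real r) x)"
      and es: "(\<lambda>i::nat. esum f (real (i ^ L)) x / wsum (real (i ^ L))) \<longlonglongrightarrow> 0" and x: "x \<in> space X"
    then obtain l where "(\<lambda>r::nat. oavg f (real r) x) \<longlonglongrightarrow> l" by (auto simp: convergent_def)
    then have "(\<lambda>r::nat. (\<Sum>n\<in>lball r. p n * f (T n x)) / wsum r) \<longlonglongrightarrow> l"
      by (intro weighted_average_tendsto) (simp add: oavg_def osum_def)
    then have w: "(\<lambda>i. (\<Sum>n\<in>lball (R i). p n * f (T n x)) / wsum (R i)) \<longlonglongrightarrow> l"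
      by (rule filterlim_compose[OF _ R])
    have e: "(\<lambda>i. esum f (R i) x / wsum (R i)) \<longlonglongrightarrow> 0"
      unfolding R_def using es by (rule LIMSEQ_Suc)
    have "(\<lambda>i. ((\<Sum>n\<in>lball (R i). p n * f (T n x)) / wsum (R i) + esum f (R i) x / wsum (R i)) / (real (N i) / wsum (R i))) \<longlonglongrightarrow> (l + 0) / 1"
      by (intro tendsto_divide tendsto_add w e cr) simp
    moreover have "\<forall>\<^sub>F i in sequentially. ((\<Sum>n\<in>lball (R i). p n * f (T n x)) / wsum (R i) + esum f (R i) x / wsum (R i)) / (real (N i) / wsum (R i))
      = (\<Sum>k=1..N i. f (T (a k) x)) / real (N i)"
      using wpos
    proof eventually_elim
      case (elim i)
      have "(\<Sum>k=1..N i. f (T (a k) x)) = ssum f (R i) x"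
        unfolding N_def ssum_def by (rule enumeration_sum[OF a])
      then show ?case using elim by (simp add: ssum_eq add_divide_distrib[symmetric])
    qed
    ultimately have lim: "(\<lambda>i. (\<Sum>k=1..N i. f (T (a k) x)) / real (N i)) \<longlonglongrightarrow> l"
      by (simp add: Lim_transform_eventually)
    have "(\<lambda>n. (\<Sum>k=1..n. f (T (a k) x)) / real n) \<longlonglongrightarrow> l"
      by (rule averages_tendsto_of_subsequence[OF _ N Nr lim]) (use fK x in auto)
    then show "convergent (\<lambda>N. (\<Sum>k=1..N. f (T (a k) x)) / real N)" by (auto simp: convergent_def)
  qed
qed

text \<open>The averages of the bounded truncation \<open>g K\<close> converge, and the maximal
  inequality keeps those of \<open>f - g K\<close> small off a small set. This is the Banach
  principle in the quantitative form asked for by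
  \<open>AE_convergent_of_oscillation\<close>.\<close>

theorem sparse_average_convergent:
  fixes f :: "'x \<Rightarrow> complex"
  assumes a: "norm_enumeration a S" and f: "integrable X f"
  shows "AE x in X. convergent (\<lambda>N. sparse_average a T f N x)"
proof (rule AE_convergent_of_oscillation)
  fix e :: real assume e: "0 < e"
  have [measurable]: "f \<in> borel_measurable X" using f by auto
  obtain C N0 where C: "0 < C" and max: "\<And>f c. integrable X f \<Longrightarrow> (\<forall>x\<in>space X. 0 \<le> f x) \<Longrightarrow> 0 < c \<Longrightarrow>
    measure X {x \<in> space X. \<exists>N\<ge>N0. c * real N < (\<Sum>k=1..N. f (T (a k) x))} \<le> C * (\<integral>x. f x \<partial>X) / c"
    using sparse_maximal[OF a] by blast
  define g where "g K x = (if norm (f x) \<le> real K then f x else 0)" for K x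
  have gm [measurable]: "g K \<in> borel_measurable X" for K unfolding g_def[abs_def] by measurable
  have gK: "norm (g K x) \<le> real K" for K x by (simp add: g_def)
  have fg: "integrable X (\<lambda>x. norm (f x - g K x))" for K
    by (rule Bochner_Integration.integrable_bound[OF integrable_norm[OF f]]) (auto simp: g_def)
  have "(\<lambda>K. \<integral>x. norm (f x - g K x) \<partial>X) \<longlonglongrightarrow> (\<integral>x. 0 \<partial>X)"
  proof (rule integral_dominated_convergence[where w="\<lambda>x. norm (f x)"])
    show "AE x in X. (\<lambda>K. norm (f x - g K x)) \<longlonglongrightarrow> 0"
    proof (rule AE_I2)
      fix x
      have "\<forall>\<^sub>F K in sequentially. norm (f x - g K x) = 0"
        using eventually_ge_at_top[of "nat \<lceil>norm (f x)\<rceil>"]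
      proof eventually_elim
        case (elim K)
        then have "norm (f x) \<le> real K" by linarith
        then show ?case by (simp add: g_def)
      qed
      then show "(\<lambda>K. norm (f x - g K x)) \<longlonglongrightarrow> 0" by (rule tendsto_eventually)
    qed
    show "AE x in X. norm (norm (f x - g K x)) \<le> norm (f x)" for K
      by (rule AE_I2) (simp add: g_def)
  qed (use f in auto)
  \<comment> \<open>At level \<open>e / 3\<close> the maximal inequality then gives measure at most
    \<open>e\<close>. The oscillation is split into thirds: one for the averages of
    \<open>g K\<close>, one for each of the two truncation errors.\<close>
  then have "\<forall>\<^sub>F K in sequentially. (\<integral>x. norm (f x - g K x) \<partial>X) < e * (e / 3) / C"
    by (rule order_tendstoD) (use e C in simp)
  then obtain K where K: "(\<integral>x. norm (f x - g K x) \<partial>X) < e * (e / 3) / C"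
    by (auto dest!: eventually_happens)
  define h where "h x = norm (f x - g K x)" for x
  define A where "A = {x \<in> space X. \<exists>N\<ge>N0. (e / 3) * real N < (\<Sum>k=1..N. h (T (a k) x))}"
  have [measurable]: "h \<in> borel_measurable X" unfolding h_def[abs_def] by measurable
  have A [measurable]: "A \<in> sets X" unfolding A_def by measurable
  have "measure X A \<le> C * (\<integral>x. h x \<partial>X) / (e / 3)"
    unfolding A_def by (rule max) (use fg[of K] e in \<open>auto simp: h_def[abs_def]\<close>)
  also have "\<dots> \<le> e" using K C e by (simp add: h_def field_simps)
  finally have mA: "measure X A \<le> e" .
  have reb: "\<forall>x\<in>space X. \<bar>Re (g K x)\<bar> \<le> real K" "\<forall>x\<in>space X. \<bar>Im (g K x)\<bar> \<le> real K"
    using gK[of K] abs_Re_le_cmod abs_Im_le_cmod by (meson order_trans)+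
  have "AE x in X. convergent (\<lambda>N. (\<Sum>k=1..N. Re (g K (T (a k) x))) / real N)"
    by (rule sparse_average_bounded[OF a _ reb(1)]) measurable
  moreover have "AE x in X. convergent (\<lambda>N. (\<Sum>k=1..N. Im (g K (T (a k) x))) / real N)"
    by (rule sparse_average_bounded[OF a _ reb(2)]) measurable
  ultimately have "AE x in X. x \<notin> A \<longrightarrow> (\<exists>N. \<forall>r\<ge>N. \<forall>s\<ge>N. dist (sparse_average a T f r x) (sparse_average a T f s x) \<le> e)"
    using AE_space
  proof eventually_elim
    fix x assume c: "convergent (\<lambda>N. (\<Sum>k=1..N. Re (g K (T (a k) x))) / real N)"
      "convergent (\<lambda>N. (\<Sum>k=1..N. Im (g K (T (a k) x))) / real N)" and x: "x \<in> space X"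
    show "x \<notin> A \<longrightarrow> (\<exists>N. \<forall>r\<ge>N. \<forall>s\<ge>N. dist (sparse_average a T f r x) (sparse_average a T f s x) \<le> e)"
    proof
      assume xA: "x \<notin> A"
      let ?s = "sparse_average a T (g K)"
      have re: "Re (?s N x) = (\<Sum>k=1..N. Re (g K (T (a k) x))) / real N" and im: "Im (?s N x) = (\<Sum>k=1..N. Im (g K (T (a k) x))) / real N" for N
        unfolding sparse_average_def by (simp_all add: Re_divide_of_nat Im_divide_of_nat)
      obtain l1 l2 where "(\<lambda>N. Re (?s N x)) \<longlonglongrightarrow> l1" "(\<lambda>N. Im (?s N x)) \<longlonglongrightarrow> l2"
        using c unfolding re im convergent_def by blast
      then have "(\<lambda>N. Complex (Re (?s N x)) (Im (?s N x))) \<longlonglongrightarrow> Complex l1 l2" by (rule tendsto_Complex)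
      then have "Cauchy (\<lambda>N. ?s N x)" unfolding complex.collapse by (rule LIMSEQ_imp_Cauchy)
      then obtain N1 where N1: "\<And>r s. N1 \<le> r \<Longrightarrow> N1 \<le> s \<Longrightarrow> dist (?s r x) (?s s x) < e / 3"
        using e by (metis Cauchy_def divide_pos_pos zero_less_numeral)
      have near: "dist (sparse_average a T f N x) (?s N x) \<le> e / 3" if N: "max N0 1 \<le> N" for N
      proof -
        have "(\<Sum>k=1..N. h (T (a k) x)) \<le> (e / 3) * real N" using xA x N by (auto simp: A_def not_less)
        moreover have "norm ((\<Sum>k=1..N. f (T (a k) x)) - (\<Sum>k=1..N. g K (T (a k) x))) \<le> (\<Sum>k=1..N. h (T (a k) x))"
          unfolding sum_subtractf[symmetric] h_def by (rule norm_sum)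
        ultimately show ?thesis
          using N unfolding sparse_average_def dist_norm diff_divide_distrib[symmetric] norm_divide
          by (simp add: pos_divide_le_eq)
      qed
      show "\<exists>N. \<forall>r\<ge>N. \<forall>s\<ge>N. dist (sparse_average a T f r x) (sparse_average a T f s x) \<le> e"
      proof (intro exI[of _ "max N1 (max N0 1)"] allI impI)
        fix r s assume r: "max N1 (max N0 1) \<le> r" and s: "max N1 (max N0 1) \<le> s"
        have "dist (sparse_average a T f r x) (sparse_average a T f s x)
          \<le> dist (sparse_average a T f r x) (?s r x) + (dist (?s r x) (?s s x) + dist (?s s x) (sparse_average a T f s x))"
          by (meson add_left_mono dist_triangle order_trans)
        also have "\<dots> \<le> e / 3 + (e / 3 + e / 3)"
          using near[of r] near[of s] N1[of r s] r s by (intro add_mono) (auto simp: dist_commute)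
        finally show "dist (sparse_average a T f r x) (sparse_average a T f s x) \<le> e" by simp
      qed
    qed
  qed
  with mA A show "\<exists>A\<in>sets X. measure X A \<le> e \<and>
    (AE x in X. x \<notin> A \<longrightarrow> (\<exists>N. \<forall>r\<ge>N. \<forall>s\<ge>N. dist (sparse_average a T f r x) (sparse_average a T f s x) \<le> e))"
    by blast
qed

end

section \<open>Random sets are almost surely sparse sets with small correlations\<close>

lemma exp_le_quadratic:
  fixes y :: real
  assumes "\<bar>y\<bar> \<le> 1"
  shows "exp y \<le> 1 + y + y\<^sup>2"
proof (cases "0 \<le> y")
  case True
  then show ?thesis using assms by (intro exp_bound) auto
next
  case False
  define x where "x = - y"
  have x: "0 < x" using False by (simp add: x_def)
  have "exp y = 1 / exp x" by (simp add: x_def exp_minus inverse_eq_divide)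
  also have "\<dots> \<le> 1 / (1 + x)" using x exp_ge_add_one_self[of x] by (intro divide_left_mono) auto
  also have "\<dots> \<le> 1 - x + x\<^sup>2"
  proof -
    \<comment> \<open>The product is \<open>1 + x ^ 3\<close>.\<close>
    have "1 \<le> (1 - x + x\<^sup>2) * (1 + x)"
      using x by (simp add: algebra_simps power2_eq_square)
    then show ?thesis using x by (simp add: pos_divide_le_eq)
  qed
  finally show ?thesis by (simp add: x_def)
qed

context prob_space
begin

lemma chernoff_upper:
  fixes Y :: "'i \<Rightarrow> 'a \<Rightarrow> real"
  assumes I: "finite I" and ind: "indep_vars (\<lambda>_. borel) Y I"
    and bound: "\<And>i \<omega>. i \<in> I \<Longrightarrow> \<omega> \<in> space M \<Longrightarrow> \<bar>Y i \<omega>\<bar> \<le> 1"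
    and mean: "\<And>i. i \<in> I \<Longrightarrow> expectation (Y i) = 0"
    and var: "\<And>i. i \<in> I \<Longrightarrow> expectation (\<lambda>\<omega>. (Y i \<omega>)\<^sup>2) \<le> v i"
    and t: "0 < t" "t \<le> 1"
  shows "prob {\<omega> \<in> space M. u \<le> (\<Sum>i\<in>I. Y i \<omega>)} \<le> exp (- t * u + t\<^sup>2 * (\<Sum>i\<in>I. v i))"
proof -
  have Y [measurable]: "i \<in> I \<Longrightarrow> Y i \<in> borel_measurable M" for i
    using ind by (simp add: indep_vars_def)
  define Z where "Z i \<omega> = exp (t * Y i \<omega>)" for i \<omega>
  have Zind: "indep_vars (\<lambda>_. borel) Z I"
    unfolding Z_def by (rule indep_vars_compose2[OF ind]) simp
  have Zm [measurable]: "i \<in> I \<Longrightarrow> Z i \<in> borel_measurable M" for i unfolding Z_def[abs_def] by measurable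
  have tY: "\<bar>t * Y i \<omega>\<bar> \<le> 1" if "i \<in> I" "\<omega> \<in> space M" for i \<omega>
    using mult_mono[OF t(2) bound[OF that]] t by (simp add: abs_mult)
  have Zi: "integrable M (Z i)" if "i \<in> I" for i
  proof (rule integrable_const_bound[where B="exp 1"])
    show "AE \<omega> in M. norm (Z i \<omega>) \<le> exp 1"
      by (rule AE_I2) (use tY[OF that] in \<open>auto simp: Z_def abs_le_iff\<close>)
  qed (use that in simp)
  have Yi: "integrable M (Y i)" "integrable M (\<lambda>\<omega>. (Y i \<omega>)\<^sup>2)" if "i \<in> I" for i
  proof -
    show "integrable M (Y i)"
      by (rule integrable_const_bound[where B=1]) (use that bound in auto)
    show "integrable M (\<lambda>\<omega>. (Y i \<omega>)\<^sup>2)"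
      by (rule integrable_const_bound[where B=1]) (use that bound in \<open>auto simp: abs_square_le_1\<close>)
  qed
  have EZ: "expectation (Z i) \<le> exp (t\<^sup>2 * v i)" if i: "i \<in> I" for i
  proof -
    have "expectation (Z i) \<le> expectation (\<lambda>\<omega>. 1 + t * Y i \<omega> + t\<^sup>2 * (Y i \<omega>)\<^sup>2)"
    proof (rule integral_mono[OF Zi[OF i]])
      show "integrable M (\<lambda>\<omega>. 1 + t * Y i \<omega> + t\<^sup>2 * (Y i \<omega>)\<^sup>2)" using Yi[OF i] by simp
      show "Z i \<omega> \<le> 1 + t * Y i \<omega> + t\<^sup>2 * (Y i \<omega>)\<^sup>2" if "\<omega> \<in> space M" for \<omega>
        using exp_le_quadratic[OF tY[OF i that]] by (simp add: Z_def power_mult_distrib)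
    qed
    also have "\<dots> = 1 + t\<^sup>2 * expectation (\<lambda>\<omega>. (Y i \<omega>)\<^sup>2)"
      using Yi[OF i] mean[OF i] by (simp add: prob_space)
    also have "\<dots> \<le> 1 + t\<^sup>2 * v i" using var[OF i] by (simp add: mult_left_mono)
    also have "\<dots> \<le> exp (t\<^sup>2 * v i)" by (rule exp_ge_add_one_self)
    finally show ?thesis .
  qed
  have prodexp: "(\<Prod>i\<in>I. Z i \<omega>) = exp (t * (\<Sum>i\<in>I. Y i \<omega>))" for \<omega>
    using I by (simp add: Z_def exp_sum sum_distrib_left)
  have "expectation (\<lambda>\<omega>. \<Prod>i\<in>I. Z i \<omega>) = (\<Prod>i\<in>I. expectation (Z i))"
    by (rule indep_vars_lebesgue_integral[OF I Zind Zi])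
  also have "\<dots> \<le> (\<Prod>i\<in>I. exp (t\<^sup>2 * v i))"
    using EZ by (intro prod_mono conjI integral_nonneg_AE) (auto simp: Z_def)
  also have "\<dots> = exp (t\<^sup>2 * (\<Sum>i\<in>I. v i))" using I by (simp add: exp_sum sum_distrib_left)
  finally have E: "expectation (\<lambda>\<omega>. \<Prod>i\<in>I. Z i \<omega>) \<le> exp (t\<^sup>2 * (\<Sum>i\<in>I. v i))" .
  have "{\<omega> \<in> space M. u \<le> (\<Sum>i\<in>I. Y i \<omega>)} = {\<omega> \<in> space M. exp (t * u) \<le> (\<Prod>i\<in>I. Z i \<omega>)}"
    unfolding prodexp using t by simp
  also have "prob \<dots> \<le> expectation (\<lambda>\<omega>. \<Prod>i\<in>I. Z i \<omega>) / exp (t * u)"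
    using indep_vars_integrable[OF I Zind Zi]
    by (intro integral_Markov_inequality_measure[where A="{}"]) (auto simp: Z_def intro!: prod_nonneg)
  also have "\<dots> \<le> exp (t\<^sup>2 * (\<Sum>i\<in>I. v i)) / exp (t * u)" using E by (intro divide_right_mono) auto
  also have "\<dots> = exp (- t * u + t\<^sup>2 * (\<Sum>i\<in>I. v i))" by (simp add: exp_diff[symmetric])
  finally show ?thesis .
qed

lemma chernoff_abs:
  fixes Y :: "'i \<Rightarrow> 'a \<Rightarrow> real"
  assumes I: "finite I" and ind: "indep_vars (\<lambda>_. borel) Y I"
    and bound: "\<And>i \<omega>. i \<in> I \<Longrightarrow> \<omega> \<in> space M \<Longrightarrow> \<bar>Y i \<omega>\<bar> \<le> 1"
    and mean: "\<And>i. i \<in> I \<Longrightarrow> expectation (Y i) = 0"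
    and var: "\<And>i. i \<in> I \<Longrightarrow> expectation (\<lambda>\<omega>. (Y i \<omega>)\<^sup>2) \<le> v i"
    and V: "(\<Sum>i\<in>I. v i) \<le> C * r powr (2 * s)" and r: "1 \<le> r" and s: "0 \<le> s"
  shows "prob {\<omega> \<in> space M. r powr (3 / 2 * s) < \<bar>\<Sum>i\<in>I. Y i \<omega>\<bar>} \<le> 2 * exp (C - r powr (s / 2))"
proof -
  have Y [measurable]: "i \<in> I \<Longrightarrow> Y i \<in> borel_measurable M" for i
    using ind by (simp add: indep_vars_def)
  \<comment> \<open>With this \<open>t\<close> the variance term of the exponent is at most the
    constant \<open>C\<close>, while the linear term is \<open>r powr (s / 2)\<close>, the factor by
    which the deviation exceeds the order \<open>r powr s\<close> of the standard deviation.\<close>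
  define t where "t = r powr (- s)"
  have t: "0 < t" "t \<le> 1" using r s powr_mono[of "- s" 0 r] by (auto simp: t_def)
  let ?u = "r powr (3 / 2 * s)"
  have exponent: "- t * ?u + t\<^sup>2 * (\<Sum>i\<in>I. v i) \<le> C - r powr (s / 2)"
  proof -
    have "t * ?u = r powr (s / 2)" using r by (simp add: t_def powr_add[symmetric] field_simps)
    moreover have "t\<^sup>2 * (\<Sum>i\<in>I. v i) \<le> t\<^sup>2 * (C * r powr (2 * s))" by (intro mult_left_mono V) simp
    moreover have "t\<^sup>2 * (C * r powr (2 * s)) = C * (r powr (- s) * r powr (- s) * r powr (2 * s))"
      by (simp add: t_def power2_eq_square)
    moreover have "r powr (- s) * r powr (- s) * r powr (2 * s) = 1" using r by (simp add: powr_add[symmetric])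
    ultimately show ?thesis by simp
  qed
  have 1: "prob {\<omega> \<in> space M. ?u \<le> (\<Sum>i\<in>I. Y i \<omega>)} \<le> exp (C - r powr (s / 2))"
    by (rule order_trans[OF chernoff_upper[OF I ind bound mean var t]]) (use exponent in simp_all)
  have 2: "prob {\<omega> \<in> space M. ?u \<le> (\<Sum>i\<in>I. - Y i \<omega>)} \<le> exp (C - r powr (s / 2))"
  proof (rule order_trans[OF chernoff_upper[OF I _ _ _ _ t]])
    show "indep_vars (\<lambda>_. borel) (\<lambda>i \<omega>. - Y i \<omega>) I" by (rule indep_vars_compose2[OF ind]) simp
  qed (use exponent bound mean var in auto)
  have "prob {\<omega> \<in> space M. ?u < \<bar>\<Sum>i\<in>I. Y i \<omega>\<bar>}
    \<le> prob ({\<omega> \<in> space M. ?u \<le> (\<Sum>i\<in>I. Y i \<omega>)} \<union> {\<omega> \<in> space M. ?u \<le> (\<Sum>i\<in>I. - Y i \<omega>)})"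
    by (rule finite_measure_mono) (auto simp: sum_negf)
  also have "\<dots> \<le> prob {\<omega> \<in> space M. ?u \<le> (\<Sum>i\<in>I. Y i \<omega>)} + prob {\<omega> \<in> space M. ?u \<le> (\<Sum>i\<in>I. - Y i \<omega>)}"
    by (rule measure_Un_le) auto
  finally show ?thesis using 1 2 by simp
qed

end

text \<open>Adding \<open>m\<close> moves \<open>n\<close> to an adjacent block of length
  \<open>\<bar>m\<bar>\<close>.\<close>

lemma div_shift_parity:
  fixes n m :: int
  assumes "m \<noteq> 0"
  shows "even ((n + m) div \<bar>m\<bar>) \<longleftrightarrow> odd (n div \<bar>m\<bar>)"
proof (cases "0 < m")
  case True
  then show ?thesis by simp
next
  case False
  define k where "k = - m"
  have k: "k \<noteq> 0" "\<bar>m\<bar> = k" "m = - k" using False assms by (auto simp: k_def)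
  have "(n + (- 1) * k) div k = - 1 + n div k" using k by (intro div_mult_self1) 
  then show ?thesis using k by simp
qed

locale random_subset = prob_space M + dyadic_weight p \<gamma>
  for M :: "'w measure" and p :: "int ^ 'd::finite \<Rightarrow> real" and \<gamma> :: real +
  fixes \<xi> :: "int ^ 'd \<Rightarrow> 'w \<Rightarrow> nat"
  assumes \<gamma>_half: "\<gamma> < CARD('d) / 2"
    and indep: "indep_vars (\<lambda>_. count_space UNIV) \<xi> UNIV"
    and p_eq: "p n = prob {\<omega> \<in> space M. \<xi> n \<omega> = 1}"
begin

definition \<zeta> :: "int ^ 'd \<Rightarrow> 'w \<Rightarrow> real" where
  "\<zeta> n \<omega> = indicator {n. \<xi> n \<omega> = 1} n - p n"

lemma \<xi>_measurable [measurable]: "\<xi> n \<in> measurable M (count_space UNIV)"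
  using indep by (simp add: indep_vars_def)

lemma \<zeta>_indep: "indep_vars (\<lambda>_. borel) \<zeta> UNIV"
proof -
  have "indep_vars (\<lambda>_. borel) (\<lambda>n \<omega>. (\<lambda>k. (if k = 1 then 1 else 0) - p n) (\<xi> n \<omega>)) UNIV"
    by (rule indep_vars_compose2[OF indep]) simp
  also have "(\<lambda>n \<omega>. (\<lambda>k. (if k = 1 then 1 else 0) - p n) (\<xi> n \<omega>)) = \<zeta>"
    by (intro ext) (simp add: \<zeta>_def indicator_def)
  finally show ?thesis .
qed

lemma \<zeta>_measurable [measurable]: "\<zeta> n \<in> borel_measurable M"
  using \<zeta>_indep by (simp add: indep_vars_def)

lemma \<zeta>_abs: "\<bar>\<zeta> n \<omega>\<bar> \<le> 1"
  using p_nonneg[of n] p_le_1[of n] by (auto simp: \<zeta>_def indicator_def)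

lemma \<zeta>_integrable: "integrable M (\<zeta> n)" "integrable M (\<lambda>\<omega>. (\<zeta> n \<omega>)\<^sup>2)"
proof -
  show "integrable M (\<zeta> n)"
    by (rule integrable_const_bound[where B=1]) (use \<zeta>_abs in auto)
  show "integrable M (\<lambda>\<omega>. (\<zeta> n \<omega>)\<^sup>2)"
    by (rule integrable_const_bound[where B=1]) (use \<zeta>_abs in \<open>auto simp: abs_square_le_1\<close>)
qed

lemma \<zeta>_mean: "expectation (\<zeta> n) = 0"
proof -
  have "expectation (\<zeta> n) = expectation (\<lambda>\<omega>. indicator {\<omega> \<in> space M. \<xi> n \<omega> = 1} \<omega> - p n)"
    by (intro Bochner_Integration.integral_cong refl) (simp add: \<zeta>_def indicator_def)
  also have "\<dots> = prob {\<omega> \<in> space M. \<xi> n \<omega> = 1} - p n"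
    by (subst Bochner_Integration.integral_diff) (auto simp: prob_space emeasure_eq_measure)
  finally show ?thesis by (simp add: p_eq)
qed

lemma \<zeta>_variance: "expectation (\<lambda>\<omega>. (\<zeta> n \<omega>)\<^sup>2) \<le> p n"
proof -
  have "expectation (\<lambda>\<omega>. (\<zeta> n \<omega>)\<^sup>2) = expectation (\<lambda>\<omega>. (1 - 2 * p n) * \<zeta> n \<omega> + (p n - p n * p n))"
    by (intro Bochner_Integration.integral_cong refl)
      (auto simp: \<zeta>_def indicator_def power2_eq_square algebra_simps)
  also have "\<dots> = p n - p n * p n" using \<zeta>_integrable(1) by (simp add: prob_space \<zeta>_mean)
  also have "\<dots> \<le> p n" by simp
  finally show ?thesis .
qed

lemma \<zeta>_pair:
  assumes "n \<noteq> k"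
  shows "expectation (\<lambda>\<omega>. \<zeta> n \<omega> * \<zeta> k \<omega>) = 0"
    and "expectation (\<lambda>\<omega>. (\<zeta> n \<omega> * \<zeta> k \<omega>)\<^sup>2) \<le> p n * p k"
proof -
  have ind: "indep_vars (\<lambda>_. borel) \<zeta> {n, k}" using \<zeta>_indep by (rule indep_vars_subset) simp
  have ind2: "indep_vars (\<lambda>_. borel) (\<lambda>i \<omega>. (\<zeta> i \<omega>)\<^sup>2) {n, k}" by (rule indep_vars_compose2[OF ind]) simp
  have "expectation (\<lambda>\<omega>. \<Prod>i\<in>{n, k}. \<zeta> i \<omega>) = (\<Prod>i\<in>{n, k}. expectation (\<zeta> i))"
    by (rule indep_vars_lebesgue_integral[OF _ ind]) (use \<zeta>_integrable in auto)
  then show "expectation (\<lambda>\<omega>. \<zeta> n \<omega> * \<zeta> k \<omega>) = 0" using assms by (simp add: \<zeta>_mean)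
  have "expectation (\<lambda>\<omega>. \<Prod>i\<in>{n, k}. (\<zeta> i \<omega>)\<^sup>2) = (\<Prod>i\<in>{n, k}. expectation (\<lambda>\<omega>. (\<zeta> i \<omega>)\<^sup>2))"
    by (rule indep_vars_lebesgue_integral[OF _ ind2]) (use \<zeta>_integrable in auto)
  then have "expectation (\<lambda>\<omega>. (\<zeta> n \<omega> * \<zeta> k \<omega>)\<^sup>2) = expectation (\<lambda>\<omega>. (\<zeta> n \<omega>)\<^sup>2) * expectation (\<lambda>\<omega>. (\<zeta> k \<omega>)\<^sup>2)"
    using assms by (simp add: power_mult_distrib)
  also have "\<dots> \<le> p n * p k" using \<zeta>_variance p_nonneg by (intro mult_mono) auto
  finally show "expectation (\<lambda>\<omega>. (\<zeta> n \<omega> * \<zeta> k \<omega>)\<^sup>2) \<le> p n * p k" .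
qed

text \<open>The hypothesis makes the pairs \<open>{n, n + m}\<close> with \<open>n \<in> A\<close>
  disjoint, so the products are functions of disjoint groups of independent variables. It excludes
  chains such as \<open>{n, n + m}\<close> and \<open>{n + m, n + m + m}\<close>.\<close>

lemma \<zeta>_product_indep:
  assumes A: "\<And>n. n \<in> A \<Longrightarrow> n + m \<notin> A"
  shows "indep_vars (\<lambda>_. borel) (\<lambda>n \<omega>. \<zeta> n \<omega> * \<zeta> (n + m) \<omega>) A"
proof -
  have disj: "disjoint_family_on (\<lambda>n. {n, n + m}) A"
    unfolding disjoint_family_on_def using A by auto
  have "indep_vars (\<lambda>n. PiM {n, n + m} (\<lambda>_. borel)) (\<lambda>n \<omega>. restrict (\<lambda>i. \<zeta> i \<omega>) {n, n + m}) A"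
    by (rule indep_vars_restrict[OF \<zeta>_indep _ disj]) simp
  then have "indep_vars (\<lambda>_. borel) (\<lambda>n \<omega>. (\<lambda>f. f n * f (n + m)) (restrict (\<lambda>i. \<zeta> i \<omega>) {n, n + m})) A"
    by (rule indep_vars_compose2) (intro borel_measurable_times measurable_component_singleton, auto)
  then show ?thesis by simp
qed

text \<open>The variance of a product is at most \<open>p n * p (n + m)\<close>, hence at most the
  mean of the two squares. Summation gives the sum of squares over the ball, a bound that is the
  same for every shift.\<close>

lemma correlation_class_tail:
  fixes R :: nat
  assumes C: "\<And>R. 1 \<le> R \<Longrightarrow> (\<Sum>n\<in>(lball R :: (int ^ 'd) set). p n * p n) \<le> C * R powr (2 * s)"
    and s: "0 \<le> s" and R: "1 \<le> R" and m: "m \<noteq> 0"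
    and A: "A \<subseteq> {n. n \<in> lball R \<and> n + m \<in> lball R}" "\<And>n. n \<in> A \<Longrightarrow> n + m \<notin> A"
  shows "prob {\<omega> \<in> space M. R powr (3 / 2 * s) < \<bar>\<Sum>n\<in>A. \<zeta> n \<omega> * \<zeta> (n + m) \<omega>\<bar>} \<le> 2 * exp (C - R powr (s / 2))"
proof (rule chernoff_abs[where v="\<lambda>n. p n * p (n + m)"])
  have AL: "A \<subseteq> lball R" using A(1) by auto
  show fin: "finite A" using AL by (rule finite_subset) simp
  show "indep_vars (\<lambda>_. borel) (\<lambda>n \<omega>. \<zeta> n \<omega> * \<zeta> (n + m) \<omega>) A" by (rule \<zeta>_product_indep[OF A(2)])
  show "\<bar>\<zeta> n \<omega> * \<zeta> (n + m) \<omega>\<bar> \<le> 1" for n \<omega>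
    using mult_mono[OF \<zeta>_abs[of n \<omega>] \<zeta>_abs[of "n + m" \<omega>]] by (simp add: abs_mult)
  show "expectation (\<lambda>\<omega>. \<zeta> n \<omega> * \<zeta> (n + m) \<omega>) = 0" for n using m by (intro \<zeta>_pair) auto
  show "expectation (\<lambda>\<omega>. (\<zeta> n \<omega> * \<zeta> (n + m) \<omega>)\<^sup>2) \<le> p n * p (n + m)" for n using m by (intro \<zeta>_pair) auto
  have "(\<Sum>n\<in>A. p n * p (n + m)) \<le> (\<Sum>n\<in>A. (p n * p n + p (n + m) * p (n + m)) / 2)"
  proof (rule sum_mono)
    fix n show "p n * p (n + m) \<le> (p n * p n + p (n + m) * p (n + m)) / 2"
      using sum_squares_bound[of "p n" "p (n + m)"] by (simp add: power2_eq_square)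
  qed
  also have "\<dots> = ((\<Sum>n\<in>A. p n * p n) + (\<Sum>n\<in>A. p (n + m) * p (n + m))) / 2"
    by (simp add: sum.distrib sum_divide_distrib[symmetric])
  also have "(\<Sum>n\<in>A. p (n + m) * p (n + m)) = (\<Sum>k\<in>(\<lambda>n. n + m) ` A. p k * p k)"
    by (subst sum.reindex) auto
  also have "\<dots> \<le> (\<Sum>n\<in>(lball R :: (int ^ 'd) set). p n * p n)"
    using A(1) by (intro sum_mono2) (auto simp: p_nonneg)
  also have "(\<Sum>n\<in>A. p n * p n) \<le> (\<Sum>n\<in>(lball R :: (int ^ 'd) set). p n * p n)"
    using AL by (intro sum_mono2) (auto simp: p_nonneg)
  also have "((\<Sum>n\<in>(lball R :: (int ^ 'd) set). p n * p n) + (\<Sum>n\<in>(lball R :: (int ^ 'd) set). p n * p n)) / 2 \<le> C * R powr (2 * s)"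
    using C[of "real R"] R by simp
  finally show "(\<Sum>n\<in>A. p n * p (n + m)) \<le> C * R powr (2 * s)" by simp
qed (use R s in auto)

text \<open>Fix a coordinate \<open>i\<close> with \<open>m $ i \<noteq> 0\<close>. The parity of \<open>n $ i div \<bar>m $ i\<bar>\<close> distinguishes \<open>n\<close> from \<open>n + m\<close>, so
  on each parity class the pairs \<open>{n, n + m}\<close> are disjoint and the products \<open>\<zeta> n * \<zeta> (n + m)\<close> independent.\<close>

lemma correlation_tail:
  fixes R :: nat
  assumes C: "\<And>R. 1 \<le> R \<Longrightarrow> (\<Sum>n\<in>(lball R :: (int ^ 'd) set). p n * p n) \<le> C * R powr (2 * s)"
    and s: "0 \<le> s" and R: "1 \<le> R" and m: "m \<noteq> 0"
  shows "prob {\<omega> \<in> space M. 2 * R powr (3 / 2 * s) < \<bar>\<Sum>n | n \<in> lball R \<and> n + m \<in> lball R. \<zeta> n \<omega> * \<zeta> (n + m) \<omega>\<bar>}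
    \<le> 4 * exp (C - R powr (s / 2))"
proof -
  obtain i where i: "m $ i \<noteq> 0" using m by (auto simp: vec_eq_iff)
  define I where "I = {n. n \<in> lball R \<and> n + m \<in> lball R}"
  define A0 where "A0 = {n \<in> I. even (n $ i div \<bar>m $ i\<bar>)}"
  define A1 where "A1 = {n \<in> I. odd (n $ i div \<bar>m $ i\<bar>)}"
  have fin: "finite I" unfolding I_def by (rule finite_subset[of _ "lball R"]) auto
  have A: "A0 \<subseteq> {n. n \<in> lball R \<and> n + m \<in> lball R}" "A1 \<subseteq> {n. n \<in> lball R \<and> n + m \<in> lball R}"
    by (auto simp: A0_def A1_def I_def)
  have sep: "n \<in> A0 \<Longrightarrow> n + m \<notin> A0" "n \<in> A1 \<Longrightarrow> n + m \<notin> A1" for n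
    using div_shift_parity[OF i, of "n $ i"] by (auto simp: A0_def A1_def)
  have fins: "finite A0" "finite A1" using fin by (auto simp: A0_def A1_def)
  let ?u = "R powr (3 / 2 * s)" and ?g = "\<lambda>\<omega> n. \<zeta> n \<omega> * \<zeta> (n + m) \<omega>"
  have split: "sum (?g \<omega>) I = sum (?g \<omega>) A0 + sum (?g \<omega>) A1" for \<omega>
  proof -
    have "I = A0 \<union> A1" "A0 \<inter> A1 = {}" by (auto simp: A0_def A1_def)
    then show ?thesis using fins by (simp add: sum.union_disjoint)
  qed
  have "prob {\<omega> \<in> space M. 2 * ?u < \<bar>sum (?g \<omega>) I\<bar>}
    \<le> prob ({\<omega> \<in> space M. ?u < \<bar>sum (?g \<omega>) A0\<bar>} \<union> {\<omega> \<in> space M. ?u < \<bar>sum (?g \<omega>) A1\<bar>})"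
    by (rule finite_measure_mono) (auto simp: split)
  also have "\<dots> \<le> prob {\<omega> \<in> space M. ?u < \<bar>sum (?g \<omega>) A0\<bar>} + prob {\<omega> \<in> space M. ?u < \<bar>sum (?g \<omega>) A1\<bar>}"
    by (rule measure_Un_le) auto
  also have "\<dots> \<le> 2 * exp (C - R powr (s / 2)) + 2 * exp (C - R powr (s / 2))"
    by (intro add_mono correlation_class_tail[OF C s R m] A sep)
  finally show ?thesis by (simp add: I_def)
qed

lemma count_tail:
  fixes R :: nat
  assumes C: "\<And>R. 1 \<le> R \<Longrightarrow> wsum R \<le> C * R powr (2 * s)" and s: "0 \<le> s" and R: "1 \<le> R"
  shows "prob {\<omega> \<in> space M. R powr (3 / 2 * s) < \<bar>\<Sum>n\<in>lball R. \<zeta> n \<omega>\<bar>} \<le> 2 * exp (C - R powr (s / 2))"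
proof (rule chernoff_abs[where v=p])
  show "indep_vars (\<lambda>_. borel) \<zeta> (lball R)" using \<zeta>_indep by (rule indep_vars_subset) simp
  show "(\<Sum>n\<in>lball R. p n) \<le> C * R powr (2 * s)" using C[of "real R"] R by (simp add: wsum_def)
qed (use \<zeta>_abs \<zeta>_mean \<zeta>_variance R s in auto)

lemma summable_stretched_exponential:
  fixes k :: nat and C c s :: real
  assumes "0 < s"
  shows "summable (\<lambda>R::nat. c * real R ^ k * exp (C - real R powr s))"
proof (rule summable_comparison_test_ev)
  show "summable (\<lambda>R::nat. 1 / real R ^ 2)"
    using inverse_power_summable[of 2, where 'a=real] by (simp add: inverse_eq_divide)
  have "(\<lambda>R::nat. \<bar>c\<bar> * exp C * (real R powr (real k + 2) * exp (- (real R powr s)))) \<longlonglongrightarrow> 0"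
    using assms by real_asymp
  then have "\<forall>\<^sub>F R::nat in sequentially. \<bar>c\<bar> * exp C * (real R powr (real k + 2) * exp (- (real R powr s))) < 1"
    by (rule order_tendstoD) simp
  then show "\<forall>\<^sub>F R::nat in sequentially. norm (c * real R ^ k * exp (C - real R powr s)) \<le> 1 / real R ^ 2"
    using eventually_gt_at_top[of 0]
  proof eventually_elim
    case (elim R)
    have "\<bar>c\<bar> * real R ^ k * exp (C - real R powr s) * real R ^ 2 < 1"
      using elim by (simp add: powr_add powr_realpow powr_numeral exp_diff exp_minus field_simps)
    then show ?case using elim by (simp add: abs_mult pos_le_divide_eq)
  qed
qed

text \<open>The tails are smaller than every power of \<open>R\<close>, so the union over the shifts
  in \<open>lball (2 * R)\<close>, of order \<open>R ^ CARD('d)\<close> in number, still leaves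
  summable probabilities for Borel-Cantelli.\<close>

theorem AE_sparse_set: "AE \<omega> in M. sparse_set p \<gamma> {n. \<xi> n \<omega> = 1}"
proof -
  define b s where "b = (CARD('d) - \<gamma>) / 2" and "s = CARD('d) / 2 - \<gamma>"
  have b: "b > 0" and s: "s > 0" using \<gamma>_less \<gamma>_half by (auto simp: b_def s_def)
  have b2: "2 * b = CARD('d) - \<gamma>" and s2: "2 * s = CARD('d) - 2 * \<gamma>" by (simp_all add: b_def s_def)
  obtain C where C: "\<And>R. 1 \<le> R \<Longrightarrow> wsum R \<le> C * R powr (2 * b)"
    using wsum_upper unfolding b2 by blast
  \<comment> \<open>Here \<open>\<gamma> < CARD('d) / 2\<close> enters: the exponent
    \<open>2 * \<gamma>\<close> of the squared weight lies below the dimension, so its mass is at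
    most of order \<open>R powr (2 * s)\<close>.\<close>
  interpret sq: dyadic_weight "\<lambda>n. p n * p n" "2 * \<gamma>"
  proof
    show "p n * p n \<le> 1" for n using p_nonneg p_le_1 by (intro mult_le_one)
    show "p n * p n = 2 powr (- (2 * \<gamma>) * real j)" if "2 ^ j \<le> lattice_norm n" "lattice_norm n < 2 ^ (j + 1)" for n j
      unfolding p_level[OF that] by (simp add: powr_add[symmetric] algebra_simps)
  qed (use \<gamma>_nonneg \<gamma>_half p_nonneg in auto)
  obtain C2 where C2: "\<And>R. 1 \<le> R \<Longrightarrow> (\<Sum>n\<in>(lball R :: (int ^ 'd) set). p n * p n) \<le> C2 * R powr (2 * s)"
    using sq.wsum_upper unfolding s2 sq.wsum_def by blast
  obtain Cb where Cb: "0 < Cb" "\<And>r. 1 \<le> r \<Longrightarrow> bcount TYPE('d) r \<le> Cb * r ^ CARD('d)"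
    using bcount_bounds[where 'd='d] by metis
  define bad1 where "bad1 R = {\<omega> \<in> space M. R powr (3 / 2 * b) < \<bar>\<Sum>n\<in>lball R. \<zeta> n \<omega>\<bar>}" for R :: nat
  define bad2 where "bad2 R m = {\<omega> \<in> space M. 2 * R powr (3 / 2 * s) < \<bar>\<Sum>n | n \<in> lball R \<and> n + m \<in> lball R. \<zeta> n \<omega> * \<zeta> (n + m) \<omega>\<bar>}" for R :: nat and m
  define bad where "bad R = bad1 R \<union> (\<Union>m\<in>lball (2 * R) - {0}. bad2 R m)" for R :: nat
  have [measurable]: "bad1 R \<in> sets M" "bad2 R m \<in> sets M" for R m
    unfolding bad1_def bad2_def by measurable
  have badm [measurable]: "bad R \<in> sets M" for R unfolding bad_def by (intro sets.Un sets.finite_UN) auto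
  have pb: "prob (bad R) \<le> 2 * real R ^ 0 * exp (C - R powr (b / 2)) + 4 * (Cb * 2 ^ CARD('d)) * real R ^ CARD('d) * exp (C2 - R powr (s / 2))"
    if R: "1 \<le> R" for R :: nat
  proof -
    have "prob (bad R) \<le> prob (bad1 R) + prob (\<Union>m\<in>lball (2 * R) - {0}. bad2 R m)"
      unfolding bad_def by (rule measure_Un_le) (auto intro!: sets.finite_UN)
    also have "prob (bad1 R) \<le> 2 * real R ^ 0 * exp (C - R powr (b / 2))"
      unfolding bad1_def using count_tail[OF C _ R] b by simp
    also have "prob (\<Union>m\<in>lball (2 * R) - {0}. bad2 R m) \<le> (\<Sum>m\<in>lball (2 * R) - {0}. prob (bad2 R m))"
      by (rule measure_UNION_le) auto
    also have "\<dots> \<le> (\<Sum>m\<in>(lball (2 * R) :: (int ^ 'd) set) - {0}. 4 * exp (C2 - R powr (s / 2)))"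
      unfolding bad2_def using correlation_tail[OF C2 _ R] s by (intro sum_mono) auto
    also have "\<dots> \<le> (\<Sum>m\<in>(lball (2 * R) :: (int ^ 'd) set). 4 * exp (C2 - R powr (s / 2)))"
      by (intro sum_mono2) auto
    also have "\<dots> = bcount TYPE('d) (2 * R) * (4 * exp (C2 - R powr (s / 2)))" by (simp add: bcount_def)
    also have "\<dots> \<le> (Cb * (2 * R) ^ CARD('d)) * (4 * exp (C2 - R powr (s / 2)))"
      using R Cb(2)[of "2 * real R"] by (intro mult_right_mono) auto
    finally show ?thesis by (simp add: power_mult_distrib mult_ac)
  qed
  have "AE \<omega> in M. \<forall>\<^sub>F R in sequentially. \<omega> \<in> space M - bad R"
  proof (rule borel_cantelli_AE1[OF badm])
    have "summable (\<lambda>R::nat. 2 * real R ^ 0 * exp (C - R powr (b / 2)) + 4 * (Cb * 2 ^ CARD('d)) * real R ^ CARD('d) * exp (C2 - R powr (s / 2)))"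
      using b s by (intro summable_add summable_stretched_exponential) auto
    then show "summable (\<lambda>R. prob (bad R))"
      by (rule summable_comparison_test_ev[rotated])
        (rule eventually_mono[OF eventually_ge_at_top[of 1]], use pb in simp)
  qed (simp add: emeasure_eq_measure)
  then show ?thesis
  proof eventually_elim
    fix \<omega> assume good: "\<forall>\<^sub>F R in sequentially. \<omega> \<in> space M - bad R"
    show "sparse_set p \<gamma> {n. \<xi> n \<omega> = 1}"
    proof
      show "\<forall>\<^sub>F R::nat in sequentially. \<bar>\<Sum>n\<in>lball R. indicator {n. \<xi> n \<omega> = 1} n - p n\<bar> \<le> R powr (3 / 4 * (CARD('d) - \<gamma>))"
        using good
      proof eventually_elim
        case (elim R)
        have e: "3 / 2 * b = 3 / 4 * (CARD('d) - \<gamma>)" by (simp add: b_def)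
        have "\<omega> \<notin> bad1 R" using elim unfolding bad_def by blast
        then have "\<not> R powr (3 / 2 * b) < \<bar>\<Sum>n\<in>lball R. \<zeta> n \<omega>\<bar>"
          using elim unfolding bad1_def by blast
        then show ?case by (simp only: not_less \<zeta>_def e)
      qed
      show "\<forall>\<^sub>F R::nat in sequentially. \<forall>m. m \<noteq> 0 \<longrightarrow>
        \<bar>\<Sum>n | n \<in> lball R \<and> n + m \<in> lball R. (indicator {n. \<xi> n \<omega> = 1} n - p n) * (indicator {n. \<xi> n \<omega> = 1} (n + m) - p (n + m))\<bar>
        \<le> 2 * R powr (3 / 2 * (CARD('d) / 2 - \<gamma>))"
        using good
      proof (eventually_elim, intro allI impI)
        fix R :: nat and m :: "int ^ 'd" assume g: "\<omega> \<in> space M - bad R" and m: "m \<noteq> 0"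
        show "\<bar>\<Sum>n | n \<in> lball R \<and> n + m \<in> lball R. (indicator {n. \<xi> n \<omega> = 1} n - p n) * (indicator {n. \<xi> n \<omega> = 1} (n + m) - p (n + m))\<bar>
          \<le> 2 * R powr (3 / 2 * (CARD('d) / 2 - \<gamma>))"
        proof (cases "m \<in> lball (2 * R)")
          case True
          then have "\<omega> \<notin> bad2 R m" using g m unfolding bad_def by blast
          then have "\<not> 2 * R powr (3 / 2 * s) < \<bar>\<Sum>n | n \<in> lball R \<and> n + m \<in> lball R. \<zeta> n \<omega> * \<zeta> (n + m) \<omega>\<bar>"
            using g unfolding bad2_def by blast
          then show ?thesis by (simp only: not_less \<zeta>_def s_def)
        next
          case False
          \<comment> \<open>Longer shifts leave no pair inside the ball, so the finite union in
            \<open>bad\<close> accounts for all \<open>m\<close>.\<close>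
          have empty: "{n. n \<in> lball R \<and> n + m \<in> lball R} = {}"
          proof (intro equals0I)
            fix n assume "n \<in> {n. n \<in> lball R \<and> n + m \<in> lball R}"
            then have "lattice_norm ((n + m) + - n) < 2 * real R"
              using lattice_norm_triangle[of "n + m" "- n"] by simp
            then show False using False by simp
          qed
          show ?thesis unfolding empty by simp
        qed
      qed
    qed (rule \<gamma>_half)
  qed
qed

end

section \<open>Transfer to arbitrary probability spaces\<close>

text \<open>Sending \<open>x\<close> to the family \<open>\<lambda>n. f (T n x)\<close> intertwines
  the action with the shift under the image measure, and \<open>f\<close> becomes evaluation at 0.
  The averages of the two systems agree pointwise, so convergence on the fixed type of families
  forces it on every type.\<close>

lemma averages_converge_ae_transfer:
  fixes a :: "nat \<Rightarrow> int ^ 'd::finite" and X :: "'x measure" and f :: "'x \<Rightarrow> complex"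
  assumes model: "\<And>Y :: (int ^ 'd \<Rightarrow> complex) measure. prob_space Y \<Longrightarrow> averages_converge_ae a Y"
    and X: "prob_space X" and T: "measure_preserving_action X T" and f: "integrable X f"
  shows "AE x in X. convergent (\<lambda>N. sparse_average a T f N x)"
proof -
  interpret zd_action X T using X T by (intro zd_action.intro zd_action_axioms.intro)
  have [measurable]: "f \<in> borel_measurable X" using f by auto
  define Q :: "(int ^ 'd \<Rightarrow> complex) measure" where "Q = PiM UNIV (\<lambda>_. borel)"
  define \<Phi> where "\<Phi> x = (\<lambda>n. f (T n x))" for x
  \<comment> \<open>Translating the index by \<open>n\<close> corresponds to \<open>T n\<close>,
    because \<open>T m (T n x) = T (m + n) x\<close>.\<close>
  define U where "U n y = (\<lambda>m. y (m + n))" for n :: "int ^ 'd" and y :: "int ^ 'd \<Rightarrow> complex"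
  define ev where "ev y = y 0" for y :: "int ^ 'd \<Rightarrow> complex"
  have \<Phi> [measurable]: "\<Phi> \<in> measurable X Q"
    unfolding \<Phi>_def[abs_def] Q_def by (rule measurable_PiM_single') auto
  have comp: "(\<lambda>y. y k) \<in> borel_measurable Q" for k
    unfolding Q_def by (rule measurable_component_singleton) simp
  have U [measurable]: "U n \<in> measurable Q Q" for n
    unfolding U_def[abs_def] Q_def
    by (rule measurable_PiM_single') (use comp in \<open>auto simp: Q_def\<close>)
  have ev [measurable]: "ev \<in> borel_measurable Q" unfolding ev_def[abs_def] by (rule comp)
  define P where "P = distr X Q \<Phi>"
  have P: "prob_space P" unfolding P_def by (rule prob_space_distr) simp
  have sP: "sets P = sets Q" by (simp add: P_def)
  have spP: "space P = UNIV" by (simp add: P_def Q_def space_PiM)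
  have shift: "U n (\<Phi> x) = \<Phi> (T n x)" if "x \<in> space X" for n x
    using that by (simp add: U_def \<Phi>_def T_add)
  have "measure_preserving_action P U"
    unfolding measure_preserving_action_def measure_preserving_map_def
  proof (intro conjI allI ballI)
    fix n
    show "U n \<in> measurable P P" using U by (simp cong: measurable_cong_sets add: sP)
    have "distr P P (U n) = distr P Q (U n)" by (rule distr_cong) (auto simp: sP)
    also have "\<dots> = distr X Q (U n \<circ> \<Phi>)" unfolding P_def by (rule distr_distr) auto
    also have "\<dots> = distr X Q (\<Phi> \<circ> T n)" by (rule distr_cong) (auto simp: shift)
    also have "\<dots> = distr (distr X X (T n)) Q \<Phi>" by (rule distr_distr[symmetric]) auto
    also have "\<dots> = P" by (simp add: distr_T P_def)
    finally show "distr P P (U n) = P" .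
  qed (auto simp: U_def algebra_simps)
  moreover have "integrable P ev"
  proof -
    have "integrable X (\<lambda>x. ev (\<Phi> x)) \<longleftrightarrow> integrable X f"
      by (rule Bochner_Integration.integrable_cong) (auto simp: ev_def \<Phi>_def)
    then show ?thesis unfolding P_def using f by (simp add: integrable_distr_eq)
  qed
  ultimately have "AE y in P. convergent (\<lambda>N. sparse_average a U ev N y)"
    using model[OF P] by (simp add: averages_converge_ae_def)
  then have "AE x in X. convergent (\<lambda>N. sparse_average a U ev N (\<Phi> x))"
    unfolding P_def by (rule AE_distrD[OF \<Phi>])
  moreover have "sparse_average a U ev N (\<Phi> x) = sparse_average a T f N x" for N x
    by (simp add: sparse_average_def U_def ev_def \<Phi>_def)
  ultimately show ?thesis by simp
qed

theorem theorem1p1: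
  fixes M :: "'w measure"
    and \<xi> :: "int ^ 'd \<Rightarrow> 'w \<Rightarrow> nat"
    and \<gamma> :: real
  assumes "prob_space M"
    and "0 \<le> \<gamma>" and "\<gamma> < real CARD('d) / 2"
    and "prob_space.indep_vars M (\<lambda>_. count_space UNIV) \<xi> UNIV"
    and "\<And>n \<omega>. \<omega> \<in> space M \<Longrightarrow> \<xi> n \<omega> \<in> {0, 1}"
    and "\<And>n j::nat. 2 ^ j \<le> lattice_norm n \<Longrightarrow> lattice_norm n < 2 ^ (j + 1) \<Longrightarrow>
           measure M {\<omega> \<in> space M. \<xi> n \<omega> = 1} = 2 powr (- \<gamma> * real j)"
  shows "(AE \<omega> in M. \<omega> \<notin> exceptional_set M \<xi>) \<and>
    (\<forall>\<omega> \<in> space M - exceptional_set M \<xi>.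
       \<forall>a. norm_enumeration a {n. \<xi> n \<omega> = 1} \<longrightarrow>
         (\<forall>(X :: 'x measure) T f.
            prob_space X \<longrightarrow> measure_preserving_action X T \<longrightarrow> integrable X f \<longrightarrow>
              (AE x in X. convergent (\<lambda>N. sparse_average a T f N x))))"
proof (intro conjI ballI allI impI)
  interpret prob_space M by (rule assms(1))
  \<comment> \<open>Taking the actual probability at every point includes the origin, whose
    distribution no shell prescribes.\<close>
  define p where "p n = prob {\<omega> \<in> space M. \<xi> n \<omega> = 1}" for n
  interpret random_subset M p \<gamma> \<xi>
  proof
    show "\<gamma> < CARD('d)" using assms(2,3) by linarith
    show "p n = 2 powr (- \<gamma> * real j)" if "2 ^ j \<le> lattice_norm n" "lattice_norm n < 2 ^ (j + 1)" for n j
      unfolding p_def using that by (rule assms(6))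
  qed (use assms(2,3,4) in \<open>auto simp: p_def\<close>)
  show "AE \<omega> in M. \<omega> \<notin> exceptional_set M \<xi>"
    using AE_sparse_set
  proof eventually_elim
    fix \<omega> assume S: "sparse_set p \<gamma> {n. \<xi> n \<omega> = 1}"
    have "averages_converge_ae a X" if "norm_enumeration a {n. \<xi> n \<omega> = 1}" "prob_space X"
      for a and X :: "(int ^ 'd \<Rightarrow> complex) measure"
      unfolding averages_converge_ae_def
    proof (intro allI impI)
      fix T :: "int ^ 'd \<Rightarrow> _ \<Rightarrow> _" and f :: "_ \<Rightarrow> complex"
      assume T: "measure_preserving_action X T" and f: "integrable X f"
      interpret act: sparse_action X T p \<gamma> "{n. \<xi> n \<omega> = 1}"
        using S T that(2) by (intro sparse_action.intro zd_action.intro zd_action_axioms.intro)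
      show "AE x in X. convergent (\<lambda>N. sparse_average a T f N x)"
        using that(1) f by (rule act.sparse_average_convergent)
    qed
    then show "\<omega> \<notin> exceptional_set M \<xi>" unfolding exceptional_set_def by blast
  qed
next
  fix \<omega> a and X :: "'x measure" and T :: "int ^ 'd \<Rightarrow> 'x \<Rightarrow> 'x" and f :: "'x \<Rightarrow> complex"
  assume \<omega>: "\<omega> \<in> space M - exceptional_set M \<xi>" and a: "norm_enumeration a {n. \<xi> n \<omega> = 1}"
    and X: "prob_space X" "measure_preserving_action X T" "integrable X f"
  \<comment> \<open>Outside the exceptional set, convergence on the fixed type holds by definition,
    so the remaining step is deterministic in \<open>\<omega>\<close>.\<close>
  have "averages_converge_ae a Y" if "prob_space Y" for Y :: "(int ^ 'd \<Rightarrow> complex) measure"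
    using \<omega> a that unfolding exceptional_set_def by blast
  then show "AE x in X. convergent (\<lambda>N. sparse_average a T f N x)"
    using X by (rule averages_converge_ae_transfer)
qed

end
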